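(* No knot invariant taking a unique value on the unknot is of finite type. That is, let $A$ be an abelian group and let $v$ be an $A$-valued knot invariant such that, for every knot $K$, $v(K)=v(\mathrm{unknot})$ implies that $K$ is the unknot. Then $v$ is not a finite-type invariant.
   Context: Knots are (tame, oriented) knots in $S^3$, up to isotopy. A knot invariant $v$ taking values in an abelian group $A$ is extended to singular knots (immersed circles whose only singularities are finitely many transverse double points) by the rule $v(K_\times)=v(K_+)-v(K_-)$, where $K_+$ and $K_-$ are the positive and negative resolutions of a double point of $K_\times$. The invariant $v$ is a finite-type invariant if there exists a positive integer $n$ such that $v(K)=0$ for every singular knot $K$ with more than $n$ singularities (double points). *)

theory Defs
  imports "HOL-Analysis.Analysis"
begin

text \<open>
  Closed curves are functions \<open>real \<Rightarrow> real^4\<close> of period 1 with values in the unit sphere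
  \<open>S\<^sup>3\<close>, the circle being the reals modulo the integers.  They carry the orientation given by the
  increasing direction of the parameter.
\<close>

type_synonym curve = "real \<Rightarrow> real^4"

abbreviation S3 :: "(real^4) set" where
  "S3 \<equiv> sphere 0 1"

definition embedded_circle :: "curve \<Rightarrow> bool" where
  "embedded_circle K \<longleftrightarrow>
     range K \<subseteq> S3 \<and> continuous_on UNIV K \<and> (\<forall>x y. K x = K y \<longleftrightarrow> x - y \<in> \<int>)"

definition immersed_circle :: "curve \<Rightarrow> bool" where
  "immersed_circle K \<longleftrightarrow>
     range K \<subseteq> S3 \<and> (\<forall>x. K (x + 1) = K x) \<and>
     K C1_differentiable_on UNIV \<and> (\<forall>x. vector_derivative K (at x) \<noteq> 0)"

definition ambient_isotopy :: "(real \<Rightarrow> real^4 \<Rightarrow> real^4) \<Rightarrow> bool" where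
  "ambient_isotopy H \<longleftrightarrow>
     continuous_on ({0..1} \<times> S3) (\<lambda>(t, p). H t p) \<and>
     (\<forall>t\<in>{0..1}. \<exists>g. homeomorphism S3 S3 (H t) g) \<and>
     (\<forall>p\<in>S3. H 0 p = p)"

text \<open>
  An increasing homeomorphism of the line commuting with the translation by 1 is a lift of an
  orientation-preserving homeomorphism of the circle; allowing it makes isotopy a relation between
  oriented knots rather than between parametrizations.
\<close>

definition circle_reparam :: "(real \<Rightarrow> real) \<Rightarrow> bool" where
  "circle_reparam \<phi> \<longleftrightarrow>
     continuous_on UNIV \<phi> \<and> strict_mono \<phi> \<and> (\<forall>x. \<phi> (x + 1) = \<phi> x + 1)"

definition isotopic :: "curve \<Rightarrow> curve \<Rightarrow> bool" where
  "isotopic K L \<longleftrightarrow>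
     (\<exists>H \<phi>. ambient_isotopy H \<and> circle_reparam \<phi> \<and> (\<forall>x. H 1 (K x) = L (\<phi> x)))"

text \<open>
  Tameness excludes wild embeddings.  The regular \<open>C\<^sup>1\<close> embedded circles serve as models; they
  represent the same isotopy classes as the polygonal ones or the smooth ones.
\<close>

definition tame_knot :: "curve \<Rightarrow> bool" where
  "tame_knot K \<longleftrightarrow>
     embedded_circle K \<and> (\<exists>L. embedded_circle L \<and> immersed_circle L \<and> isotopic K L)"

definition unknot :: curve where
  "unknot x = vector [cos (2 * pi * x), sin (2 * pi * x), 0, 0]"

definition knot_invariant :: "(curve \<Rightarrow> 'a) \<Rightarrow> bool" where
  "knot_invariant v \<longleftrightarrow>
     (\<forall>K L. tame_knot K \<longrightarrow> tame_knot L \<longrightarrow> isotopic K L \<longrightarrow> v K = v L)"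

text \<open>
  A double point is recorded by its pair of parameters in \<open>{0..<1}\<close>, in increasing order.
\<close>

definition double_points :: "curve \<Rightarrow> (real \<times> real) set" where
  "double_points K = {(x, y). 0 \<le> x \<and> x < y \<and> y < 1 \<and> K x = K y}"

text \<open>
  The injectivity condition says that distinct pairs of parameters have distinct images, that is,
  that there are no points of multiplicity greater than two.  Transversality of two branches of a
  curve in a 3-manifold means that their tangent lines are distinct.  Having no double points is
  allowed, so that every regular \<open>C\<^sup>1\<close> knot is a singular knot with an empty set of double points.
\<close>

definition singular_knot :: "curve \<Rightarrow> bool" where
  "singular_knot K \<longleftrightarrow>
     immersed_circle K \<and> finite (double_points K) \<and>
     inj_on (\<lambda>(x, y). K x) (double_points K) \<and>
     (\<forall>(x, y)\<in>double_points K.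
        dim {vector_derivative K (at x), vector_derivative K (at y)} = 2)"

text \<open>
  \<open>L\<close> is a resolution of the double point \<open>(x, y)\<close> of \<open>K\<close>, positive for \<open>e = 1\<close> and negative for
  \<open>e = -1\<close>, if it is the end of a \<open>C\<^sup>1\<close> family \<open>G t\<close> starting at \<open>K\<close> whose members for \<open>t > 0\<close>
  are singular knots with exactly the other double points of \<open>K\<close>, such that the two branches
  through \<open>(x, y)\<close> are pulled apart in the direction prescribed by \<open>e\<close>.  The usual push-off of one
  strand in a small ball is such a family.  Any two families with the same \<open>e\<close> agree near the
  double point up to isotopy, by the inverse function theorem applied to
  \<open>(t, a, b) \<mapsto> G t a - G t b\<close> at \<open>(0, x, y)\<close> (read in a chart of the sphere).

  \<open>Gt\<close> and \<open>Gx\<close> are the partial derivatives of \<open>G\<close>.  The basis \<open>u\<close>, \<open>w\<close>, \<open>d\<close> of the tangent space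
  at \<open>p \<in> S3\<close> is positive if \<open>det (p, u, w, d) > 0\<close>.  A crossing is positive if (tangent of the
  over-strand, tangent of the under-strand, vector from the under-strand to the over-strand) is
  positive; exchanging the two strands changes the sign of the vector between them as well, so that
  it does not matter which of \<open>x\<close>, \<open>y\<close> is regarded as the over-strand.
\<close>

definition resolution :: "real \<Rightarrow> curve \<Rightarrow> real \<times> real \<Rightarrow> curve \<Rightarrow> bool" where
  "resolution e K c L \<longleftrightarrow>
     (\<exists>G Gt Gx :: real \<Rightarrow> curve.
        (\<forall>t\<in>{0..1}. \<forall>x. ((\<lambda>s. G s x) has_vector_derivative Gt t x) (at t within {0..1})) \<and>
        (\<forall>t\<in>{0..1}. \<forall>x. (G t has_vector_derivative Gx t x) (at x)) \<and>
        continuous_on ({0..1} \<times> UNIV) (\<lambda>(t, x). Gt t x) \<and>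
        continuous_on ({0..1} \<times> UNIV) (\<lambda>(t, x). Gx t x) \<and>
        G 0 = K \<and> G 1 = L \<and>
        (\<forall>t\<in>{0<..1}. singular_knot (G t) \<and> double_points (G t) = double_points K - {c}) \<and>
        (case c of (x, y) \<Rightarrow>
           e * det (vector [K x, Gx 0 x, Gx 0 y, Gt 0 x - Gt 0 y] :: real^4^4) > 0))"

abbreviation positive_resolution :: "curve \<Rightarrow> real \<times> real \<Rightarrow> curve \<Rightarrow> bool" where
  "positive_resolution \<equiv> resolution 1"

abbreviation negative_resolution :: "curve \<Rightarrow> real \<times> real \<Rightarrow> curve \<Rightarrow> bool" where
  "negative_resolution \<equiv> resolution (- 1)"

definition singular_extension :: "(curve \<Rightarrow> 'a::ab_group_add) \<Rightarrow> (curve \<Rightarrow> 'a) \<Rightarrow> bool" where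
  "singular_extension v w \<longleftrightarrow>
     (\<forall>K. singular_knot K \<longrightarrow> double_points K = {} \<longrightarrow> w K = v K) \<and>
     (\<forall>K P N. \<forall>c\<in>double_points K.
        singular_knot K \<longrightarrow> positive_resolution K c P \<longrightarrow> negative_resolution K c N \<longrightarrow>
        w K = w P - w N)"

text \<open>
  The extension of a knot invariant to singular knots exists and its values on singular knots are
  unique, so that the existential quantifier over \<open>w\<close> merely names it.
\<close>

definition finite_type :: "(curve \<Rightarrow> 'a::ab_group_add) \<Rightarrow> bool" where
  "finite_type v \<longleftrightarrow>
     (\<exists>w. singular_extension v w \<and>
        (\<exists>n::nat. n > 0 \<and> (\<forall>K. singular_knot K \<longrightarrow> card (double_points K) > n \<longrightarrow> w K = 0)))"

end

theory Submission
  imports Defs "HOL-Computational_Algebra.Fundamental_Theorem_Algebra"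
begin

text \<open>
  Given a bound \<open>n\<close> on the number of double points, the proof produces a nontrivial
  knot on which every invariant of type at most \<open>n\<close> has the same value as on the
  unknot.
  
  The knots are closed braids on three strands in which two strands stay at rest, in a frame
  rotating with the braid, and the third one moves along a loop \<open>g\<close> in the complex
  plane, the resting strands being at \<open>1\<close> and \<open>-1\<close>. When \<open>g\<close>
  avoids \<open>1\<close> and \<open>-1\<close>, the closed braid \<open>braid_knot g\<close> is a
  knot that depends only on the homotopy class of \<open>g\<close>
  (\<open>braid_knot_homotopic\<close>), that is, on an element of the free group on two generators;
  the trivial element gives the unknot (\<open>braid_knot_const\<close>). A loop that passes through
  \<open>1\<close> or \<open>-1\<close> gives a singular knot with one double point for each
  passage, and pushing the loop off to either side gives the two resolutions
  (\<open>braid_knot_resolution\<close>). A generator is a circle through \<open>0\<close> around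
  \<open>1\<close> or \<open>-1\<close>. Shrinking the circle to a point makes it pass over
  \<open>1\<close> or \<open>-1\<close> once, so the difference of the values on a word with and
  without the letter is, up to sign, the value on a singular knot. Hence a finite-type invariant
  restricts to a polynomial function on the free group, that is, a function annihilated by a power
  of the augmentation ideal (\<open>pol_fun\<close>), and such a function does not tell a
  sufficiently deep iterated commutator from the identity (\<open>deep_commutator\<close>,
  \<open>deep_eq\<close>).
  
  It remains to find deep commutators whose knots are nontrivial. The roots \<open>z\<close> of
  \<open>z ^ 4 - 6 * z\<^sup>2 + 8 * k * z - 3\<close> form a fourfold covering of the
  \<open>k\<close>-plane without \<open>1\<close> and \<open>-1\<close>, and the numbers
  \<open>s\<close> whose squares are such roots form an eightfold one. The monodromy group of the
  latter is \<open>SL(2, 3)\<close>, whose commutator subgroup is the quaternion group of order 8. A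
  commutator of a generator with an element of order 4 of the quaternion group again has order 4, so
  there are commutators of arbitrary depth with monodromy \<open>-1\<close>, i.e. loops along which
  \<open>s\<close> is continued to \<open>-s\<close> (\<open>flipping_word_perm\<close>).
  
  The knot of such a loop is nontrivial. From \<open>s\<close> one writes down a monic cubic in
  \<open>X\<close>, affine in a further variable \<open>z\<close>, that has a double root exactly
  when \<open>z\<close> is at one of the three strands over \<open>k\<close>
  (\<open>cubic_double_root\<close>). Continuing \<open>s\<close> to \<open>-s\<close> changes the
  cubic by \<open>X \<mapsto> -X\<close>, just as one turn around the axis of the braid does, so
  that the cubics fit together to a family of separable cubics over the complement of the knot
  (\<open>braid_knot_cubic_family\<close>). On the disc of points at angle 0, which is bounded by
  the axis, this is the family \<open>X ^ 3 - z * X + d\<close>, with the full symmetric group of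
  degree 3 as monodromy group: there is no continuous choice of a root
  (\<open>no_root_section\<close>), and the discriminant has no continuous square root
  (\<open>no_discriminant_root\<close>). The complement of the unknot is an open solid torus, its
  fundamental group is cyclic, and the monodromy of a family of separable cubics over it either
  fixes a root or permutes the three roots cyclically (\<open>unknotted_cubic_roots\<close>). Hence
  the knot is not the unknot, although the finite-type invariant does not tell it from the unknot.
\<close>

section \<open>Polynomial functions on a free group\<close>

text \<open>
  With words as elements of a free group, \<open>pol_fun k f\<close> says that the linear extension
  of \<open>f\<close> to the group ring vanishes on the \<open>k\<close>-th power of the
  augmentation ideal: all \<open>k\<close>-fold differences, in which each of \<open>k\<close>
  marked letters is either present or absent, are zero.
\<close>

primrec pol_fun :: "nat \<Rightarrow> ('l list \<Rightarrow> 'a::ab_group_add) \<Rightarrow> bool" where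
  "pol_fun 0 f \<longleftrightarrow> (\<forall>v. f v = 0)"
| "pol_fun (Suc k) f \<longleftrightarrow> (\<forall>u x. pol_fun k (\<lambda>v. f (u @ x # v) - f (u @ v)))"

lemma pol_fun_diff: "pol_fun k f \<Longrightarrow> pol_fun k g \<Longrightarrow> pol_fun k (\<lambda>v. f v - g v)"
proof (induction k arbitrary: f g)
  case (Suc k)
  show ?case
  proof (simp, intro allI)
    fix u x
    have "pol_fun k (\<lambda>v. (f (u @ x # v) - f (u @ v)) - (g (u @ x # v) - g (u @ v)))"
      by (rule Suc.IH; use Suc.prems in simp)
    then show "pol_fun k (\<lambda>v. f (u @ x # v) - g (u @ x # v) - (f (u @ v) - g (u @ v)))"
      by (simp add: algebra_simps)
  qed
qed simp

lemma pol_fun_zero: "pol_fun k (\<lambda>v. 0)"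
  by (induction k) auto

lemma pol_fun_uminus: "pol_fun k f \<Longrightarrow> pol_fun k (\<lambda>v. - f v)"
  using pol_fun_diff[OF pol_fun_zero, of k f] by simp

lemma pol_fun_add: "pol_fun k f \<Longrightarrow> pol_fun k g \<Longrightarrow> pol_fun k (\<lambda>v. f v + g v)"
  using pol_fun_diff[OF _ pol_fun_uminus, of k f g] by simp

lemma pol_fun_left: "pol_fun k f \<Longrightarrow> pol_fun k (\<lambda>v. f (t @ v))"
proof (induction k arbitrary: f)
  case (Suc k)
  show ?case
  proof (simp, intro allI)
    fix u x
    show "pol_fun k (\<lambda>v. f (t @ u @ x # v) - f (t @ u @ v))"
      using Suc.prems[simplified, rule_format, of "t @ u" x] by simp
  qed
qed simp

lemma pol_fun_word_diff: "pol_fun (Suc k) f \<Longrightarrow> pol_fun k (\<lambda>v. f (u @ p @ v) - f (u @ v))"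
proof (induction p arbitrary: u)
  case Nil
  then show ?case by (simp add: pol_fun_zero)
next
  case (Cons x p)
  have 1: "pol_fun k (\<lambda>v. f ((u @ [x]) @ p @ v) - f ((u @ [x]) @ v))"
    by (rule Cons.IH) (rule Cons.prems)
  have 2: "pol_fun k (\<lambda>v. f (u @ x # v) - f (u @ v))"
    using Cons.prems by simp
  show ?case using pol_fun_add[OF 1 2] by simp
qed

text \<open>
  The involution \<open>inv1\<close> sends a letter to its formal inverse. Words are not reduced;
  functions on the free group are the functions on words that satisfy \<open>reduced_fun\<close>.
\<close>

locale free_words =
  fixes inv1 :: "'l \<Rightarrow> 'l"
  assumes inv1_inv1 [simp]: "inv1 (inv1 x) = x"
begin

definition winv :: "'l list \<Rightarrow> 'l list" where
  "winv w = rev (map inv1 w)"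

definition commutator :: "'l list \<Rightarrow> 'l list \<Rightarrow> 'l list" where
  "commutator p q = p @ q @ winv p @ winv q"

definition reduced_fun :: "('l list \<Rightarrow> 'a) \<Rightarrow> bool" where
  "reduced_fun f \<longleftrightarrow> (\<forall>u x v. f (u @ x # inv1 x # v) = f (u @ v))"

lemma winv_winv [simp]: "winv (winv w) = w"
  by (simp add: winv_def rev_map comp_def)

lemma winv_append: "winv (u @ v) = winv v @ winv u"
  by (simp add: winv_def)

lemma reduced_fun_cancel: "reduced_fun f \<Longrightarrow> f (u @ p @ winv p @ v) = f (u @ v)"
proof (induction p arbitrary: u v)
  case (Cons x p)
  have "f (u @ (x # p) @ winv (x # p) @ v) = f ((u @ [x]) @ p @ winv p @ (inv1 x # v))"
    by (simp add: winv_def)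
  also have "\<dots> = f ((u @ [x]) @ inv1 x # v)"
    by (rule Cons.IH) (rule Cons.prems)
  finally show ?case using Cons.prems by (simp add: reduced_fun_def)
qed (simp add: winv_def)

text \<open>
  Inserting or deleting \<open>p\<close> lowers the degree of every polynomial function by
  \<open>j\<close>, as it does if \<open>p - 1\<close> is in the \<open>j\<close>-th power of the
  augmentation ideal. The type argument fixes the group in which the functions take their values.
\<close>

definition deep :: "'a::ab_group_add itself \<Rightarrow> nat \<Rightarrow> 'l list \<Rightarrow> bool" where
  "deep T j p \<longleftrightarrow> (\<forall>k (f :: 'l list \<Rightarrow> 'a::ab_group_add) u.
     pol_fun (k + j) f \<longrightarrow> reduced_fun f \<longrightarrow> pol_fun k (\<lambda>v. f (u @ p @ v) - f (u @ v)))"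

lemma deep_1: "deep T 1 p"
  unfolding deep_def using pol_fun_word_diff by (auto simp del: pol_fun.simps)

lemma reduced_fun_diff:
  "reduced_fun f \<Longrightarrow> reduced_fun (\<lambda>v. f (u @ p @ v) - f (u @ v))"
  unfolding reduced_fun_def by (metis append.assoc)

lemma deep_second_difference:
  fixes f :: "'l list \<Rightarrow> 'a::ab_group_add"
  assumes "deep TYPE('a) i p" "deep TYPE('a) j q" "pol_fun (k + (i + j)) f" "reduced_fun f"
  shows "pol_fun k (\<lambda>v. f (u @ p @ q @ v) - f (u @ q @ v) - (f (u @ p @ v) - f (u @ v)))"
proof -
  \<comment> \<open>The depth of the first word is used on f, the depth of the second one on the difference.\<close>
  define H where "H = (\<lambda>v. f (u @ p @ v) - f (u @ v))"
  have "pol_fun ((k + j) + i) f" using assms(3) by (simp add: ac_simps)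
  then have "pol_fun (k + j) H" "reduced_fun H"
    using assms unfolding deep_def H_def by (auto intro!: reduced_fun_diff)
  then have "pol_fun k (\<lambda>v. H ([] @ q @ v) - H ([] @ v))"
    using assms(2) unfolding deep_def by blast
  then show ?thesis by (simp add: H_def)
qed

text \<open>
  In the group ring, \<open>p * q - q * p = (p - 1) * (q - 1) - (q - 1) * (p - 1)\<close>, so that
  the depths add up; multiplying by the inverses of \<open>p\<close> and \<open>q\<close> turns the
  left-hand side into the commutator minus 1.
\<close>

lemma deep_commutator:
  assumes "deep TYPE('a::ab_group_add) i p" "deep TYPE('a) j q"
  shows "deep TYPE('a) (i + j) (commutator p q)"
  unfolding deep_def
proof (intro allI impI)
  fix k and f :: "'l list \<Rightarrow> 'a" and u
  assume f: "pol_fun (k + (i + j)) f" "reduced_fun f"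
  let ?D = "\<lambda>p q v. f (u @ p @ q @ v) - f (u @ q @ v) - (f (u @ p @ v) - f (u @ v))"
  have "pol_fun k (?D p q)"
    using assms f by (rule deep_second_difference)
  moreover have "pol_fun k (?D q p)"
    using assms(2,1) f by (intro deep_second_difference[where i = j and j = i]) (simp_all add: add.commute)
  ultimately have "pol_fun k (\<lambda>v. ?D p q v - ?D q p v)"
    by (rule pol_fun_diff)
  then have "pol_fun k (\<lambda>v. f (u @ p @ q @ v) - f (u @ q @ p @ v))"
    by (simp add: algebra_simps)
  from pol_fun_left[OF this, of "winv p @ winv q"]
  have "pol_fun k (\<lambda>v. f (u @ commutator p q @ v) - f (u @ q @ p @ winv p @ winv q @ v))"
    by (simp add: commutator_def)
  moreover have "f (u @ q @ p @ winv p @ winv q @ v) = f (u @ v)" for v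
    using f(2) reduced_fun_cancel[of f "u @ q" p "winv q @ v"] reduced_fun_cancel[of f u q v] by simp
  ultimately show "pol_fun k (\<lambda>v. f (u @ commutator p q @ v) - f (u @ v))"
    by simp
qed

lemma deep_eq:
  assumes "deep TYPE('a) j p" "pol_fun j (f :: 'l list \<Rightarrow> 'a::ab_group_add)" "reduced_fun f"
  shows "f p = f []"
proof -
  have "pol_fun 0 (\<lambda>v. f ([] @ p @ v) - f ([] @ v))"
    using assms unfolding deep_def by (metis add_0)
  then have "f ([] @ p @ []) - f ([] @ []) = 0" by (simp del: append_Nil append_Nil2)
  then show ?thesis by simp
qed

end

section \<open>Continuous families of separable polynomials\<close>

text \<open>
  Coefficients need not be mentioned: for monic polynomials of fixed degree, continuity of all the
  values is the same as continuity of the coefficients.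
\<close>

definition root_family :: "'b::topological_space set \<Rightarrow> nat \<Rightarrow> ('b \<Rightarrow> complex poly) \<Rightarrow> bool" where
  "root_family S d P \<longleftrightarrow>
     (\<forall>b\<in>S. lead_coeff (P b) = 1 \<and> degree (P b) = d \<and> rsquarefree (P b)) \<and>
     (\<forall>X. continuous_on S (\<lambda>b. poly (P b) X))"

lemma root_family_poly_eq:
  assumes "root_family S d P" "b \<in> S"
  shows "poly (P b) X = (\<Prod>z | poly (P b) z = 0. X - z)" "card {z. poly (P b) z = 0} = d"
    "finite {z. poly (P b) z = 0}"
proof -
  have 1: "lead_coeff (P b) = 1" "degree (P b) = d" "rsquarefree (P b)"
    using assms by (auto simp: root_family_def)
  have eq: "P b = (\<Prod>z | poly (P b) z = 0. [:-z, 1:])"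
    using complex_poly_decompose_rsquarefree[OF 1(3)] 1(1) by simp
  then have "poly (P b) X = poly (\<Prod>z | poly (P b) z = 0. [:-z, 1:]) X"
    by simp
  then show "poly (P b) X = (\<Prod>z | poly (P b) z = 0. X - z)"
    by (simp add: poly_prod)
  show "finite {z. poly (P b) z = 0}"
    using 1 by (intro poly_roots_finite) auto
  have "d = degree (\<Prod>z | poly (P b) z = 0. [:-z, 1:])"
    using 1(2) eq by simp
  also have "\<dots> = (\<Sum>z | poly (P b) z = 0. degree [:-z, 1:])"
    by (rule degree_prod_sum_eq) auto
  finally show "card {z. poly (P b) z = 0} = d" by simp
qed

lemma root_family_pos:
  assumes "root_family S d P" "b \<in> S" "poly (P b) X = 0"
  shows "d > 0"
proof -
  have "{z. poly (P b) z = 0} \<noteq> {}" using assms(3) by auto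
  then have "card {z. poly (P b) z = 0} > 0"
    using root_family_poly_eq(3)[OF assms(1,2)] by (simp add: card_gt_0_iff)
  then show ?thesis
    by (simp only: root_family_poly_eq(2)[OF assms(1,2)])
qed

text \<open>
  The absolute value of a monic polynomial at \<open>X\<close> is the product of the distances from
  \<open>X\<close> to the roots, so a small value forces a root near \<open>X\<close>.
\<close>

lemma root_family_near:
  assumes P: "root_family S d P" and b: "b \<in> S" and X: "poly (P b) X = 0" and e: "\<epsilon> > 0"
  shows "eventually (\<lambda>b'. \<exists>Y\<in>ball X \<epsilon>. poly (P b') Y = 0) (at b within S)"
proof -
  have "continuous_on S (\<lambda>b. poly (P b) X)"
    using P by (simp add: root_family_def)
  then have "((\<lambda>b. poly (P b) X) \<longlongrightarrow> 0) (at b within S)"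
    using b X by (auto simp: continuous_on_def)
  then have "eventually (\<lambda>b'. dist (poly (P b') X) 0 < \<epsilon> ^ d) (at b within S)"
    using e by (intro tendstoD) auto
  moreover have "eventually (\<lambda>b'. b' \<in> S) (at b within S)"
    by (simp add: eventually_at_filter)
  ultimately show ?thesis
  proof eventually_elim
    case (elim b')
    show ?case
    proof (rule ccontr)
      assume "\<not> ?thesis"
      then have far: "norm (X - z) \<ge> \<epsilon>" if "poly (P b') z = 0" for z
        using that by (auto simp: dist_norm not_less)
      have "\<epsilon> ^ d = (\<Prod>z | poly (P b') z = 0. \<epsilon>)"
        by (simp only: prod_constant root_family_poly_eq(2)[OF P elim(2)])
      also have "\<dots> \<le> (\<Prod>z | poly (P b') z = 0. norm (X - z))"
        using far e by (intro prod_mono) auto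
      also have "\<dots> = norm (poly (P b') X)"
        by (subst root_family_poly_eq(1)[OF P elim(2)]) (simp only: prod_norm)
      finally show False using elim(1) by simp
    qed
  qed
qed

text \<open>
  Near \<open>b\<close> each of the \<open>d\<close> disjoint balls around the roots at
  \<open>b\<close> contains a root; since there are only \<open>d\<close> roots, it contains exactly
  one.
\<close>

lemma root_family_local:
  assumes P: "root_family S d P" and b: "b \<in> S"
  obtains \<epsilon> T where "\<epsilon> > 0" "b \<in> T" "openin (top_of_set S) T"
    "\<And>x y. poly (P b) x = 0 \<Longrightarrow> poly (P b) y = 0 \<Longrightarrow> x \<noteq> y \<Longrightarrow> ball x \<epsilon> \<inter> ball y \<epsilon> = {}"
    "\<And>b' x. b' \<in> T \<Longrightarrow> poly (P b) x = 0 \<Longrightarrow> \<exists>!Y. Y \<in> ball x \<epsilon> \<and> poly (P b') Y = 0"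
    "\<And>b' Y. b' \<in> T \<Longrightarrow> poly (P b') Y = 0 \<Longrightarrow> \<exists>x. poly (P b) x = 0 \<and> Y \<in> ball x \<epsilon>"
proof -
  define Z where "Z = {z. poly (P b) z = 0}"
  have fin: "finite Z" and card: "card Z = d"
    using root_family_poly_eq(2,3)[OF P b] by (auto simp: Z_def)
  obtain \<delta> where \<delta>: "\<delta> > 0" "\<And>x y. x \<in> Z \<Longrightarrow> y \<in> Z \<Longrightarrow> x \<noteq> y \<Longrightarrow> \<delta> \<le> dist x y"
  proof (cases "{(x, y). x \<in> Z \<and> y \<in> Z \<and> x \<noteq> y} = {}")
    case True
    then show ?thesis using that[of 1] by auto
  next
    case False
    let ?D = "(\<lambda>(x, y). dist x y) ` {(x, y). x \<in> Z \<and> y \<in> Z \<and> x \<noteq> y}"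
    have "finite {(x, y). x \<in> Z \<and> y \<in> Z \<and> x \<noteq> y}"
      by (rule finite_subset[of _ "Z \<times> Z"]) (use fin in auto)
    then have f: "finite ?D" by simp
    have "Min ?D \<in> ?D" using False f by (intro Min_in) auto
    then have "Min ?D > 0" by auto
    moreover have "Min ?D \<le> dist x y" if "x \<in> Z" "y \<in> Z" "x \<noteq> y" for x y
      using f that by (intro Min_le) auto
    ultimately show ?thesis using that by blast
  qed
  define \<epsilon> where "\<epsilon> = \<delta> / 2"
  have \<epsilon>: "\<epsilon> > 0" using \<delta> by (simp add: \<epsilon>_def)
  have disj: "ball x \<epsilon> \<inter> ball y \<epsilon> = {}" if "x \<in> Z" "y \<in> Z" "x \<noteq> y" for x y
  proof -
    have False if "dist x w < \<epsilon>" "dist y w < \<epsilon>" for w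
      using \<delta>(2)[OF \<open>x \<in> Z\<close> \<open>y \<in> Z\<close> \<open>x \<noteq> y\<close>] that dist_triangle2[of x y w] by (simp add: \<epsilon>_def)
    then show ?thesis by auto
  qed
  have "eventually (\<lambda>b'. \<forall>x\<in>Z. \<exists>Y\<in>ball x \<epsilon>. poly (P b') Y = 0) (at b within S)"
    unfolding eventually_ball_finite_distrib[OF fin]
    using root_family_near[OF P b _ \<epsilon>] by (simp add: Z_def)
  then obtain T0 where T0: "open T0" "b \<in> T0"
    "\<And>b'. b' \<in> T0 \<Longrightarrow> b' \<noteq> b \<Longrightarrow> b' \<in> S \<Longrightarrow> \<forall>x\<in>Z. \<exists>Y\<in>ball x \<epsilon>. poly (P b') Y = 0"
    by (auto simp: eventually_at_topological)
  define T where "T = S \<inter> T0"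
  have ex: "\<exists>Y\<in>ball x \<epsilon>. poly (P b') Y = 0" if "b' \<in> T" "x \<in> Z" for b' x
    using T0(3)[of b'] that \<epsilon> by (cases "b' = b") (auto simp: T_def Z_def)
  have all: "\<exists>f. bij_betw f Z {z. poly (P b') z = 0} \<and> (\<forall>x\<in>Z. f x \<in> ball x \<epsilon>)" if b': "b' \<in> T" for b'
  proof -
    obtain f where f: "\<And>x. x \<in> Z \<Longrightarrow> f x \<in> ball x \<epsilon> \<and> poly (P b') (f x) = 0"
      using ex[OF b'] by metis
    have inj: "inj_on f Z"
      using disj f by (force simp: inj_on_def)
    have "f ` Z = {z. poly (P b') z = 0}"
    proof (rule card_subset_eq)
      show "finite {z. poly (P b') z = 0}" "card (f ` Z) = card {z. poly (P b') z = 0}"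
        using root_family_poly_eq(2,3)[OF P, of b'] b' card_image[OF inj] card by (auto simp: T_def)
    qed (use f in auto)
    then show ?thesis using inj f by (auto simp: bij_betw_def)
  qed
  show thesis
  proof (rule that[of \<epsilon> T])
    show "\<epsilon> > 0" "b \<in> T" "openin (top_of_set S) T"
      using \<epsilon> b T0 by (auto simp: T_def)
    show "ball x \<epsilon> \<inter> ball y \<epsilon> = {}" if "poly (P b) x = 0" "poly (P b) y = 0" "x \<noteq> y" for x y
      using disj that by (simp add: Z_def)
    fix b' assume b': "b' \<in> T"
    obtain f where f: "bij_betw f Z {z. poly (P b') z = 0}" "\<And>x. x \<in> Z \<Longrightarrow> f x \<in> ball x \<epsilon>"
      using all[OF b'] by blast
    have root: "\<exists>y\<in>Z. Y = f y" if "poly (P b') Y = 0" for Y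
      using f(1) that by (auto simp: bij_betw_def)
    show "\<exists>!Y. Y \<in> ball x \<epsilon> \<and> poly (P b') Y = 0" if "poly (P b) x = 0" for x
    proof (rule ex1I[of _ "f x"])
      have x: "x \<in> Z" using that by (simp add: Z_def)
      then show "f x \<in> ball x \<epsilon> \<and> poly (P b') (f x) = 0"
        using f by (auto simp: bij_betw_def)
      fix Y assume Y: "Y \<in> ball x \<epsilon> \<and> poly (P b') Y = 0"
      then obtain y where "y \<in> Z" "Y = f y" using root by blast
      then show "Y = f x" using disj[of x y] f(2)[of y] Y x by blast
    qed
    show "\<exists>x. poly (P b) x = 0 \<and> Y \<in> ball x \<epsilon>" if "poly (P b') Y = 0" for Y
      using root[OF that] f(2) by (auto simp: Z_def)
  qed
qed

lemma root_family_covering: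
  assumes P: "root_family S d P" and d: "d > 0"
  shows "covering_space {(b, X). b \<in> S \<and> poly (P b) X = 0} fst S" (is "covering_space ?C _ _")
proof
  show "continuous_on ?C fst" by (intro continuous_intros)
  have "\<exists>X. poly (P b) X = 0" if "b \<in> S" for b
  proof (rule ccontr)
    assume "\<not> ?thesis"
    then have "{X. poly (P b) X = 0} = {}" by simp
    then show False using root_family_poly_eq(2)[OF P that] d by simp
  qed
  then show "fst ` ?C = S" by (force simp: image_iff)
  fix b assume b: "b \<in> S"
  obtain \<epsilon> T where eT: "\<epsilon> > 0" "b \<in> T" "openin (top_of_set S) T"
    and disj: "\<And>x y. poly (P b) x = 0 \<Longrightarrow> poly (P b) y = 0 \<Longrightarrow> x \<noteq> y \<Longrightarrow> ball x \<epsilon> \<inter> ball y \<epsilon> = {}"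
    and ex1: "\<And>b' x. b' \<in> T \<Longrightarrow> poly (P b) x = 0 \<Longrightarrow> \<exists>!Y. Y \<in> ball x \<epsilon> \<and> poly (P b') Y = 0"
    and all: "\<And>b' Y. b' \<in> T \<Longrightarrow> poly (P b') Y = 0 \<Longrightarrow> \<exists>x. poly (P b) x = 0 \<and> Y \<in> ball x \<epsilon>"
    by (rule root_family_local[OF P b]) blast
  have TS: "T \<subseteq> S" using eT(3) openin_imp_subset by blast
  define u where "u x = {(b', Y). b' \<in> T \<and> Y \<in> ball x \<epsilon> \<and> poly (P b') Y = 0}" for x
  define v where "v = u ` {x. poly (P b) x = 0}"
  have "\<exists>q. homeomorphism (u x) T fst q" if x: "poly (P b) x = 0" for x
  proof -
    define r where "r b' = (THE Y. Y \<in> ball x \<epsilon> \<and> poly (P b') Y = 0)" for b'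
    have r: "r b' \<in> ball x \<epsilon>" "poly (P b') (r b') = 0" if "b' \<in> T" for b'
      using theI'[OF ex1[OF that x]] by (auto simp: r_def)
    have runiq: "Y = r b'" if "b' \<in> T" "Y \<in> ball x \<epsilon>" "poly (P b') Y = 0" for b' Y
      using ex1[OF that(1) x] r[OF that(1)] that by blast
    have "continuous_on T r"
      unfolding continuous_on_def
    proof
      fix b1 assume b1: "b1 \<in> T"
      show "(r \<longlongrightarrow> r b1) (at b1 within T)"
      proof (rule tendstoI)
        fix e :: real assume e: "e > 0"
        have "open (ball (r b1) e \<inter> ball x \<epsilon>)" "r b1 \<in> ball (r b1) e \<inter> ball x \<epsilon>"
          using r[OF b1] e by auto
        then obtain e' where e': "e' > 0" "ball (r b1) e' \<subseteq> ball (r b1) e \<inter> ball x \<epsilon>"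
          by (meson openE)
        have "eventually (\<lambda>b'. \<exists>Y\<in>ball (r b1) e'. poly (P b') Y = 0) (at b1 within S)"
          using root_family_near[OF P _ _ e'(1)] r[OF b1] b1 TS by auto
        then have "eventually (\<lambda>b'. \<exists>Y\<in>ball (r b1) e'. poly (P b') Y = 0) (at b1 within T)"
          using TS at_le filter_leD by blast
        moreover have "eventually (\<lambda>b'. b' \<in> T) (at b1 within T)"
          by (simp add: eventually_at_filter)
        ultimately show "eventually (\<lambda>b'. dist (r b') (r b1) < e) (at b1 within T)"
        proof eventually_elim
          case (elim b')
          then obtain Y where Y: "Y \<in> ball (r b1) e'" "poly (P b') Y = 0" by blast
          then have "Y = r b'" using runiq[of b' Y] elim(2) e'(2) by blast
          then show ?case using Y(1) e'(2) by (auto simp: dist_commute)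
        qed
      qed
    qed
    have "homeomorphism (u x) T fst (\<lambda>b'. (b', r b'))"
    proof
      show "continuous_on (u x) fst" by (intro continuous_intros)
      show "continuous_on T (\<lambda>b'. (b', r b'))" using \<open>continuous_on T r\<close> by (intro continuous_intros)
      show "fst ` u x \<subseteq> T" by (auto simp: u_def)
      show "(\<lambda>b'. (b', r b')) ` T \<subseteq> u x" using r by (auto simp: u_def simp del: mem_ball)
      show "(fst p, r (fst p)) = p" if "p \<in> u x" for p
        using runiq[of "fst p" "snd p"] that by (auto simp: u_def simp del: mem_ball)
    qed simp
    then show ?thesis by blast
  qed
  moreover have "openin (top_of_set ?C) (u x)" for x
  proof -
    obtain T1 where T1: "open T1" "T = S \<inter> T1" using eT(3) by (auto simp: openin_open)
    have "u x = ?C \<inter> (T1 \<times> ball x \<epsilon>)" by (auto simp: u_def T1)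
    then show ?thesis using T1(1) by (auto simp: openin_open intro!: open_Times)
  qed
  moreover have "pairwise disjnt v"
  proof -
    have "disjnt (u x) (u y)" if "poly (P b) x = 0" "poly (P b) y = 0" "u x \<noteq> u y" for x y
    proof -
      have "x \<noteq> y" using that(3) by auto
      from disj[OF that(1,2) this] show ?thesis
        unfolding disjnt_def u_def by blast
    qed
    then show ?thesis unfolding pairwise_def v_def by blast
  qed
  moreover have "\<Union>v = ?C \<inter> fst -` T"
    using all TS by (auto simp: v_def u_def simp del: mem_ball)
  ultimately show "\<exists>T. b \<in> T \<and> openin (top_of_set S) T \<and>
      (\<exists>v. \<Union> v = ?C \<inter> fst -` T \<and> (\<forall>u\<in>v. openin (top_of_set ?C) u) \<and> pairwise disjnt v \<and>
        (\<forall>u\<in>v. \<exists>q. homeomorphism u T fst q))"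
    using eT by (intro exI[of _ T] conjI exI[of _ v]) (auto simp: v_def)
qed

lemma root_lift_exists:
  fixes U :: "'b::real_normed_vector set"
  assumes P: "root_family U d P" and U: "convex U" and u: "u \<in> U" and x: "poly (P u) x = 0"
  obtains g where "continuous_on U g" "g u = x" "\<And>y. y \<in> U \<Longrightarrow> poly (P y) (g y) = 0"
proof -
  have "d > 0"
    by (rule root_family_pos[OF P u x])
  then have cov: "covering_space {(b, X). b \<in> U \<and> poly (P b) X = 0} fst U"
    using root_family_covering[OF P] by simp
  obtain g where g: "continuous_on U g" "g \<in> U \<rightarrow> {(b, X). b \<in> U \<and> poly (P b) X = 0}" "g u = (u, x)"
    "\<And>y. y \<in> U \<Longrightarrow> fst (g y) = y"
    by (rule covering_space_lift_strong[OF cov, of "(u, x)" u U "\<lambda>x. x"])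
       (use u x U in \<open>auto intro: convex_imp_simply_connected convex_imp_locally_path_connected\<close>)
  show thesis
  proof (rule that[of "\<lambda>y. snd (g y)"])
    show "continuous_on U (\<lambda>y. snd (g y))" using g(1) by (intro continuous_intros)
    show "snd (g u) = x" using g(3) by simp
    show "poly (P y) (snd (g y)) = 0" if "y \<in> U" for y
    proof -
      have "g y \<in> {(b, X). b \<in> U \<and> poly (P b) X = 0}" using g(2) that by (rule Pi_mem)
      then show ?thesis using g(4)[OF that] by (auto simp: case_prod_beta)
    qed
  qed
qed

lemma root_lift_unique:
  fixes U :: "'b::real_normed_vector set"
  assumes P: "root_family U d P" and U: "connected U" and u: "u \<in> U" "y \<in> U"
    and f: "continuous_on U f" "\<And>y. y \<in> U \<Longrightarrow> poly (P y) (f y) = 0"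
    and g: "continuous_on U g" "\<And>y. y \<in> U \<Longrightarrow> poly (P y) (g y) = 0"
    and eq: "f u = g u"
  shows "f y = g y"
proof -
  have "d > 0"
    by (rule root_family_pos[OF P u(1) f(2)[OF u(1)]])
  then have cov: "covering_space {(b, X). b \<in> U \<and> poly (P b) X = 0} fst U"
    using root_family_covering[OF P] by simp
  have "(y, f y) = (y, g y)"
    by (rule covering_space_lift_unique[OF cov, of "\<lambda>y. (y, f y)" u "\<lambda>y. (y, g y)" U "\<lambda>y. y"])
       (use assms in \<open>auto intro!: continuous_intros\<close>)
  then show ?thesis by simp
qed

section \<open>A continuously differentiable step\<close>

text \<open>
  A quadratic spline of class \<open>C\<^sup>1\<close> that is constant outside the unit interval.
  Paths reparametrized by it start and end with velocity zero and can be concatenated within the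
  \<open>C\<^sup>1\<close> paths. The closed formula, rather than a definition by cases, makes
  symmetry and differentiability computations.
\<close>

definition smoothstep :: "real \<Rightarrow> real" where
  "smoothstep t = 1/2 + t * \<bar>t\<bar> - 2 * ((t - 1/2) * \<bar>t - 1/2\<bar>) + (t - 1) * \<bar>t - 1\<bar>"

lemma smoothstep_left [simp]: "t \<le> 0 \<Longrightarrow> smoothstep t = 0"
  and smoothstep_right [simp]: "t \<ge> 1 \<Longrightarrow> smoothstep t = 1"
  by (auto simp: smoothstep_def abs_if algebra_simps)

lemma smoothstep_first_half: "0 \<le> t \<Longrightarrow> t \<le> 1/2 \<Longrightarrow> smoothstep t = 2 * t\<^sup>2"
  by (auto simp: smoothstep_def abs_if algebra_simps power2_eq_square)

lemma smoothstep_reverse: "smoothstep (1 - t) = 1 - smoothstep t"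
  by (auto simp: smoothstep_def abs_if algebra_simps)

lemma smoothstep_half [simp]: "smoothstep (1/2) = 1/2"
  by (simp add: smoothstep_def)

lemma smoothstep_less_half:
  assumes "0 < t" "t < 1/2" shows "0 < smoothstep t" "smoothstep t < 1/2"
proof -
  have "t\<^sup>2 < (1/2)\<^sup>2" using assms by (intro power_strict_mono) auto
  then show "0 < smoothstep t" "smoothstep t < 1/2"
    using assms by (auto simp: smoothstep_first_half power2_eq_square)
qed

lemma smoothstep_greater_half:
  assumes "1/2 < t" "t < 1" shows "1/2 < smoothstep t" "smoothstep t < 1"
  using smoothstep_less_half[of "1 - t"] assms by (auto simp: smoothstep_reverse)

lemma smoothstep_half' [simp]: "t * 2 = 1 \<Longrightarrow> smoothstep t * 2 = 1"
proof -
  assume "t * 2 = 1"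
  then have "t = 1/2" by simp
  then show ?thesis by (simp only: smoothstep_half)
qed

lemma smoothstep_strict: "0 < t \<Longrightarrow> t < 1 \<Longrightarrow> 0 < smoothstep t \<and> smoothstep t < 1"
proof (cases t "1/2 :: real" rule: linorder_cases)
  case equal
  then have "smoothstep t * 2 = 1" by simp
  then show ?thesis by linarith
qed (use smoothstep_less_half[of t] smoothstep_greater_half[of t] in auto)

lemma smoothstep_eq_half: "smoothstep t = 1/2 \<longleftrightarrow> t = 1/2"
  using smoothstep_less_half(2)[of t] smoothstep_greater_half(1)[of t] smoothstep_left[of t] smoothstep_right[of t]
  by (cases "t \<le> 0"; cases "t \<ge> 1"; cases t "1/2::real" rule: linorder_cases) auto

lemma mult_abs_deriv: "((\<lambda>t::real. t * \<bar>t\<bar>) has_real_derivative 2 * \<bar>t\<bar>) (at t)"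
proof (cases t "0 :: real" rule: linorder_cases)
  case less
  have "((\<lambda>t::real. - t\<^sup>2) has_real_derivative 2 * \<bar>t\<bar>) (at t)"
    using less by (auto intro!: derivative_eq_intros)
  then show ?thesis
    by (rule has_field_derivative_transform_within_open[where S = "{..<0}"])
       (use less in \<open>auto simp: power2_eq_square\<close>)
next
  case equal
  have "((\<lambda>h. \<bar>h\<bar>) \<longlongrightarrow> 0) (at (0::real))"
    by (rule tendsto_eq_intros | simp)+
  then have "((\<lambda>h. h * \<bar>h\<bar> / h) \<longlongrightarrow> 0) (at (0::real))"
    by (rule Lim_transform_eventually) (auto simp: eventually_at_filter)
  then show ?thesis using equal by (simp add: DERIV_def)
next
  case greater
  have "((\<lambda>t::real. t\<^sup>2) has_real_derivative 2 * \<bar>t\<bar>) (at t)"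
    using greater by (auto intro!: derivative_eq_intros)
  then show ?thesis
    by (rule has_field_derivative_transform_within_open[where S = "{0<..}"])
       (use greater in \<open>auto simp: power2_eq_square\<close>)
qed

definition smoothstep' :: "real \<Rightarrow> real" where
  "smoothstep' t = 2 * \<bar>t\<bar> - 4 * \<bar>t - 1/2\<bar> + 2 * \<bar>t - 1\<bar>"

lemma smoothstep_deriv: "(smoothstep has_real_derivative smoothstep' t) (at t)"
proof -
  have shift: "((\<lambda>t::real. (t - c) * \<bar>t - c\<bar>) has_real_derivative 2 * \<bar>t - c\<bar>) (at t)" for c
  proof -
    have "((\<lambda>t. t - c) has_real_derivative 1) (at t)" by (auto intro!: derivative_eq_intros)
    from DERIV_chain2[OF mult_abs_deriv this] show ?thesis by simp
  qed
  show ?thesis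
    unfolding smoothstep_def[abs_def] smoothstep'_def
    by (rule derivative_eq_intros shift mult_abs_deriv refl)+ simp
qed

lemma continuous_smoothstep' [continuous_intros]:
  "continuous_on A f \<Longrightarrow> continuous_on A (\<lambda>x. smoothstep' (f x))"
  unfolding smoothstep'_def by (intro continuous_intros)

lemma continuous_smoothstep [continuous_intros]:
  "continuous_on A f \<Longrightarrow> continuous_on A (\<lambda>x. smoothstep (f x))"
  unfolding smoothstep_def by (intro continuous_intros)

section \<open>A quartic ramified over 1 and -1\<close>

text \<open>
  At \<open>k = 1\<close> the quartic is \<open>(z - 1) ^ 3 * (z + 3)\<close> and at \<open>k =
  -1\<close> it is \<open>(z + 1) ^ 3 * (z - 3)\<close>; elsewhere it is separable. Three sheets
  meet over each ramification point, and the two 3-cycles generate the alternating group of degree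
  4.
\<close>

definition quartic :: "complex \<Rightarrow> complex poly" where
  "quartic k = [:-3, 8 * k, -6, 0, 1:]"

lemma quartic_eval: "poly (quartic k) z = z ^ 4 - 6 * z\<^sup>2 + 8 * k * z - 3"
  by (simp add: quartic_def algebra_simps eval_nat_numeral)

lemma quartic_family:
  fixes g :: "'b::topological_space \<Rightarrow> complex"
  assumes "continuous_on U g" "\<And>t. t \<in> U \<Longrightarrow> g t \<noteq> 1 \<and> g t \<noteq> -1"
  shows "root_family U 4 (\<lambda>t. quartic (g t))"
proof -
  have "rsquarefree (quartic k)" if k: "k \<noteq> 1" "k \<noteq> -1" for k
    unfolding rsquarefree_roots
  proof safe
    fix z assume z: "poly (quartic k) z = 0" "poly (pderiv (quartic k)) z = 0"
    have "4 * z ^ 3 - 12 * z + 8 * k = 0"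
      using z(2) by (simp add: quartic_def pderiv_pCons algebra_simps eval_nat_numeral)
    then have kz: "2 * k = 3 * z - z ^ 3" by algebra
    with z(1) have "(z\<^sup>2 - 1)\<^sup>2 = 0" unfolding quartic_eval by algebra
    then have "z = 1 \<or> z = -1" by (simp add: power2_eq_1_iff)
    with kz k show False by auto
  qed
  then show ?thesis
    using assms by (auto simp: root_family_def quartic_def intro!: continuous_intros)
qed

lemma quartic_two_roots:
  assumes "poly (quartic k) x = 0" "poly (quartic k) y = 0" "x \<noteq> y"
  shows "8 * k * (x * y) = (x + y) * ((x * y)\<^sup>2 + 3)"
proof -
  have "(x - y) * ((x + y) * (x\<^sup>2 + y\<^sup>2) - 6 * (x + y) + 8 * k) = 0"
    using assms(1,2) unfolding quartic_eval by algebra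
  then have 1: "(x + y) * (x\<^sup>2 + y\<^sup>2) - 6 * (x + y) + 8 * k = 0" using assms(3) by simp
  have "(x - y) * (x * y * (x\<^sup>2 + x * y + y\<^sup>2) - 6 * (x * y) + 3) = 0"
    using assms(1,2) unfolding quartic_eval by algebra
  then have 2: "x * y * (x\<^sup>2 + x * y + y\<^sup>2) - 6 * (x * y) + 3 = 0" using assms(3) by simp
  show ?thesis using 1 2 by algebra
qed

text \<open>
  Eliminating \<open>k\<close> between two roots gives the relation
  \<open>quartic_two_roots\<close>, which for \<open>k = 2\<close> cannot hold for two numbers with
  positive product and negative sum.
\<close>

lemma quartic_left_root_unique:
  assumes x: "poly (quartic 2) x = 0" "Re x < 0" and y: "poly (quartic 2) y = 0" "Re y < 0"
  shows "x = y" "cnj x = x"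
proof -
  have pair: False if "poly (quartic 2) a = 0" "poly (quartic 2) b = 0" "a \<noteq> b"
    and v: "a * b = of_real v" "v > 0" and u: "a + b = of_real u" "u < 0" for a b u v
  proof -
    have "of_real (16 * v) = (of_real (u * (v\<^sup>2 + 3)) :: complex)"
      using quartic_two_roots[OF that(1-3)] v u by simp
    then have "16 * v = u * (v\<^sup>2 + 3)" by (simp only: of_real_eq_iff)
    moreover have "u * (v\<^sup>2 + 3) < 0" using u(2) by (intro mult_neg_pos) (auto intro: add_nonneg_pos)
    ultimately show False using v(2) by simp
  qed
  have real: "cnj a = a" if "poly (quartic 2) a = 0" "Re a < 0" for a
  proof (rule ccontr)
    assume ne: "cnj a \<noteq> a"
    have "cnj (poly (quartic 2) a) = poly (quartic 2) (cnj a)"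
      by (simp add: quartic_eval)
    then have "poly (quartic 2) (cnj a) = 0" using that(1) by simp
    moreover have "a * cnj a = of_real ((cmod a)\<^sup>2)" by (rule complex_norm_square[symmetric])
    moreover have "a + cnj a = of_real (2 * Re a)" by (rule complex_add_cnj)
    moreover have "a \<noteq> 0" using that(2) by auto
    ultimately show False using pair[of a "cnj a" "(cmod a)\<^sup>2" "2 * Re a"] that ne by auto
  qed
  show "cnj x = x" by (rule real[OF x])
  show "x = y"
  proof (rule ccontr)
    assume ne: "x \<noteq> y"
    have "x = of_real (Re x)" "y = of_real (Re y)"
      using real[OF x] real[OF y] by (auto simp: complex_eq_iff)
    then have "x * y = of_real (Re x * Re y)" "x + y = of_real (Re x + Re y)"
      by (metis of_real_mult, metis of_real_add)
    then show False
      using pair[OF x(1) y(1) ne, of "Re x * Re y" "Re x + Re y"] x(2) y(2) by (simp add: mult_neg_neg)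
  qed
qed

lemma quartic_Re_nonzero:
  assumes "poly (quartic k) x = 0" "Re k \<noteq> 0" shows "Re x \<noteq> 0"
proof
  assume "Re x = 0"
  then obtain \<tau> where x: "x = \<i> * of_real \<tau>"
    by (metis complex_eq mult_zero_left of_real_0 add_0)
  have "poly (quartic k) x = of_real (\<tau> ^ 4 + 6 * \<tau>\<^sup>2 - 3) + \<i> * k * of_real (8 * \<tau>)"
    by (simp add: quartic_eval x power_mult_distrib eval_nat_numeral algebra_simps)
  then have "of_real (\<tau> ^ 4 + 6 * \<tau>\<^sup>2 - 3) + \<i> * k * of_real (8 * \<tau>) = 0" using assms(1) by simp
  then have "Im (of_real (\<tau> ^ 4 + 6 * \<tau>\<^sup>2 - 3) + \<i> * k * of_real (8 * \<tau>)) = 0"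
      "Re (of_real (\<tau> ^ 4 + 6 * \<tau>\<^sup>2 - 3) + \<i> * k * of_real (8 * \<tau>)) = 0" by simp_all
  then have "Re k * \<tau> = 0" "\<tau> ^ 4 + 6 * \<tau>\<^sup>2 - 3 - Im k * 8 * \<tau> = 0" by (simp_all flip: of_real_power)
  then show False using assms(2) by auto
qed

lemma quartic_nonzero: "poly (quartic k) x = 0 \<Longrightarrow> x \<noteq> 0"
  by (auto simp: quartic_eval)

section \<open>Continuation of the roots around a ramification point\<close>

definition circle_loop :: "real \<Rightarrow> complex" where
  "circle_loop t = 1 - cis (2 * pi * smoothstep t)"

lemma circle_loop_ends [simp]: "circle_loop 0 = 0" "circle_loop 1 = 0" "circle_loop (1/2) = 2"
  by (auto simp: circle_loop_def complex_eq_iff)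

lemma circle_loop_Re: "0 < t \<Longrightarrow> t < 1 \<Longrightarrow> Re (circle_loop t) > 0"
proof -
  assume t: "0 < t" "t < 1"
  have "cos (2 * pi * smoothstep t) < 1"
  proof (rule ccontr)
    assume "\<not> ?thesis"
    then have "cos (2 * pi * smoothstep t) = 1" using cos_le_one[of "2 * pi * smoothstep t"] by linarith
    then obtain n :: int where "2 * pi * smoothstep t = of_int n * 2 * pi"
      by (auto simp: cos_one_2pi_int)
    then have "smoothstep t = of_int n" by simp
    then show False using smoothstep_strict[OF t] by (metis of_int_0_less_iff of_int_less_1_iff int_one_le_iff_zero_less not_le)
  qed
  then show ?thesis by (simp add: circle_loop_def)
qed

lemma circle_loop_reverse: "circle_loop (1 - t) = cnj (circle_loop t)"
  by (auto simp: circle_loop_def smoothstep_reverse complex_eq_iff cos_diff sin_diff algebra_simps)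

lemma circle_loop_avoids: "circle_loop t \<noteq> 1 \<and> circle_loop t \<noteq> -1"
proof -
  have "norm (circle_loop t - 1) = 1" by (simp add: circle_loop_def norm_minus_commute)
  then show ?thesis by (auto simp: norm_minus_commute)
qed

lemma continuous_circle_loop [continuous_intros]: "continuous_on A circle_loop"
proof -
  have "continuous_on A (\<lambda>t. 1 - exp (\<i> * of_real (2 * pi * smoothstep t)))"
    by (intro continuous_intros)
  then show ?thesis by (simp add: circle_loop_def[abs_def] cis_conv_exp)
qed

lemma circle_family: "root_family A 4 (\<lambda>t. quartic (circle_loop t))"
  by (rule quartic_family) (use circle_loop_avoids in \<open>auto intro: continuous_intros\<close>)

definition circle_lift :: "(real \<Rightarrow> complex) \<Rightarrow> bool" where
  "circle_lift c \<longleftrightarrow> continuous_on {0..1} c \<and> (\<forall>t\<in>{0..1}. poly (quartic (circle_loop t)) (c t) = 0)"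

lemma circle_lift_exists:
  assumes "poly (quartic 0) x = 0" obtains c where "circle_lift c" "c 0 = x"
proof (rule root_lift_exists[OF circle_family, of "{0..1}" 0 x])
  fix g :: "real \<Rightarrow> complex"
  assume "continuous_on {0..1} g" "g 0 = x" "\<And>y. y \<in> {0..1} \<Longrightarrow> poly (quartic (circle_loop y)) (g y) = 0"
  then show thesis using that[of g] by (simp add: circle_lift_def)
qed (use assms in auto)

lemma circle_lift_unique:
  assumes "circle_lift c" "circle_lift c'" "u \<in> {0..1}" "c u = c' u" "t \<in> {0..1}"
  shows "c t = c' t"
  by (rule root_lift_unique[OF circle_family, of "{0..1}" u])
     (use assms in \<open>auto simp: circle_lift_def\<close>)

text \<open>
  Over the right half-plane no root is purely imaginary, so a continuous root cannot cross the
  imaginary axis.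
\<close>

lemma circle_lift_Re_sign:
  assumes c: "circle_lift c"
  shows "(\<forall>t\<in>{0<..<1}. Re (c t) > 0) \<or> (\<forall>t\<in>{0<..<1}. Re (c t) < 0)"
proof (rule ccontr)
  assume "\<not> ?thesis"
  then obtain t t' where t: "t \<in> {0<..<1}" "Re (c t) \<le> 0" "t' \<in> {0<..<1}" "Re (c t') \<ge> 0"
    by (auto simp: not_less)
  have "connected ((\<lambda>t. Re (c t)) ` {0<..<1})"
    using c by (intro connected_continuous_image continuous_intros)
      (auto simp: circle_lift_def intro: continuous_on_subset)
  then have "0 \<in> (\<lambda>t. Re (c t)) ` {0<..<1}"
    using t unfolding connected_iff_interval by blast
  then obtain s where "s \<in> {0<..<1}" "Re (c s) = 0" by auto
  then show False
    using quartic_Re_nonzero[of "circle_loop s" "c s"] circle_loop_Re[of s] c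
    by (auto simp: circle_lift_def)
qed

text \<open>
  The roots of the quartic at \<open>k = 0\<close> are \<open>rho\<close>, \<open>-rho\<close>,
  \<open>\<i> * tau\<close> and \<open>-\<i> * tau\<close>.
\<close>

definition rho :: real where "rho = sqrt (3 + 2 * sqrt 3)"
definition tau :: real where "tau = sqrt (2 * sqrt 3 - 3)"

lemma tau_pos: "tau > 0" and tau_sq: "tau\<^sup>2 = 2 * sqrt 3 - 3" and rho_gt: "rho > 1" and rho_sq: "rho\<^sup>2 = 3 + 2 * sqrt 3"
proof -
  have "sqrt 3 > 3/2" by (rule real_less_rsqrt) (simp add: power2_eq_square)
  then show "tau > 0" "tau\<^sup>2 = 2 * sqrt 3 - 3" by (auto simp: tau_def)
  have "sqrt 3 \<ge> 0" "2 + 2 * sqrt 3 > 0" by (simp, smt (verit) real_sqrt_ge_zero)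
  then show "rho\<^sup>2 = 3 + 2 * sqrt 3" "rho > 1" by (auto simp: rho_def)
qed

lemma quartic_0_roots:
  "poly (quartic 0) x = 0 \<longleftrightarrow> x \<in> {of_real rho, - of_real rho, \<i> * of_real tau, - (\<i> * of_real tau)}"
proof -
  \<comment> \<open>The quartic at \<open>k = 0\<close> is quadratic in the square of its argument.\<close>
  have r: "(of_real rho :: complex)\<^sup>2 = 3 + 2 * of_real (sqrt 3)" "(of_real tau :: complex)\<^sup>2 = 2 * of_real (sqrt 3) - 3"
    using arg_cong[OF rho_sq, of complex_of_real] arg_cong[OF tau_sq, of complex_of_real] by simp_all
  have s3: "(of_real (sqrt 3) :: complex)\<^sup>2 = 3"
    by (simp flip: of_real_power)
  have prod: "(of_real rho :: complex)\<^sup>2 * (of_real tau)\<^sup>2 = 3"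
    unfolding r using s3 by (simp add: algebra_simps power2_eq_square)
  have "(x - of_real rho) * (x + of_real rho) * ((x - \<i> * of_real tau) * (x + \<i> * of_real tau))
      = (x\<^sup>2 - (of_real rho)\<^sup>2) * (x\<^sup>2 + (of_real tau)\<^sup>2)"
    by (simp add: algebra_simps power2_eq_square)
  also have "\<dots> = x ^ 4 - ((of_real rho)\<^sup>2 - (of_real tau)\<^sup>2) * x\<^sup>2 - (of_real rho)\<^sup>2 * (of_real tau)\<^sup>2"
    by (simp add: algebra_simps power2_eq_square power4_eq_xxxx)
  also have "\<dots> = poly (quartic 0) x"
    unfolding prod by (simp add: r quartic_eval)
  finally have "poly (quartic 0) x = (x - of_real rho) * (x + of_real rho) * ((x - \<i> * of_real tau) * (x + \<i> * of_real tau))" ..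
  then show ?thesis by (auto simp: add_eq_0_iff2)
qed

lemma circle_lift_half:
  assumes "circle_lift c" shows "poly (quartic 2) (c (1/2)) = 0"
proof -
  have "\<forall>t\<in>{0..1}. poly (quartic (circle_loop t)) (c t) = 0"
    using assms by (simp add: circle_lift_def)
  then have "poly (quartic (circle_loop (1/2))) (c (1/2)) = 0" by (rule bspec) simp
  then show ?thesis by simp
qed

lemma nonneg_at_ends:
  fixes f :: "real \<Rightarrow> real"
  assumes f: "continuous_on {0..1} f" and t: "t \<in> {0..1}" and nonneg: "\<And>t. t \<in> {0<..<1} \<Longrightarrow> f t \<ge> 0"
  shows "f t \<ge> 0"
proof -
  have cl: "closure {0<..<1::real} = {0..1}"
    by (rule closure_greaterThanLessThan) simp
  show ?thesis
  proof (rule continuous_ge_on_closure[where S = "{0<..<1::real}" and f = f and x = t and a = 0])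
    show "continuous_on (closure {0<..<1}) f" unfolding cl by (rule f)
    show "t \<in> closure {0<..<1}" unfolding cl by (rule t)
    show "0 \<le> f t" if "t \<in> {0<..<1}" for t by (rule nonneg[OF that])
  qed
qed

text \<open>
  This is the root that is not ramified over \<open>1\<close>. Complex conjugation reverses the loop
  and fixes the only root in the left half-plane at the midpoint \<open>2\<close> of the loop, hence
  the continuation is symmetric.
\<close>

lemma circle_lift_left:
  assumes c: "circle_lift c" "c 0 = - of_real rho"
  shows "\<forall>t\<in>{0..1}. Re (c t) < 0" "c 1 = - of_real rho"
proof -
  have cont: "continuous_on {0..1} (\<lambda>t. Re (c t))"
    using c by (auto simp: circle_lift_def intro: continuous_intros)
  have neg: "\<forall>t\<in>{0<..<1}. Re (c t) < 0"
  proof (rule ccontr)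
    assume "\<not> ?thesis"
    then have pos: "\<forall>t\<in>{0<..<1}. Re (c t) > 0" using circle_lift_Re_sign[OF c(1)] by blast
    have "Re (c 0) \<ge> 0"
      by (rule nonneg_at_ends[OF cont]) (use pos in \<open>auto intro!: less_imp_le\<close>)
    then show False using c(2) rho_gt by simp
  qed
  \<comment> \<open>The reflected continuation agrees with the given one at the midpoint, hence everywhere.\<close>
  define c' where "c' = (\<lambda>t. cnj (c (1 - t)))"
  have "circle_lift c'"
    unfolding circle_lift_def
  proof
    have "continuous_on {0..1} (\<lambda>t. c (1 - t))"
      by (rule continuous_on_compose2[of "{0..1}" c])
         (use c(1) in \<open>auto simp: circle_lift_def intro!: continuous_intros\<close>)
    then show "continuous_on {0..1} c'"
      unfolding c'_def by (intro continuous_intros)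
    show "\<forall>t\<in>{0..1}. poly (quartic (circle_loop t)) (c' t) = 0"
    proof
      fix t :: real assume "t \<in> {0..1}"
      then have "poly (quartic (circle_loop (1 - t))) (c (1 - t)) = 0"
        using c(1) by (auto simp: circle_lift_def)
      then have "cnj (poly (quartic (circle_loop (1 - t))) (c (1 - t))) = 0" by simp
      then show "poly (quartic (circle_loop t)) (c' t) = 0"
        by (simp add: quartic_eval c'_def circle_loop_reverse)
    qed
  qed
  moreover have "c' (1/2) = c (1/2)"
    using quartic_left_root_unique(2)[OF circle_lift_half[OF c(1)] _ circle_lift_half[OF c(1)]] neg by (simp add: c'_def)
  ultimately have "c' 1 = c 1"
    using circle_lift_unique[of c' c "1/2" 1] c(1) by simp
  then show c1: "c 1 = - of_real rho" using c(2) by (simp add: c'_def)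
  show "\<forall>t\<in>{0..1}. Re (c t) < 0"
  proof
    fix t :: real assume "t \<in> {0..1}"
    then show "Re (c t) < 0" using neg c(2) c1 rho_gt by (cases "t = 0 \<or> t = 1") auto
  qed
qed

lemma circle_lift_right:
  assumes c: "circle_lift c" "c 0 \<noteq> - of_real rho"
  shows "\<forall>t\<in>{0..1}. Re (c t) \<ge> 0"
proof -
  have cont: "continuous_on {0..1} (\<lambda>t. Re (c t))"
    using c by (auto simp: circle_lift_def intro: continuous_intros)
  have pos: "\<forall>t\<in>{0<..<1}. Re (c t) > 0"
  proof (rule ccontr)
    assume "\<not> ?thesis"
    then have neg: "\<forall>t\<in>{0<..<1}. Re (c t) < 0" using circle_lift_Re_sign[OF c(1)] by blast
    \<comment> \<open>A second root in the left half-plane would agree with the unramified one at the midpoint.\<close>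
    obtain b where b: "circle_lift b" "b 0 = - of_real rho"
      using circle_lift_exists[of "- of_real rho"] quartic_0_roots by auto
    have "c (1/2) = b (1/2)"
      using quartic_left_root_unique(1)[OF circle_lift_half[OF c(1)] _ circle_lift_half[OF b(1)]] neg circle_lift_left(1)[OF b] by auto
    then have "c 0 = b 0" using circle_lift_unique[OF c(1) b(1), of "1/2" 0] by simp
    then show False using b(2) c(2) by simp
  qed
  show ?thesis
  proof
    fix t :: real assume "t \<in> {0..1}"
    then show "Re (c t) \<ge> 0"
      by (rule nonneg_at_ends[OF cont]) (use pos in \<open>auto intro!: less_imp_le\<close>)
  qed
qed

text \<open>
  On the closed right half-plane \<open>8 * z / (z + 3)\<close> has positive real part, so its
  principal cube root is continuous there, and \<open>(z - 1) / cube_scale z\<close> is a cube root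
  of \<open>1 - k\<close> when \<open>z\<close> is a root of the quartic.
\<close>

definition cube_scale :: "complex \<Rightarrow> complex" where
  "cube_scale z = exp (Ln (8 * z / (z + 3)) / 3)"

lemma right_half_quotient:
  assumes "Re z \<ge> 0" "z \<noteq> 0" shows "Re (8 * z / (z + 3)) > 0"
proof -
  have "Re (8 * z * cnj (z + 3)) = 8 * ((Re z)\<^sup>2 + (Im z)\<^sup>2 + 3 * Re z)"
    by (simp add: algebra_simps power2_eq_square)
  moreover have "(Re z)\<^sup>2 + (Im z)\<^sup>2 > 0"
    using assms(2) by (simp add: complex_neq_0 flip: complex_neq_0)
  ultimately have "Re (8 * z * cnj (z + 3)) > 0" using assms(1) by simp
  then show ?thesis by (simp add: Re_complex_div_gt_0)
qed

lemma cube_scale_cube: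
  assumes "Re z \<ge> 0" "z \<noteq> 0" shows "cube_scale z ^ 3 = 8 * z / (z + 3)"
proof -
  have "8 * z / (z + 3) \<noteq> 0" using right_half_quotient[OF assms] by auto
  then have "exp (Ln (8 * z / (z + 3))) = 8 * z / (z + 3)" by (rule exp_Ln)
  then show ?thesis unfolding cube_scale_def by (simp flip: exp_of_nat_mult)
qed

lemma cube_scale_polar:
  assumes "Re z \<ge> 0" "z \<noteq> 0"
  obtains r a where "cube_scale z = of_real r * cis a" "r > 0" "\<bar>a\<bar> < pi / 6"
proof
  let ?L = "Ln (8 * z / (z + 3))"
  show "cube_scale z = of_real (exp (Re ?L / 3)) * cis (Im ?L / 3)"
    unfolding cube_scale_def by (subst exp_eq_polar) simp
  have "8 * z / (z + 3) \<noteq> 0" using right_half_quotient[OF assms] by auto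
  then have "\<bar>Im ?L\<bar> < pi / 2"
    using right_half_quotient[OF assms] Re_Ln_pos_lt by blast
  then show "\<bar>Im ?L / 3\<bar> < pi / 6" by simp
qed simp

text \<open>
  Along the loop \<open>1 - k\<close> makes one turn around the origin, so its cube root \<open>(z -
  1) / cube_scale z\<close> makes a third of a turn. The quotient of the two is continuous with
  values in a finite set.
\<close>

lemma circle_lift_right_turn:
  assumes c: "circle_lift c" and Re: "\<And>t. t \<in> {0..1} \<Longrightarrow> Re (c t) \<ge> 0"
  shows "(c 1 - 1) / cube_scale (c 1) = (c 0 - 1) / cube_scale (c 0) * cis (2 * pi / 3)"
proof -
  have root: "poly (quartic (circle_loop t)) (c t) = 0" if "t \<in> {0..1}" for t
    using c that by (simp add: circle_lift_def)
  have nz: "c t \<noteq> 0" if "t \<in> {0..1}" for t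
    using quartic_nonzero root that by blast
  define f where "f = (\<lambda>t. (c t - 1) / (cube_scale (c t) * exp (\<i> * of_real (2 * pi * smoothstep t / 3))))"
  have cont: "continuous_on {0..1} c" using c by (simp add: circle_lift_def)
  have "c t + 3 \<noteq> 0" if "t \<in> {0..1}" for t
    using Re[OF that] by (auto simp: complex_eq_iff)
  moreover have "8 * c t / (c t + 3) \<notin> \<real>\<^sub>\<le>\<^sub>0" if "t \<in> {0..1}" for t
    using right_half_quotient[OF Re[OF that] nz[OF that]] complex_nonpos_Reals_iff by force
  ultimately have "continuous_on {0..1} f"
    unfolding f_def cube_scale_def using cont
    by (intro continuous_intros) auto
  moreover have "f t ^ 3 = 1" if t: "t \<in> {0..1}" for t
  proof -
    let ?z = "c t" and ?e = "exp (\<i> * of_real (2 * pi * smoothstep t / 3))"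
    have e: "?e ^ 3 = cis (2 * pi * smoothstep t)"
      by (simp add: cis_conv_exp mult_ac flip: exp_of_nat_mult)
    have "(?z - 1) ^ 3 * (?z + 3) = 8 * ?z * cis (2 * pi * smoothstep t)"
      using root[OF t] unfolding quartic_eval circle_loop_def by algebra
    moreover have "?z + 3 \<noteq> 0" using Re[OF t] by (auto simp: complex_eq_iff)
    ultimately have "(?z - 1) ^ 3 = 8 * ?z / (?z + 3) * cis (2 * pi * smoothstep t)"
      by (simp add: field_simps)
    also have "\<dots> = (cube_scale ?z * ?e) ^ 3"
      unfolding power_mult_distrib e cube_scale_cube[OF Re[OF t] nz[OF t]] ..
    finally show ?thesis
      unfolding f_def power_divide by (simp add: cube_scale_def)
  qed
  then have "finite (f ` {0..1})"
    by (intro finite_subset[OF _ finite_roots_unity[of 3]]) auto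
  ultimately have "f constant_on {0..1}"
    by (intro continuous_finite_range_constant) auto
  then have "f 1 = f 0" unfolding constant_on_def by force
  then have "(c 1 - 1) / (cube_scale (c 1) * cis (2 * pi / 3)) = (c 0 - 1) / cube_scale (c 0)"
    by (simp add: f_def cis_conv_exp)
  then show ?thesis by (simp add: divide_simps split: if_splits)
qed

lemma circle_lift_end:
  assumes "circle_lift c" shows "poly (quartic 0) (c 1) = 0"
proof -
  have "\<forall>t\<in>{0..1}. poly (quartic (circle_loop t)) (c t) = 0"
    using assms by (simp add: circle_lift_def)
  then have "poly (quartic (circle_loop 1)) (c 1) = 0"
    by (rule bspec) simp
  then show ?thesis by simp
qed

text \<open>
  The three roots in the closed right half-plane at \<open>k = 0\<close> are told apart by the cube
  root of unity that belongs to them.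
\<close>

definition sheet :: "complex \<Rightarrow> complex" where
  "sheet z = (z - 1) / cube_scale z"

lemma cube_scale_nonzero [simp]: "cube_scale z \<noteq> 0" by (simp add: cube_scale_def)

lemma sheet_cube:
  assumes "poly (quartic 0) z = 0" "Re z \<ge> 0" shows "sheet z ^ 3 = 1"
proof -
  have z: "z \<noteq> 0" using quartic_nonzero assms(1) by blast
  have "z + 3 \<noteq> 0" using assms(2) by (auto simp: complex_eq_iff)
  moreover have "(z - 1) ^ 3 * (z + 3) = 8 * z"
    using assms(1) unfolding quartic_eval by algebra
  ultimately have "(z - 1) ^ 3 = 8 * z / (z + 3)" by (simp add: field_simps)
  then have "(z - 1) ^ 3 = cube_scale z ^ 3" using cube_scale_cube[OF assms(2) z] by simp
  then show ?thesis by (simp add: sheet_def power_divide)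
qed

lemma cube_roots_of_unity:
  fixes z :: complex assumes "z ^ 3 = 1"
  shows "z = 1 \<or> z = cis (2 * pi / 3) \<or> z = cis (4 * pi / 3)"
proof -
  have w: "cis (2 * pi / 3) + cis (4 * pi / 3) = -1" "cis (2 * pi / 3) * cis (4 * pi / 3) = 1"
  proof -
    have c: "cos (4 * pi / 3) = - 1/2" "sin (4 * pi / 3) = - sqrt 3 / 2"
      using cos_add[of pi "pi/3"] sin_add[of pi "pi/3"] by (simp_all add: cos_60 sin_60)
    have c': "cos (2 * pi / 3) = - 1/2" "sin (2 * pi / 3) = sqrt 3 / 2"
      using cos_120 sin_120 by (simp_all add: mult.commute)
    show "cis (2 * pi / 3) + cis (4 * pi / 3) = -1"
      by (simp add: complex_eq_iff c c')
    show "cis (2 * pi / 3) * cis (4 * pi / 3) = 1" by (simp add: cis_mult flip: add_divide_distrib)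
  qed
  have "(z - 1) * ((z - cis (2 * pi / 3)) * (z - cis (4 * pi / 3))) = 0"
    using assms w by algebra
  then show ?thesis by auto
qed

text \<open>
  The argument of \<open>cube_scale z\<close> is less than \<open>pi / 6\<close> in absolute value,
  which leaves only one possibility for a cube root of unity.
\<close>

lemma sheet_rho: "sheet (of_real rho) = 1"
proof -
  obtain r a where r: "cube_scale (of_real rho) = of_real r * cis a" "r > 0" "\<bar>a\<bar> < pi / 6"
    by (rule cube_scale_polar[of "of_real rho"]) (use rho_gt in auto)
  have s: "sheet (of_real rho) ^ 3 = 1"
    by (rule sheet_cube) (use rho_gt quartic_0_roots in auto)
  have eq: "of_real rho - 1 = sheet (of_real rho) * (of_real r * cis a)"
    using r(1) by (simp add: sheet_def flip: r(1))
  have p: "rho - 1 > 0" using rho_gt by simp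
  have "sheet (of_real rho) \<noteq> cis \<theta>" if "sin (\<theta> + a) \<noteq> 0" for \<theta>
  proof
    assume "sheet (of_real rho) = cis \<theta>"
    then have "of_real rho - 1 = of_real r * cis (\<theta> + a)" using eq by (simp add: cis_mult mult_ac flip: cis_mult)
    then have "Im (of_real rho - 1) = r * sin (\<theta> + a)" by simp
    then show False using that r(2) by simp
  qed
  moreover have "sin (2 * pi / 3 + a) > 0" by (rule sin_gt_zero) (use r(3) in auto)
  moreover have "sin (4 * pi / 3 + a) < 0"
    using sin_gt_zero[of "pi / 3 + a"] r(3) sin_add[of pi "pi / 3 + a"] by (simp add: algebra_simps)
  ultimately show ?thesis using cube_roots_of_unity[OF s] by auto
qed

lemma sheet_tau: "sheet (\<i> * of_real tau) = cis (2 * pi / 3)" "sheet (- (\<i> * of_real tau)) = cis (4 * pi / 3)"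
proof -
  have main: "sheet z = cis (if e > 0 then 2 * pi / 3 else 4 * pi / 3)" if z: "z = \<i> * of_real (e * tau)" "\<bar>e\<bar> = 1" for z and e :: real
  proof -
    have t: "z \<noteq> 0" "Re z \<ge> 0" using z tau_pos by auto
    obtain r a where r: "cube_scale z = of_real r * cis a" "r > 0" "\<bar>a\<bar> < pi / 6"
      by (rule cube_scale_polar[OF t(2,1)])
    have "e = 1 \<or> e = -1" using z(2) by auto
    then have s: "sheet z ^ 3 = 1"
      by (intro sheet_cube) (use z quartic_0_roots in auto)
    have eq: "z - 1 = sheet z * (of_real r * cis a)"
      by (simp add: sheet_def flip: r(1))
    have pol: "r * cos (\<theta> + a) = -1 \<and> r * sin (\<theta> + a) = e * tau" if "sheet z = cis \<theta>" for \<theta>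
    proof -
      have "z - 1 = of_real r * cis (\<theta> + a)" using eq that by (simp add: mult_ac flip: cis_mult)
      then show ?thesis using z(1) by (auto simp: complex_eq_iff)
    qed
    have "cos a > 0" by (rule cos_gt_zero_pi) (use r(3) pi_gt_zero in linarith)+
    then have "r * cos a > 0" using r(2) by simp
    then have "sheet z \<noteq> cis 0" using pol[of 0] by (auto simp del: cis_zero)
    moreover have "sin (2 * pi / 3 + a) > 0" by (rule sin_gt_zero) (use r(3) in auto)
    then have "r * sin (2 * pi / 3 + a) > 0" using r(2) by simp
    moreover have "sin (4 * pi / 3 + a) < 0"
      using sin_gt_zero[of "pi / 3 + a"] r(3) sin_add[of pi "pi / 3 + a"] by (simp add: algebra_simps)
    then have "r * sin (4 * pi / 3 + a) < 0" using r(2) by (simp add: mult_pos_neg)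
    ultimately show ?thesis
      using cube_roots_of_unity[OF s] pol[of "2 * pi / 3"] pol[of "4 * pi / 3"] \<open>e = 1 \<or> e = -1\<close> tau_pos by auto
  qed
  show "sheet (\<i> * of_real tau) = cis (2 * pi / 3)" using main[of _ 1] by simp
  show "sheet (- (\<i> * of_real tau)) = cis (4 * pi / 3)" using main[of _ "-1"] by simp
qed

text \<open>
  The three roots ramified over \<open>1\<close> are permuted cyclically.
\<close>

lemma circle_lift_right_end:
  assumes c: "circle_lift c" "c 0 \<noteq> - of_real rho"
  shows "c 0 = of_real rho \<Longrightarrow> c 1 = \<i> * of_real tau"
    "c 0 = \<i> * of_real tau \<Longrightarrow> c 1 = - (\<i> * of_real tau)"
    "c 0 = - (\<i> * of_real tau) \<Longrightarrow> c 1 = of_real rho"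
proof -
  have turn: "sheet (c 1) = sheet (c 0) * cis (2 * pi / 3)"
    unfolding sheet_def using circle_lift_right_turn[OF c(1)] circle_lift_right[OF c] by blast
  have "Re (c 1) \<ge> 0" using circle_lift_right[OF c] by simp
  then have c1: "c 1 \<in> {of_real rho, \<i> * of_real tau, - (\<i> * of_real tau)}"
    using circle_lift_end[OF c(1)] rho_gt unfolding quartic_0_roots by auto
  have ne: "cis (2 * pi / 3) \<noteq> 1" "cis (4 * pi / 3) \<noteq> 1" "cis (2 * pi / 3) \<noteq> cis (4 * pi / 3)"
  proof -
    have c: "sin (4 * pi / 3) < 0" "sin (2 * pi / 3) > 0"
      using sin_add[of pi "pi/3"] sin_gt_zero[of "2 * pi / 3"] by (simp_all add: sin_60)
    show "cis (2 * pi / 3) \<noteq> 1" "cis (4 * pi / 3) \<noteq> 1" "cis (2 * pi / 3) \<noteq> cis (4 * pi / 3)"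
      using c by (auto simp: complex_eq_iff)
  qed
  have m: "cis (2 * pi / 3) * cis (2 * pi / 3) = cis (4 * pi / 3)" "cis (4 * pi / 3) * cis (2 * pi / 3) = 1"
    by (simp_all add: cis_mult flip: add_divide_distrib)
  show "c 0 = of_real rho \<Longrightarrow> c 1 = \<i> * of_real tau"
    "c 0 = \<i> * of_real tau \<Longrightarrow> c 1 = - (\<i> * of_real tau)"
    "c 0 = - (\<i> * of_real tau) \<Longrightarrow> c 1 = of_real rho"
    using c1 turn ne m sheet_rho sheet_tau by auto
qed

section \<open>Continuation of square roots of the roots\<close>

text \<open>
  \<open>s\<close> is a continuous square root of a continuous root of the quartic. Since roots
  never vanish, these square roots form an eightfold covering of the twice punctured plane.
\<close>

definition spin_lift :: "(real \<Rightarrow> complex) \<Rightarrow> complex \<Rightarrow> complex \<Rightarrow> bool" where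
  "spin_lift g x y \<longleftrightarrow> (\<exists>s. path s \<and> pathstart s = x \<and> pathfinish s = y \<and>
     (\<forall>t\<in>{0..1}. poly (quartic (g t)) ((s t)\<^sup>2) = 0))"

lemma spin_lift_join:
  assumes "spin_lift g x y" "spin_lift h y z" shows "spin_lift (g +++ h) x z"
proof -
  obtain s where s: "path s" "pathstart s = x" "pathfinish s = y" "\<forall>t\<in>{0..1}. poly (quartic (g t)) ((s t)\<^sup>2) = 0"
    using assms(1) unfolding spin_lift_def by blast
  obtain r where r: "path r" "pathstart r = y" "pathfinish r = z" "\<forall>t\<in>{0..1}. poly (quartic (h t)) ((r t)\<^sup>2) = 0"
    using assms(2) unfolding spin_lift_def by blast
  have "\<forall>t\<in>{0..1}. poly (quartic ((g +++ h) t)) (((s +++ r) t)\<^sup>2) = 0"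
    using s(4) r(4) by (auto simp: joinpaths_def)
  then show ?thesis
    unfolding spin_lift_def using s r by (intro exI[of _ "s +++ r"]) auto
qed

lemma spin_lift_reverse:
  assumes "spin_lift g x y" shows "spin_lift (reversepath g) y x"
proof -
  obtain s where s: "path s" "pathstart s = x" "pathfinish s = y" "\<forall>t\<in>{0..1}. poly (quartic (g t)) ((s t)\<^sup>2) = 0"
    using assms unfolding spin_lift_def by blast
  then show ?thesis
    unfolding spin_lift_def by (intro exI[of _ "reversepath s"]) 
      (auto simp: pathstart_reversepath pathfinish_reversepath path_reversepath, simp add: reversepath_def)
qed

lemma spin_lift_uminus:
  assumes "spin_lift g x y" shows "spin_lift g (- x) (- y)"
proof -
  obtain s where s: "path s" "pathstart s = x" "pathfinish s = y" "\<forall>t\<in>{0..1}. poly (quartic (g t)) ((s t)\<^sup>2) = 0"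
    using assms unfolding spin_lift_def by blast
  then show ?thesis
    unfolding spin_lift_def by (intro exI[of _ "\<lambda>t. - s t"])
      (auto simp: path_def pathstart_def pathfinish_def intro: continuous_intros)
qed

text \<open>
  The quartic is invariant under changing the signs of both \<open>k\<close> and the root.
\<close>

lemma spin_lift_rotate:
  assumes "spin_lift g x y" shows "spin_lift (\<lambda>t. - g t) (\<i> * x) (\<i> * y)"
proof -
  obtain s where s: "path s" "pathstart s = x" "pathfinish s = y" "\<forall>t\<in>{0..1}. poly (quartic (g t)) ((s t)\<^sup>2) = 0"
    using assms unfolding spin_lift_def by blast
  then have "\<forall>t\<in>{0..1}. poly (quartic (- g t)) ((\<i> * s t)\<^sup>2) = 0"
    by (simp add: quartic_eval power_mult_distrib)
  with s show ?thesis
    unfolding spin_lift_def by (intro exI[of _ "\<lambda>t. \<i> * s t"])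
      (auto simp: path_def pathstart_def pathfinish_def intro: continuous_intros)
qed

definition spin_rho :: complex where "spin_rho = of_real (sqrt rho)"
definition spin_tau :: complex where "spin_tau = of_real (sqrt tau) * cis (pi / 4)"

lemma spin_csqrt:
  "csqrt (of_real rho) = spin_rho" "csqrt (\<i> * of_real tau) = spin_tau"
  "csqrt (- (\<i> * of_real tau)) = - \<i> * spin_tau"
proof -
  show "csqrt (of_real rho) = spin_rho" using rho_gt by (simp add: spin_rho_def csqrt_of_real_nonneg)
  have sq: "spin_tau\<^sup>2 = \<i> * of_real tau"
    using tau_pos by (simp add: spin_tau_def power_mult_distrib Complex.DeMoivre flip: of_real_power)
  have "Re spin_tau > 0" "Im spin_tau > 0"
    using tau_pos by (simp_all add: spin_tau_def cos_45 sin_45)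
  then show "csqrt (\<i> * of_real tau) = spin_tau" "csqrt (- (\<i> * of_real tau)) = - \<i> * spin_tau"
    using csqrt_unique[of spin_tau "\<i> * of_real tau"] csqrt_unique[of "- \<i> * spin_tau" "- (\<i> * of_real tau)"] sq
    by (simp_all add: power_mult_distrib)
qed

lemma continuous_on_csqrt_comp:
  assumes "continuous_on A f" "\<And>t. t \<in> A \<Longrightarrow> f t \<notin> \<real>\<^sub>\<le>\<^sub>0"
  shows "continuous_on A (\<lambda>t. csqrt (f t))"
proof (rule continuous_on_compose2[OF _ assms(1)])
  show "continuous_on (- \<real>\<^sub>\<le>\<^sub>0) csqrt"
    by (rule continuous_at_imp_continuous_on) (auto intro: continuous_at_csqrt)
qed (use assms(2) in auto)

lemma spin_lift_circle_right:
  assumes c: "circle_lift c" "c 0 \<noteq> - of_real rho"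
  shows "spin_lift circle_loop (csqrt (c 0)) (csqrt (c 1))"
proof -
  have root: "poly (quartic (circle_loop t)) (c t) = 0" if "t \<in> {0..1}" for t
    using c(1) that by (simp add: circle_lift_def)
  have "c t \<notin> \<real>\<^sub>\<le>\<^sub>0" if "t \<in> {0..1}" for t
    using circle_lift_right[OF c] quartic_nonzero[OF root[OF that]] that
    by (force simp: complex_nonpos_Reals_iff complex_eq_iff)
  then have "path (\<lambda>t. csqrt (c t))"
    unfolding path_def using c(1) by (intro continuous_on_csqrt_comp) (auto simp: circle_lift_def)
  then show ?thesis
    unfolding spin_lift_def using root
    by (intro exI[of _ "\<lambda>t. csqrt (c t)"]) (auto simp: pathstart_def pathfinish_def)
qed

text \<open>
  Roots in the closed right half-plane carry their principal square root along; the root in the left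
  half-plane carries \<open>\<i>\<close> times the principal square root of its negative.
\<close>

lemma spin_lift_circle:
  "spin_lift circle_loop spin_rho spin_tau"
  "spin_lift circle_loop spin_tau (- \<i> * spin_tau)"
  "spin_lift circle_loop (- \<i> * spin_tau) spin_rho"
  "spin_lift circle_loop (\<i> * spin_rho) (\<i> * spin_rho)"
proof -
  have ne: "of_real rho \<noteq> - (of_real rho :: complex)" "\<i> * of_real tau \<noteq> - of_real rho" "- (\<i> * of_real tau) \<noteq> - of_real rho"
    using rho_gt tau_pos by (auto simp: complex_eq_iff)
  have right: "spin_lift circle_loop (csqrt x) (csqrt y)"
    if x: "poly (quartic 0) x = 0" "x \<noteq> - of_real rho"
      and y: "\<And>c. circle_lift c \<Longrightarrow> c 0 \<noteq> - of_real rho \<Longrightarrow> c 0 = x \<Longrightarrow> c 1 = y" for x y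
  proof -
    obtain c where c: "circle_lift c" "c 0 = x" by (rule circle_lift_exists[OF x(1)])
    have ne: "c 0 \<noteq> - of_real rho" unfolding c(2) by (rule x(2))
    show ?thesis
      using spin_lift_circle_right[OF c(1) ne] unfolding y[OF c(1) ne c(2)] c(2) .
  qed
  have roots: "poly (quartic 0) (of_real rho) = 0" "poly (quartic 0) (\<i> * of_real tau) = 0"
      "poly (quartic 0) (- (\<i> * of_real tau)) = 0"
    unfolding quartic_0_roots by blast+
  show "spin_lift circle_loop spin_rho spin_tau"
    using right[OF roots(1) ne(1), of "\<i> * of_real tau"] circle_lift_right_end(1) unfolding spin_csqrt by blast
  show "spin_lift circle_loop spin_tau (- \<i> * spin_tau)"
    using right[OF roots(2) ne(2), of "- (\<i> * of_real tau)"] circle_lift_right_end(2) unfolding spin_csqrt by blast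
  show "spin_lift circle_loop (- \<i> * spin_tau) spin_rho"
    using right[OF roots(3) ne(3), of "of_real rho"] circle_lift_right_end(3) unfolding spin_csqrt by blast
  obtain c where c: "circle_lift c" "c 0 = - of_real rho"
    by (rule circle_lift_exists[of "- of_real rho"]) (use quartic_0_roots in auto)
  note left = circle_lift_left[OF c]
  have "- c t \<notin> \<real>\<^sub>\<le>\<^sub>0" if "t \<in> {0..1}" for t
    using left(1) that by (force simp: complex_nonpos_Reals_iff)
  then have "path (\<lambda>t. \<i> * csqrt (- c t))"
    unfolding path_def using c(1)
    by (intro continuous_on_mult continuous_on_const continuous_on_csqrt_comp continuous_on_minus) (auto simp: circle_lift_def)
  moreover have "poly (quartic (circle_loop t)) ((\<i> * csqrt (- c t))\<^sup>2) = 0" if "t \<in> {0..1}" for t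
    using c(1) that by (simp add: circle_lift_def power_mult_distrib)
  ultimately show "spin_lift circle_loop (\<i> * spin_rho) (\<i> * spin_rho)"
    unfolding spin_lift_def using c(2) left(2) spin_csqrt(1)
    by (intro exI[of _ "\<lambda>t. \<i> * csqrt (- c t)"]) (auto simp: pathstart_def pathfinish_def)
qed

section \<open>Deep commutators that reverse the sign of every square root\<close>

text \<open>
  The first component tells whether the circle goes around \<open>-1\<close> instead of
  \<open>1\<close>, the second one whether it is traversed backwards.
\<close>

type_synonym letter = "bool \<times> bool"

definition inverse_letter :: "letter \<Rightarrow> letter" where
  "inverse_letter x = (fst x, \<not> snd x)"

interpretation letters: free_words inverse_letter
  by unfold_locales (simp add: inverse_letter_def)

text \<open>
  The second component of \<open>l\<close> is the diameter of the circle. Diameter 2 gives a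
  generator of the fundamental group, diameter 1 a circle through \<open>1\<close> or
  \<open>-1\<close>, and diameter 0 a constant path.
\<close>

definition letter_loop :: "letter \<times> real \<Rightarrow> real \<Rightarrow> complex" where
  "letter_loop l t = of_real (snd l / 2) * (if fst (fst l) then -1 else 1) *
     (1 - cis ((if snd (fst l) then -1 else 1) * (2 * pi * smoothstep t)))"

primrec word_path :: "(letter \<times> real) list \<Rightarrow> real \<Rightarrow> complex" where
  "word_path [] = (\<lambda>t. 0)"
| "word_path (l # w) = letter_loop l +++ word_path w"

abbreviation on :: "letter list \<Rightarrow> (letter \<times> real) list" where
  "on w \<equiv> map (\<lambda>x. (x, 2)) w"

text \<open>
  The eight square roots over \<open>k = 0\<close> in the order of their arguments, which are the
  multiples of \<open>pi / 4\<close>. Adding 4 to the index changes the sign.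
\<close>

definition spin_state :: "nat \<Rightarrow> complex" where
  "spin_state k = \<i> ^ (k div 2) * (if even k then spin_rho else spin_tau)"

text \<open>
  The monodromy permutations of the indices of the eight square roots, as lists of images.
\<close>

primrec letter_perm :: "letter \<Rightarrow> nat list" where
  "letter_perm (b, v) =
     (if b then if v then [0, 3, 1, 2, 4, 7, 5, 6] else [0, 2, 3, 1, 4, 6, 7, 5]
      else if v then [7, 0, 2, 5, 3, 4, 6, 1] else [1, 7, 2, 4, 5, 3, 6, 0])"

primrec word_perm :: "letter list \<Rightarrow> nat list" where
  "word_perm [] = [0, 1, 2, 3, 4, 5, 6, 7]"
| "word_perm (x # w) = map ((!) (word_perm w)) (letter_perm x)"

lemma letter_loop_on:
  "letter_loop ((False, False), 2) = circle_loop"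
  "letter_loop ((False, True), 2) = reversepath circle_loop"
  "letter_loop ((True, v), 2) = (\<lambda>t. - letter_loop ((False, v), 2) t)"
  by (auto simp: letter_loop_def circle_loop_def reversepath_def fun_eq_iff smoothstep_reverse
      complex_eq_iff cos_diff sin_diff algebra_simps)

lemma spin_state_values:
  "spin_state 0 = spin_rho" "spin_state 1 = spin_tau" "spin_state (Suc 0) = spin_tau" "spin_state 2 = \<i> * spin_rho" "spin_state 3 = \<i> * spin_tau"
  "spin_state 4 = - spin_rho" "spin_state 5 = - spin_tau" "spin_state 6 = - (\<i> * spin_rho)" "spin_state 7 = - (\<i> * spin_tau)"
proof -
  have "\<i> ^ 3 = - \<i>" by (simp add: power3_eq_cube)
  then show "spin_state 0 = spin_rho" "spin_state 1 = spin_tau" "spin_state (Suc 0) = spin_tau" "spin_state 2 = \<i> * spin_rho" "spin_state 3 = \<i> * spin_tau"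
    "spin_state 4 = - spin_rho" "spin_state 5 = - spin_tau" "spin_state 6 = - (\<i> * spin_rho)" "spin_state 7 = - (\<i> * spin_tau)"
    by (simp_all add: spin_state_def)
qed

lemma spin_lift_circle_spin_state:
  assumes "k < 8" shows "spin_lift circle_loop (spin_state k) (spin_state ([1, 7, 2, 4, 5, 3, 6, 0] ! k))"
proof -
  have "k \<in> {0, 1, 2, 3, 4, 5, 6, 7}" using assms by auto
  then show ?thesis
    using spin_lift_circle spin_lift_circle[THEN spin_lift_uminus]
    by (auto simp: spin_state_values)
qed

lemma letter_perm_bij:
  "k < 8 \<Longrightarrow> letter_perm (inverse_letter x) ! (letter_perm x ! k) = k"
  "k < 8 \<Longrightarrow> letter_perm x ! k < 8" "length (letter_perm x) = 8"
proof -
  have "k \<in> {0, 1, 2, 3, 4, 5, 6, 7}" if "k < 8" using that by auto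
  then show "k < 8 \<Longrightarrow> letter_perm (inverse_letter x) ! (letter_perm x ! k) = k"
    "k < 8 \<Longrightarrow> letter_perm x ! k < 8" "length (letter_perm x) = 8"
    by (cases x; auto simp: inverse_letter_def)+
qed

lemma spin_lift_letter:
  assumes "k < 8" shows "spin_lift (letter_loop (x, 2)) (spin_state k) (spin_state (letter_perm x ! k))"
proof -
  have pos: "spin_lift circle_loop (spin_state j) (spin_state (letter_perm (False, False) ! j))" if "j < 8" for j
    using spin_lift_circle_spin_state[OF that] by simp
  have a: "spin_lift (letter_loop ((False, v), 2)) (spin_state j) (spin_state (letter_perm (False, v) ! j))"
    if "j < 8" for v j
  proof (cases v)
    case True
    have "letter_perm (False, True) ! j < 8" "letter_perm (False, False) ! (letter_perm (False, True) ! j) = j"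
      using letter_perm_bij(1)[OF that, of "(False, True)"] letter_perm_bij(2)[OF that, of "(False, True)"]
      by (simp_all add: inverse_letter_def)
    then show ?thesis
      using spin_lift_reverse[OF pos[of "letter_perm (False, True) ! j"]] True
      by (simp only: letter_loop_on)
  qed (use pos[OF that] letter_loop_on in simp)
  obtain b v where x: "x = (b, v)" by (cases x)
  show ?thesis
  proof (cases b)
    case True
    \<comment> \<open>Multiplication by \<open>\<i>\<close> adds 2 to the index, so j is the index of the quotient
        by \<open>\<i>\<close>.\<close>
    define j where "j = (k + 6) mod 8"
    have j: "j < 8" "spin_state k = \<i> * spin_state j" "spin_state (letter_perm (True, v) ! k) = \<i> * spin_state (letter_perm (False, v) ! j)"
    proof -
      have "k \<in> {0, 1, 2, 3, 4, 5, 6, 7}" using assms by auto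
      then show "spin_state k = \<i> * spin_state j" "spin_state (letter_perm (True, v) ! k) = \<i> * spin_state (letter_perm (False, v) ! j)"
        by (auto simp: j_def spin_state_values)
    qed (simp add: j_def)
    show ?thesis
    proof -
      have x': "x = (True, v)" using x True by simp
      show ?thesis
        unfolding x' letter_loop_on(3) j(2,3) by (rule spin_lift_rotate[OF a[OF j(1)]])
    qed
  qed (use a[OF assms] x in simp)
qed

lemma spin_state_root:
  assumes "k < 8" shows "poly (quartic 0) ((spin_state k)\<^sup>2) = 0"
proof -
  obtain s where "pathstart s = spin_state k" "\<forall>t\<in>{0..1}. poly (quartic (circle_loop t)) ((s t)\<^sup>2) = 0"
    using spin_lift_circle_spin_state[OF assms] unfolding spin_lift_def by blast
  then have "s 0 = spin_state k" "poly (quartic (circle_loop 0)) ((s 0)\<^sup>2) = 0"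
    by (simp add: pathstart_def, blast intro: bspec[of "{0..1}" _ 0] zero_le_one atLeastAtMost_iff[THEN iffD2] order_refl)
  then show ?thesis by simp
qed

lemma spin_lift_word:
  "k < 8 \<Longrightarrow> spin_lift (word_path (on w)) (spin_state k) (spin_state (word_perm w ! k))"
proof (induction w arbitrary: k)
  case Nil
  then have "k \<in> {0, 1, 2, 3, 4, 5, 6, 7}" by auto
  then have "word_perm [] ! k = k" by auto
  then show ?case
    using spin_state_root[OF Nil] unfolding spin_lift_def
    by (intro exI[of _ "\<lambda>t. spin_state k"]) (auto simp: path_def pathstart_def pathfinish_def)
next
  case (Cons x w)
  show ?case
    using spin_lift_join[OF spin_lift_letter[OF Cons.prems, of x] Cons.IH[OF letter_perm_bij(2)[OF Cons.prems]]]
      Cons.prems letter_perm_bij(3)[of x] by simp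
qed

lemma word_perm_length: "length (word_perm w) = 8"
  by (cases w) (simp_all add: letter_perm_bij(3))

lemma word_perm_append: "word_perm (u @ v) = map ((!) (word_perm v)) (word_perm u)"
proof (induction u)
  case Nil
  show ?case by (rule nth_equalityI) (auto simp: word_perm_length nth_Cons' numeral_eq_Suc less_Suc_eq)
next
  case (Cons x u)
  then show ?case
    using letter_perm_bij(2)[of _ x] letter_perm_bij(3)[of x] word_perm_length[of u]
    by (auto intro!: nth_equalityI simp: in_set_conv_nth)
qed

text \<open>
  The monodromy of a commutator lies in the quaternion group. Conjugation by a generator permutes
  the three cyclic subgroups of order 4, so its commutator with an element of order 4 again has
  order 4.
\<close>

fun deep_word :: "nat \<Rightarrow> letter list" where
  "deep_word 0 = letters.commutator [(False, False)] [(True, False)]"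
| "deep_word (Suc n) = letters.commutator [(False, False)] (deep_word n)"

text \<open>
  Two elements of order 4 in different cyclic subgroups of the quaternion group have commutator
  \<open>-1\<close>.
\<close>

definition flipping_word :: "nat \<Rightarrow> letter list" where
  "flipping_word n = letters.commutator (deep_word n)
     ([(False, False)] @ deep_word n @ letters.winv [(False, False)])"

lemma word_perm_commutator:
  "word_perm (letters.commutator p q) =
     map ((!) (word_perm (letters.winv q))) (map ((!) (word_perm (letters.winv p))) (map ((!) (word_perm q)) (word_perm p)))"
  "word_perm (letters.winv (letters.commutator p q)) =
     map ((!) (word_perm (letters.winv p))) (map ((!) (word_perm (letters.winv q))) (map ((!) (word_perm p)) (word_perm q)))"
proof -
  have "letters.commutator p q = ((p @ q) @ letters.winv p) @ letters.winv q"
    "letters.winv (letters.commutator p q) = ((q @ p) @ letters.winv q) @ letters.winv p"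
    by (simp_all add: letters.commutator_def letters.winv_append)
  then show "word_perm (letters.commutator p q) =
     map ((!) (word_perm (letters.winv q))) (map ((!) (word_perm (letters.winv p))) (map ((!) (word_perm q)) (word_perm p)))"
  "word_perm (letters.winv (letters.commutator p q)) =
     map ((!) (word_perm (letters.winv p))) (map ((!) (word_perm (letters.winv q))) (map ((!) (word_perm p)) (word_perm q)))"
    by (simp_all only: word_perm_append)
qed

lemma word_perm_generator:
  "word_perm [(False, False)] = [1, 7, 2, 4, 5, 3, 6, 0]"
  "word_perm (letters.winv [(False, False)]) = [7, 0, 2, 5, 3, 4, 6, 1]"
  "word_perm [(True, False)] = [0, 2, 3, 1, 4, 6, 7, 5]"
  "word_perm (letters.winv [(True, False)]) = [0, 3, 1, 2, 4, 7, 5, 6]"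
  by (simp_all add: letters.winv_def inverse_letter_def)

text \<open>
  The cases are generators of the three cyclic subgroups of order 4 and their inverses; the
  induction step permutes them cyclically.
\<close>

lemma deep_word_perm:
  "(word_perm (deep_word n) = [1, 4, 7, 2, 5, 0, 3, 6] \<and> word_perm (letters.winv (deep_word n)) = [5, 0, 3, 6, 1, 4, 7, 2]) \<or>
   (word_perm (deep_word n) = [6, 7, 0, 1, 2, 3, 4, 5] \<and> word_perm (letters.winv (deep_word n)) = [2, 3, 4, 5, 6, 7, 0, 1]) \<or>
   (word_perm (deep_word n) = [3, 6, 1, 4, 7, 2, 5, 0] \<and> word_perm (letters.winv (deep_word n)) = [7, 2, 5, 0, 3, 6, 1, 4])"
proof (induction n)
  case 0
  show ?case
    unfolding deep_word.simps word_perm_commutator word_perm_generator by simp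
next
  case (Suc n)
  then show ?case
    unfolding deep_word.simps word_perm_commutator word_perm_generator
    by (elim disjE conjE) simp_all
qed

lemma flipping_word_perm: "word_perm (flipping_word n) = [4, 5, 6, 7, 0, 1, 2, 3]"
proof -
  have conj: "word_perm ([(False, False)] @ w @ letters.winv [(False, False)])
      = map ((!) [7, 0, 2, 5, 3, 4, 6, 1]) (map ((!) (word_perm w)) [1, 7, 2, 4, 5, 3, 6, 0])" for w
  proof -
    have "[(False, False)] @ w @ letters.winv [(False, False)] = ([(False, False)] @ w) @ letters.winv [(False, False)]"
      by simp
    then show ?thesis by (simp only: word_perm_append word_perm_generator)
  qed
  have "letters.winv ([(False, False)] @ w @ letters.winv [(False, False)])
      = [(False, False)] @ letters.winv w @ letters.winv [(False, False)]" for w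
    by (simp only: letters.winv_append letters.winv_winv append_assoc)
  then have conj_inv: "word_perm (letters.winv ([(False, False)] @ w @ letters.winv [(False, False)]))
      = map ((!) [7, 0, 2, 5, 3, 4, 6, 1]) (map ((!) (word_perm (letters.winv w))) [1, 7, 2, 4, 5, 3, 6, 0])" for w
    by (simp only: conj)
  show ?thesis
    using deep_word_perm[of n] unfolding flipping_word_def word_perm_commutator conj conj_inv
    by (elim disjE conjE) simp_all
qed

lemma flipping_word_deep: "letters.deep TYPE('a::ab_group_add) (n + 3) (flipping_word n)"
proof -
  have "letters.deep TYPE('a) (n + 2) (deep_word n)"
  proof (induction n)
    case 0
    show ?case using letters.deep_commutator[OF letters.deep_1 letters.deep_1, where 'a = 'a] by (simp add: numeral_2_eq_2)
  next
    case (Suc n)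
    from letters.deep_commutator[OF letters.deep_1 this] show ?case by simp
  qed
  from letters.deep_commutator[OF this letters.deep_1]
  have "letters.deep TYPE('a) (n + 2 + 1) (flipping_word n)"
    unfolding flipping_word_def .
  moreover have "n + 2 + 1 = n + 3" by simp
  ultimately show ?thesis by (simp only:)
qed

lemma flipping_word_spin_lift: "spin_lift (word_path (on (flipping_word n))) spin_tau (- spin_tau)"
proof -
  have "spin_state 5 = - spin_tau" "spin_state 1 = spin_tau" by (simp_all add: spin_state_def)
  then show ?thesis using spin_lift_word[of 1 "flipping_word n"] by (simp add: flipping_word_perm)
qed

section \<open>The three-sphere in the complex plane of dimension two\<close>

text \<open>
  \<open>real^4\<close> as pairs of complex numbers; \<open>fstc\<close> and \<open>sndc\<close> are
  the two components.
\<close>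

definition emb :: "complex \<Rightarrow> complex \<Rightarrow> real^4" where
  "emb z w = (\<chi> i. if i = 1 then Re z else if i = 2 then Im z else if i = 3 then Re w else Im w)"

definition fstc :: "real^4 \<Rightarrow> complex" where "fstc p = Complex (p $ 1) (p $ 2)"
definition sndc :: "real^4 \<Rightarrow> complex" where "sndc p = Complex (p $ 3) (p $ 4)"

lemma emb_nth [simp]: "emb z w $ 1 = Re z" "emb z w $ 2 = Im z" "emb z w $ 3 = Re w" "emb z w $ 4 = Im w"
  by (simp_all add: emb_def)

lemma fstc_emb [simp]: "fstc (emb z w) = z" and sndc_emb [simp]: "sndc (emb z w) = w"
  by (simp_all add: fstc_def sndc_def)

lemma emb_fstc_sndc [simp]: "emb (fstc p) (sndc p) = p"
  by (simp add: vec_eq_iff forall_4 fstc_def sndc_def)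

lemma emb_eq_iff [simp]: "emb z w = emb z' w' \<longleftrightarrow> z = z' \<and> w = w'"
  by (metis fstc_emb sndc_emb)

lemma emb_add: "emb z w + emb z' w' = emb (z + z') (w + w')"
  and emb_diff: "emb z w - emb z' w' = emb (z - z') (w - w')"
  and emb_scaleR: "c *\<^sub>R emb z w = emb (c *\<^sub>R z) (c *\<^sub>R w)"
  and emb_0 [simp]: "emb 0 0 = 0"
  by (simp_all add: vec_eq_iff forall_4)

lemma fstc_scaleR [simp]: "fstc (c *\<^sub>R p) = c *\<^sub>R fstc p" and sndc_scaleR [simp]: "sndc (c *\<^sub>R p) = c *\<^sub>R sndc p"
  by (simp_all add: fstc_def sndc_def complex_eq_iff)

lemma norm_emb: "norm (emb z w) = sqrt ((cmod z)\<^sup>2 + (cmod w)\<^sup>2)"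
  by (simp add: norm_vec_def L2_set_def sum_4 cmod_power2 add.assoc)

lemma bounded_linear_emb: "bounded_linear (\<lambda>(z, w). emb z w)"
proof (rule bounded_linear_intro[of _ 1])
  fix x :: "complex \<times> complex"
  show "norm (case x of (z, w) \<Rightarrow> emb z w) \<le> norm x * 1"
    by (cases x) (simp add: norm_emb norm_prod_def)
qed (auto simp: emb_add emb_scaleR split: prod.splits)

lemma continuous_on_emb [continuous_intros]:
  "continuous_on A f \<Longrightarrow> continuous_on A g \<Longrightarrow> continuous_on A (\<lambda>x. emb (f x) (g x))"
  using bounded_linear.continuous_on[OF bounded_linear_emb, of A "\<lambda>x. (f x, g x)"]
  by (simp add: continuous_intros)

lemma continuous_on_fstc [continuous_intros]: "continuous_on A f \<Longrightarrow> continuous_on A (\<lambda>x. fstc (f x))"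
  and continuous_on_sndc [continuous_intros]: "continuous_on A f \<Longrightarrow> continuous_on A (\<lambda>x. sndc (f x))"
  unfolding fstc_def sndc_def Complex_eq by (intro continuous_intros; assumption)+

definition proj :: "real^4 \<Rightarrow> real^4" where "proj p = p /\<^sub>R norm p"

lemma proj_in_S3: "p \<noteq> 0 \<Longrightarrow> proj p \<in> S3"
  by (simp add: proj_def)

lemma proj_scale: "c > 0 \<Longrightarrow> proj (c *\<^sub>R p) = proj p"
  by (simp add: proj_def)

lemma proj_S3: "p \<in> S3 \<Longrightarrow> proj p = p"
  by (simp add: proj_def)

lemma continuous_on_proj:
  "continuous_on A f \<Longrightarrow> (\<And>x. x \<in> A \<Longrightarrow> f x \<noteq> 0) \<Longrightarrow> continuous_on A (\<lambda>x. proj (f x))"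
  unfolding proj_def by (intro continuous_intros) auto

lemma proj_eqD:
  assumes "proj p = proj q" "p \<noteq> 0" "q \<noteq> 0"
  obtains c where "c > 0" "p = c *\<^sub>R q"
proof
  show "norm p / norm q > 0" using assms by simp
  have "p = norm p *\<^sub>R proj p" using assms(2) by (simp add: proj_def)
  also have "\<dots> = norm p *\<^sub>R proj q" by (simp only: assms(1))
  also have "\<dots> = (norm p / norm q) *\<^sub>R q" by (simp add: proj_def divide_inverse)
  finally show "p = (norm p / norm q) *\<^sub>R q" .
qed

section \<open>Isotopies from positively homogeneous maps\<close>

text \<open>
  A positively homogeneous bijection maps rays to rays and hence acts on the sphere of rays; this
  avoids constructing isotopies within the curved sphere.
\<close>

lemma homogeneous_ambient_isotopy:
  fixes F :: "real \<Rightarrow> real^4 \<Rightarrow> real^4"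
  assumes cont: "continuous_on ({0..1} \<times> UNIV) (\<lambda>(t, p). F t p)"
    and bij: "\<And>t. t \<in> {0..1} \<Longrightarrow> bij (F t)"
    and hom: "\<And>t c p. t \<in> {0..1} \<Longrightarrow> c > 0 \<Longrightarrow> F t (c *\<^sub>R p) = c *\<^sub>R F t p"
    and id: "\<And>p. F 0 p = p"
  shows "ambient_isotopy (\<lambda>t p. proj (F t p))"
proof -
  have F0: "F t 0 = 0" if "t \<in> {0..1}" for t
    using hom[OF that, of 2 0] by (simp add: scaleR_2)
  have nz: "F t p \<noteq> 0" if "t \<in> {0..1}" "p \<in> S3" for t p
    using bij[OF that(1)] F0[OF that(1)] that(2) by (auto simp: bij_def inj_def dest!: spec2[of _ p 0])
  have c: "continuous_on ({0..1} \<times> S3) (\<lambda>(t, p). proj (F t p))"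
    unfolding case_prod_beta
  proof (rule continuous_on_proj)
    show "continuous_on ({0..1} \<times> S3) (\<lambda>x. F (fst x) (snd x))"
      using cont unfolding case_prod_beta by (rule continuous_on_subset) auto
  qed (use nz in auto)
  have "\<exists>g. homeomorphism S3 S3 (\<lambda>p. proj (F t p)) g" if t: "t \<in> {0..1}" for t
  proof (rule homeomorphism_compact)
    show "compact S3" by (rule compact_sphere)
    have "continuous_on S3 ((\<lambda>(t, p). proj (F t p)) \<circ> (\<lambda>p. (t, p)))"
      by (intro continuous_on_compose continuous_intros continuous_on_subset[OF c]) (use t in auto)
    then show "continuous_on S3 (\<lambda>p. proj (F t p))" by (simp add: o_def)
    show "(\<lambda>p. proj (F t p)) ` S3 = S3"
    proof
      show "(\<lambda>p. proj (F t p)) ` S3 \<subseteq> S3" using nz[OF t] proj_in_S3 by blast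
      show "S3 \<subseteq> (\<lambda>p. proj (F t p)) ` S3"
      proof
        fix q :: "real^4" assume q: "q \<in> S3"
        obtain p where p: "q = F t p" using bij[OF t] by (metis bij_pointE)
        have p0: "p \<noteq> 0" using q p F0[OF t] by auto
        have "proj (F t (proj p)) = proj (inverse (norm p) *\<^sub>R q)"
          using hom[OF t, of "inverse (norm p)" p] p0 p by (simp add: proj_def)
        also have "\<dots> = q" using p0 q by (simp add: proj_scale proj_S3)
        finally show "q \<in> (\<lambda>p. proj (F t p)) ` S3" using proj_in_S3[OF p0] by (metis imageI)
      qed
    qed
    show "inj_on (\<lambda>p. proj (F t p)) S3"
    proof (rule inj_onI)
      fix p q :: "real^4" assume pq: "p \<in> S3" "q \<in> S3" "proj (F t p) = proj (F t q)"
      obtain c where c: "c > 0" "F t p = c *\<^sub>R F t q"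
        using proj_eqD[OF pq(3) nz[OF t pq(1)] nz[OF t pq(2)]] by blast
      then have "F t p = F t (c *\<^sub>R q)" using hom[OF t] by simp
      then have "p = c *\<^sub>R q" using bij[OF t] by (simp add: bij_def inj_eq)
      then show "p = q" using pq(1,2) c(1) by simp
    qed
  qed
  then show ?thesis
    unfolding ambient_isotopy_def using c id proj_S3 by auto
qed

lemma isotopic_homogeneous:
  fixes F :: "real \<Rightarrow> real^4 \<Rightarrow> real^4"
  assumes "continuous_on ({0..1} \<times> UNIV) (\<lambda>(t, p). F t p)"
    and "\<And>t. t \<in> {0..1} \<Longrightarrow> bij (F t)"
    and "\<And>t c p. t \<in> {0..1} \<Longrightarrow> c > 0 \<Longrightarrow> F t (c *\<^sub>R p) = c *\<^sub>R F t p"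
    and "\<And>p. F 0 p = p" and "\<And>x. proj (F 1 (K x)) = L x"
  shows "isotopic K L"
proof -
  have "circle_reparam (\<lambda>x. x)" by (simp add: circle_reparam_def strict_mono_def)
  then show ?thesis
    unfolding isotopic_def using homogeneous_ambient_isotopy[OF assms(1-4)] assms(5) by blast
qed

lemma isotopic_refl: "range K \<subseteq> S3 \<Longrightarrow> isotopic K K"
  by (rule isotopic_homogeneous[of "\<lambda>t p. p"])
     (auto simp: case_prod_beta bij_id[unfolded id_def] intro!: continuous_intros proj_S3)

lemma isotopic_trans:
  assumes "isotopic K L" "isotopic L M" shows "isotopic K M"
proof -
  obtain H \<phi> where H: "ambient_isotopy H" "circle_reparam \<phi>" "\<And>x. H 1 (K x) = L (\<phi> x)"
    using assms(1) unfolding isotopic_def by blast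
  obtain G \<psi> where G: "ambient_isotopy G" "circle_reparam \<psi>" "\<And>x. G 1 (L x) = M (\<psi> x)"
    using assms(2) unfolding isotopic_def by blast
  have im: "H t p \<in> S3" if "t \<in> {0..1}" "p \<in> S3" for t p
    using H(1) that unfolding ambient_isotopy_def homeomorphism_def by blast
  have "ambient_isotopy (\<lambda>t. G t \<circ> H t)"
    unfolding ambient_isotopy_def
  proof (intro conjI ballI)
    have c: "continuous_on ({0..1} \<times> S3) (\<lambda>x. H (fst x) (snd x))" "continuous_on ({0..1} \<times> S3) (\<lambda>x. G (fst x) (snd x))"
      using H(1) G(1) by (simp_all add: ambient_isotopy_def case_prod_beta)
    have "continuous_on ({0..1} \<times> S3) (\<lambda>x. (fst x, H (fst x) (snd x)))"
      by (intro continuous_intros c)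
    moreover have "(\<lambda>x. (fst x, H (fst x) (snd x))) ` ({0..1} \<times> S3) \<subseteq> {0..1} \<times> S3"
      using im by (auto simp del: mem_sphere_0 mem_sphere)
    ultimately have "continuous_on ({0..1} \<times> S3) (\<lambda>x. G (fst (fst x, H (fst x) (snd x))) (snd (fst x, H (fst x) (snd x))))"
      by (rule continuous_on_compose2[OF c(2)])
    then show "continuous_on ({0..1} \<times> S3) (\<lambda>(t, p). (G t \<circ> H t) p)"
      by (simp add: case_prod_beta)
    show "\<exists>g. homeomorphism S3 S3 (G t \<circ> H t) g" if "t \<in> {0..1}" for t
      using H(1) G(1) that unfolding ambient_isotopy_def by (meson homeomorphism_compose)
    show "(G 0 \<circ> H 0) p = p" if "p \<in> S3" for p
      using H(1) G(1) that unfolding ambient_isotopy_def by simp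
  qed
  moreover have "circle_reparam (\<psi> \<circ> \<phi>)"
    unfolding circle_reparam_def
  proof (intro conjI allI)
    show "continuous_on UNIV (\<psi> \<circ> \<phi>)"
      using H(2) G(2) unfolding circle_reparam_def by (metis continuous_on_compose continuous_on_subset subset_UNIV)
    show "strict_mono (\<psi> \<circ> \<phi>)"
      using H(2) G(2) unfolding circle_reparam_def by (simp add: strict_mono_o)
    show "(\<psi> \<circ> \<phi>) (x + 1) = (\<psi> \<circ> \<phi>) x + 1" for x
      using H(2) G(2) unfolding circle_reparam_def by simp
  qed
  ultimately show ?thesis
    unfolding isotopic_def using H(3) G(3) by (intro exI[of _ "\<lambda>t. G t \<circ> H t"] exI[of _ "\<psi> \<circ> \<phi>"]) simp
qed

text \<open>
  Solving \<open>x + f x = y\<close> is a fixed point problem for the contraction \<open>x \<mapsto>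
  y - f x\<close>.
\<close>

lemma bij_plus_contraction:
  fixes f :: "'a::banach \<Rightarrow> 'a"
  assumes "0 \<le> c" "c < 1" "\<And>x y. norm (f x - f y) \<le> c * norm (x - y)"
  shows "bij (\<lambda>x. x + f x)"
proof (rule bijI)
  show "inj (\<lambda>x. x + f x)"
  proof (rule injI)
    fix x y assume "x + f x = y + f y"
    then have "norm (x - y) = norm (f x - f y)" by (metis add_diff_cancel_left' diff_add_eq_diff_diff_swap norm_minus_commute add_diff_eq diff_eq_eq)
    with assms(3)[of x y] have "(1 - c) * norm (x - y) \<le> 0" by (simp add: algebra_simps)
    then show "x = y" using assms(2) by (simp add: mult_le_0_iff)
  qed
  show "surj (\<lambda>x. x + f x)"
  proof (rule surjI)
    fix y
    have "\<exists>!x. y - f x = x"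
      by (rule banach_fix_type[of c]) (use assms in \<open>auto simp: dist_norm norm_minus_commute\<close>)
    then have "y - f (THE x. y - f x = x) = (THE x. y - f x = x)" by (rule theI')
    then show "(THE x. y - f x = x) + f (THE x. y - f x = x) = y" by (metis diff_add_cancel)
  qed
qed

text \<open>
  A displacement in the first coordinate, described by \<open>D\<close> on the points with second
  coordinate on the unit circle and extended positively homogeneously.
\<close>

definition fibre_shift :: "(complex \<Rightarrow> complex \<Rightarrow> complex) \<Rightarrow> real \<Rightarrow> real^4 \<Rightarrow> real^4" where
  "fibre_shift D s p = emb (fstc p + of_real (s * cmod (sndc p)) * D (sndc p / of_real (cmod (sndc p))) (fstc p / of_real (cmod (sndc p)))) (sndc p)"

lemma fibre_shift_scaleR:
  assumes "k > 0" shows "fibre_shift D t (k *\<^sub>R p) = k *\<^sub>R fibre_shift D t p"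
proof -
  have q: "k *\<^sub>R x / of_real (cmod (k *\<^sub>R sndc p)) = x / of_real (cmod (sndc p))" for x :: complex
    using assms by (simp add: scaleR_conv_of_real norm_mult)
  show ?thesis
    unfolding fibre_shift_def fstc_scaleR sndc_scaleR q emb_scaleR
    using assms by (simp add: scaleR_conv_of_real norm_mult algebra_simps)
qed

lemma fibre_shift_isotopic:
  assumes D: "continuous_on (sphere 0 1 \<times> UNIV) (\<lambda>(u, z). D u z)"
    and bdd: "\<And>u z. norm u = 1 \<Longrightarrow> norm (D u z) \<le> B"
    and lip: "\<And>u z z'. norm u = 1 \<Longrightarrow> norm (D u z - D u z') \<le> c * norm (z - z')" and c: "0 \<le> c" "c < 1"
    and KL: "\<And>x. proj (fibre_shift D 1 (K x)) = L x"
  shows "isotopic K L"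
proof (rule isotopic_homogeneous[of "fibre_shift D"])
  show "fibre_shift D 0 p = p" for p by (simp add: fibre_shift_def)
  show "fibre_shift D t (k *\<^sub>R p) = k *\<^sub>R fibre_shift D t p" if "k > 0" for t k p
    by (rule fibre_shift_scaleR[OF that])
  show "bij (fibre_shift D t)" if t: "t \<in> {0..1}" for t
  proof -
    have fib: "bij (\<lambda>z. z + of_real (t * cmod w) * D (w / of_real (cmod w)) (z / of_real (cmod w)))" for w
    proof (cases "w = 0")
      case False
      show ?thesis
      proof (rule bij_plus_contraction[OF c])
        fix z z'
        let ?D = "\<lambda>z. D (w / of_real (cmod w)) (z / of_real (cmod w))"
        have "norm (of_real (t * cmod w) * ?D z - of_real (t * cmod w) * ?D z') = t * cmod w * norm (?D z - ?D z')"
          using t by (simp add: norm_mult flip: right_diff_distrib)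
        also have "\<dots> \<le> t * cmod w * (c * norm (z / of_real (cmod w) - z' / of_real (cmod w)))"
          using t False by (intro mult_left_mono lip) (auto simp: norm_divide)
        also have "\<dots> = t * (c * norm (z - z'))"
          using False by (simp add: norm_divide flip: diff_divide_distrib)
        also have "\<dots> \<le> 1 * (c * norm (z - z'))"
          using t c by (intro mult_right_mono) auto
        finally show "norm (of_real (t * cmod w) * ?D z - of_real (t * cmod w) * ?D z') \<le> c * norm (z - z')"
          by simp
      qed
    qed (simp add: bij_id[unfolded id_def])
    show ?thesis
    proof (rule bijI)
      show "inj (fibre_shift D t)"
      proof (rule injI)
        fix p q assume "fibre_shift D t p = fibre_shift D t q"
        then have "sndc p = sndc q" "fstc p = fstc q"
          using fib[of "sndc p"] by (auto simp: fibre_shift_def bij_def dest: injD)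
        then show "p = q" by (metis emb_fstc_sndc)
      qed
      show "surj (fibre_shift D t)"
      proof (unfold surj_def, intro allI)
        fix q
        obtain z where "fstc q = z + of_real (t * cmod (sndc q)) * D (sndc q / of_real (cmod (sndc q))) (z / of_real (cmod (sndc q)))"
          using fib[of "sndc q"] by (metis (no_types, lifting) bij_def surjD)
        then have "q = fibre_shift D t (emb z (sndc q))" by (simp add: fibre_shift_def vec_eq_iff)
          (metis emb_fstc_sndc)
        then show "\<exists>p. q = fibre_shift D t p" by blast
      qed
    qed
  qed
  show "continuous_on ({0..1} \<times> UNIV) (\<lambda>(t, p). fibre_shift D t p)"
  proof -
    define g where "g = (\<lambda>x::real \<times> (real^4). of_real (fst x * cmod (sndc (snd x))) * D (sndc (snd x) / of_real (cmod (sndc (snd x)))) (fstc (snd x) / of_real (cmod (sndc (snd x)))))"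
    have "isCont g x" for x
    proof (cases "sndc (snd x) = 0")
      case False
      let ?U = "{x::real \<times> (real^4). sndc (snd x) \<noteq> 0}"
      have op: "open ?U" by (intro open_Collect_neq continuous_intros)
      have 1: "continuous_on ?U (\<lambda>x. (sndc (snd x) / of_real (cmod (sndc (snd x))), fstc (snd x) / of_real (cmod (sndc (snd x)))))"
        by (intro continuous_intros) auto
      have "continuous_on ?U (\<lambda>x. D (sndc (snd x) / of_real (cmod (sndc (snd x)))) (fstc (snd x) / of_real (cmod (sndc (snd x)))))"
      proof -
        have "(\<lambda>x. (sndc (snd x) / of_real (cmod (sndc (snd x))), fstc (snd x) / of_real (cmod (sndc (snd x))))) ` ?U
            \<subseteq> sphere 0 1 \<times> UNIV"
          by (auto simp: norm_divide)
        from continuous_on_compose2[OF D 1 this] show ?thesis by (simp add: case_prod_beta)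
      qed
      then have "continuous_on ?U g" unfolding g_def by (intro continuous_intros)
      then show ?thesis using op False continuous_on_eq_continuous_at by blast
    next
      case True
      \<comment> \<open>At points with second coordinate 0 the direction of that coordinate is discontinuous, but
          the displacement is bounded by its absolute value.\<close>
      have b: "norm (g y) \<le> \<bar>fst y\<bar> * cmod (sndc (snd y)) * B" for y
      proof (cases "sndc (snd y) = 0")
        case False
        show ?thesis
        proof -
          let ?d = "D (sndc (snd y) / of_real (cmod (sndc (snd y)))) (fstc (snd y) / of_real (cmod (sndc (snd y))))"
          have "norm (g y) = (\<bar>fst y\<bar> * cmod (sndc (snd y))) * norm ?d"
            unfolding g_def norm_mult norm_of_real by (simp add: abs_mult)
          also have "\<dots> \<le> (\<bar>fst y\<bar> * cmod (sndc (snd y))) * B"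
            using False by (intro mult_left_mono bdd) (auto simp: norm_divide)
          finally show ?thesis .
        qed
      qed (simp add: g_def)
      have "isCont (\<lambda>y::real \<times> (real^4). \<bar>fst y\<bar> * cmod (sndc (snd y)) * B) x"
      proof -
        have "continuous_on UNIV (\<lambda>y::real \<times> (real^4). \<bar>fst y\<bar> * cmod (sndc (snd y)) * B)"
          by (intro continuous_intros)
        then show ?thesis using continuous_on_eq_continuous_at[OF open_UNIV] by blast
      qed
      then have "((\<lambda>y. \<bar>fst y\<bar> * cmod (sndc (snd y)) * B) \<longlongrightarrow> 0) (at x)"
        using True by (simp add: isCont_def)
      then have "(g \<longlongrightarrow> 0) (at x)"
        by (rule Lim_null_comparison[rotated]) (simp add: b)
      moreover have "g x = 0" using True by (simp add: g_def)
      ultimately show ?thesis by (simp add: isCont_def)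
    qed
    then have "continuous_on ({0..1} \<times> UNIV) g" by (simp add: continuous_at_imp_continuous_on)
    then have "continuous_on ({0..1} \<times> UNIV) (\<lambda>x::real \<times> (real^4). emb (fstc (snd x) + g x) (sndc (snd x)))"
      by (intro continuous_intros)
    then show ?thesis by (simp add: g_def fibre_shift_def case_prod_beta)
  qed
qed (rule KL)

section \<open>Functions of the angle\<close>

text \<open>
  Angles are measured in full turns.
\<close>

definition unit :: "real \<Rightarrow> complex" where "unit x = cis (2 * pi * x)"
definition turn :: "complex \<Rightarrow> real" where "turn w = Arg2pi w / (2 * pi)"

lemma norm_unit [simp]: "cmod (unit x) = 1" by (simp add: unit_def)
lemma unit_nonzero [simp]: "unit x \<noteq> 0" by (simp add: unit_def)
lemma unit_0 [simp]: "unit 0 = 1" by (simp add: unit_def)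
lemma unit_add: "unit (x + y) = unit x * unit y" by (simp add: unit_def cis_mult ring_distribs)
lemma unit_diff: "unit (x - y) = unit x / unit y" by (simp add: unit_def cis_divide algebra_simps)
lemma unit_int [simp]: "unit (of_int k) = 1"
  by (simp add: unit_def cis.ctr complex_eq_iff cos_int_2pin sin_int_2pin)

lemma unit_eq_iff: "unit x = unit y \<longleftrightarrow> x - y \<in> \<int>"
proof
  assume "unit x = unit y"
  then have "unit (x - y) = 1" by (simp add: unit_diff)
  then have "cos (2 * pi * (x - y)) = 1" by (simp add: unit_def complex_eq_iff)
  then obtain n :: int where "2 * pi * (x - y) = of_int n * 2 * pi" by (auto simp: cos_one_2pi_int)
  then have "x - y = of_int n" by simp
  then show "x - y \<in> \<int>" by simp
next
  assume "x - y \<in> \<int>"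
  then obtain n where "x - y = of_int n" by (rule Ints_cases)
  then have "x = y + of_int n" by simp
  then show "unit x = unit y" by (simp add: unit_add)
qed

lemma continuous_on_unit [continuous_intros]: "continuous_on A f \<Longrightarrow> continuous_on A (\<lambda>x. unit (f x))"
  unfolding unit_def cis_conv_exp by (intro continuous_intros)

lemma turn_range: "0 \<le> turn w" "turn w < 1"
  using Arg2pi[of w] by (auto simp: turn_def)

lemma unit_turn: "w \<noteq> 0 \<Longrightarrow> unit (turn w) = w / of_real (cmod w)"
  using Arg2pi_eq[of w] by (simp add: unit_def turn_def cis_conv_exp field_simps)

lemma turn_unit: "turn (unit x) = frac x"
proof -
  have "unit (turn (unit x)) = unit x" by (simp add: unit_turn)
  moreover have "unit (frac x) = unit x" by (simp add: unit_eq_iff frac_def)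
  ultimately have "unit (turn (unit x)) = unit (frac x)" by simp
  then obtain n :: int where "turn (unit x) - frac x = of_int n" by (auto simp: unit_eq_iff elim: Ints_cases)
  moreover have "-1 < turn (unit x) - frac x" "turn (unit x) - frac x < 1"
    using turn_range[of "unit x"] frac_ge_0[of x] frac_lt_1[of x] by linarith+
  ultimately have "real_of_int n > -1" "real_of_int n < 1" by linarith+
  then have "n = 0" by linarith
  then show ?thesis using \<open>turn (unit x) - frac x = of_int n\<close> by simp
qed

lemma turn_scale: "c > 0 \<Longrightarrow> turn (of_real c * w) = turn w"
  by (simp add: turn_def Arg2pi_times_of_real)

text \<open>
  The angle is continuous off the positive real axis. Across that axis the principal argument is
  used, and the agreement at the ends of the interval makes the two branches match.
\<close>

lemma circle_function_continuous:
  fixes f :: "real \<Rightarrow> 'b::topological_space \<Rightarrow> 'c::real_normed_vector"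
  assumes f: "continuous_on ({0..1} \<times> UNIV) (\<lambda>(t, y). f t y)" and ends: "\<And>y. f 0 y = f 1 y"
  shows "continuous_on ((- {0}) \<times> UNIV) (\<lambda>(w, y). f (turn w) y)"
proof -
  let ?A = "(- \<real>\<^sub>\<ge>\<^sub>0) \<times> (UNIV :: 'b set)" and ?B = "(- \<real>\<^sub>\<le>\<^sub>0) \<times> (UNIV :: 'b set)"
  have f': "continuous_on ({0..1} \<times> UNIV) (\<lambda>x. f (fst x) (snd x))"
    using f by (simp add: case_prod_beta)
  have comp: "continuous_on C (\<lambda>x. f (g x) (snd x))"
    if "continuous_on C g" "\<And>x. x \<in> C \<Longrightarrow> g x \<in> {0..1}" for C :: "(complex \<times> 'b) set" and g
  proof -
    have "continuous_on C (\<lambda>x. (g x, snd x))" by (intro continuous_intros that(1))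
    moreover have "(\<lambda>x. (g x, snd x)) ` C \<subseteq> {0..1} \<times> UNIV" using that(2) by auto
    ultimately have "continuous_on C (\<lambda>x. f (fst (g x, snd x)) (snd (g x, snd x)))"
      by (rule continuous_on_compose2[OF f'])
    then show ?thesis by simp
  qed
  have A: "continuous_on ?A (\<lambda>x. f (turn (fst x)) (snd x))"
  proof (rule comp)
    have "continuous_on (- \<real>\<^sub>\<ge>\<^sub>0) Arg2pi"
      by (rule continuous_at_imp_continuous_on) (auto intro: continuous_at_Arg2pi)
    then have "continuous_on ?A (\<lambda>x. Arg2pi (fst x))"
      by (rule continuous_on_compose2) (auto intro: continuous_intros)
    then show "continuous_on ?A (\<lambda>x. turn (fst x))" unfolding turn_def by (intro continuous_intros) auto
  qed (use turn_range in \<open>auto intro: less_imp_le\<close>)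
  \<comment> \<open>Across the positive real axis the angle jumps from 1 to 0, but one of the two arguments below
      is always clamped to an end of the interval, where its value cancels with the subtracted one.\<close>
  have B: "continuous_on ?B (\<lambda>x. f (turn (fst x)) (snd x))"
  proof -
    define a where "a w = Arg w / (2 * pi)" for w
    have "continuous_on (- \<real>\<^sub>\<le>\<^sub>0) Arg"
      by (rule continuous_at_imp_continuous_on) (auto intro: continuous_at_Arg)
    then have "continuous_on ?B (\<lambda>x. Arg (fst x))"
      by (rule continuous_on_compose2) (auto intro: continuous_intros)
    then have a: "continuous_on ?B (\<lambda>x. a (fst x))" unfolding a_def by (intro continuous_intros) auto
    have "continuous_on ?B (\<lambda>x. f (max 0 (min 1 (a (fst x)))) (snd x) + f (max 0 (min 1 (a (fst x) + 1))) (snd x) - f (0 * a (fst x)) (snd x))"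
      by (intro continuous_on_add continuous_on_diff comp continuous_intros a) auto
    moreover have "f (max 0 (min 1 (a w))) y + f (max 0 (min 1 (a w + 1))) y - f (0 * a w) y = f (turn w) y"
      if "w \<notin> \<real>\<^sub>\<le>\<^sub>0" for w y
    proof -
      have w: "w \<noteq> 0" using that by auto
      have r: "-pi < Arg w" "Arg w \<le> pi" using Arg_bounded[of w] mpi_less_Arg[of w] by auto
      then have r': "-1/2 < a w" "a w \<le> 1/2" by (auto simp: a_def field_simps)
      show ?thesis
      proof (cases "Arg w \<ge> 0")
        case True
        have "Arg2pi w = Arg w"
          by (rule Arg2pi_unique[of "cmod w"]) (use w r True Arg_eq[OF w] in auto)
        then have "turn w = a w" by (simp add: turn_def a_def)
        moreover have "a w \<ge> 0" using True by (simp add: a_def)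
        ultimately show ?thesis using r' ends by (simp add: max_def min_def)
      next
        case False
        have "of_real (cmod w) * exp (\<i> * of_real (Arg w + 2 * pi)) = w"
        proof -
          have "exp (\<i> * of_real (Arg w + 2 * pi)) = exp (\<i> * of_real (Arg w)) * exp (2 * of_real pi * \<i>)"
            by (simp add: ring_distribs exp_add mult_ac)
          then show ?thesis using Arg_eq[OF w] exp_two_pi_i by simp
        qed
        then have "Arg2pi w = Arg w + 2 * pi"
          by (intro Arg2pi_unique[of "cmod w"]) (use w r False in auto)
        then have "turn w = a w + 1" by (simp add: turn_def a_def add_divide_distrib)
        moreover have "a w < 0" using False by (simp add: a_def field_simps)
        ultimately show ?thesis using r' by (simp add: max_def min_def)
      qed
    qed
    ultimately show ?thesis by (rule continuous_on_eq) auto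
  qed
  have "continuous_on (?A \<union> ?B) (\<lambda>x. f (turn (fst x)) (snd x))"
    by (rule continuous_on_open_Un[OF _ _ A B])
       (auto intro!: open_Times simp: closed_nonneg_Reals_complex closed_nonpos_Reals_complex)
  moreover have "(- {0 :: complex}) \<times> (UNIV :: 'b set) \<subseteq> ?A \<union> ?B"
    by (auto simp: complex_nonneg_Reals_iff complex_nonpos_Reals_iff complex_eq_iff)
  ultimately show ?thesis by (auto simp: case_prod_beta intro: continuous_on_subset)
qed

section \<open>Closed braids with one moving strand\<close>

text \<open>
  The affine map sending \<open>1\<close> and \<open>-1\<close> to the two primitive cube roots of
  unity and \<open>base\<close> to \<open>1\<close>.
\<close>

definition strand :: "complex \<Rightarrow> complex" where
  "strand k = - 1/2 - \<i> * of_real (sqrt 3 / 2) * k"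

definition base :: complex where "base = \<i> * of_real (sqrt 3)"

text \<open>
  The second coordinate \<open>unit (3 * x)\<close> goes around the axis three times while the first
  one, for \<open>g\<close> resting at \<open>base\<close>, goes around once: over each angle the
  three strands are the three cube roots of a unit number. Only during the last of the three rounds
  the strand moves along \<open>g\<close>, in coordinates rotating with the braid.
\<close>

definition braid_knot :: "(real \<Rightarrow> complex) \<Rightarrow> curve" where
  "braid_knot g x = proj (emb (unit x * strand (g (max 0 (3 * frac x - 2)))) (unit (3 * x)))"

lemma unit_thirds: "unit (1/3) = - 1/2 + \<i> * of_real (sqrt 3 / 2)" "unit (2/3) = - 1/2 - \<i> * of_real (sqrt 3 / 2)"
proof -
  have c: "cos (4 * pi / 3) = - 1/2" "sin (4 * pi / 3) = - sqrt 3 / 2"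
    using cos_add[of pi "pi/3"] sin_add[of pi "pi/3"] by (simp_all add: cos_60 sin_60)
  have c': "cos (2 * pi / 3) = - 1/2" "sin (2 * pi / 3) = sqrt 3 / 2"
    using cos_120 sin_120 by (simp_all add: mult.commute)
  show "unit (1/3) = - 1/2 + \<i> * of_real (sqrt 3 / 2)" "unit (2/3) = - 1/2 - \<i> * of_real (sqrt 3 / 2)"
    using c c' by (simp_all add: unit_def complex_eq_iff mult.commute)
qed

lemma strand_diff: "strand a - strand b = - \<i> * of_real (sqrt 3 / 2) * (a - b)"
  by (simp add: strand_def field_simps)

lemma norm_strand_diff: "cmod (strand a - strand b) = sqrt 3 / 2 * cmod (a - b)"
  unfolding strand_diff by (simp add: norm_mult)

lemma strand_eq_iff: "strand a = strand b \<longleftrightarrow> a = b"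
  by (metis norm_strand_diff eq_iff_diff_eq_0 mult_eq_0_iff norm_eq_zero norm_zero real_sqrt_eq_0_iff divide_eq_0_iff zero_neq_numeral diff_self)

lemma strand_values: "strand 1 = unit (2/3)" "strand (-1) = unit (1/3)" "strand base = 1"
proof -
  have "\<i> * of_real (sqrt 3 / 2) * (\<i> * of_real (sqrt 3)) = - of_real (3/2 :: real)"
    by (simp add: complex_eq_iff)
  then show "strand 1 = unit (2/3)" "strand (-1) = unit (1/3)" "strand base = 1"
    by (simp_all add: strand_def unit_thirds base_def)
qed

lemma frac_thirds:
  obtains (last) "2/3 \<le> frac x" "frac (3 * x) = 3 * frac x - 2"
  | (first) m :: nat where "m < 2" "frac x < 2/3" "frac (3 * x) = 3 * frac x - real m"
proof -
  have x: "3 * x = 3 * frac x + of_int (3 * \<lfloor>x\<rfloor>)" by (simp add: frac_def)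
  have "frac (a + of_int k) = frac a" for a :: real and k by (simp add: frac_def)
  from this[of "3 * frac x" "3 * \<lfloor>x\<rfloor>"] have f: "frac (3 * x) = frac (3 * frac x)"
    unfolding x[symmetric] .
  have fr: "frac (3 * frac x) = 3 * frac x - real m" if "real m \<le> 3 * frac x" "3 * frac x < real m + 1" for m :: nat
  proof -
    have "\<lfloor>3 * frac x\<rfloor> = int m" using that by (simp add: floor_eq_iff)
    then show ?thesis by (simp add: frac_def)
  qed
  have r: "0 \<le> frac x" "frac x < 1" by (simp_all add: frac_lt_1)
  show thesis
  proof (cases "2/3 \<le> frac x")
    case True then show ?thesis using fr[of 2] r f last by simp
  next
    case False
    show ?thesis
    proof (cases "1/3 \<le> frac x")
      case True
      show ?thesis by (rule first[of 1]) (use fr[of 1] f True False in simp_all)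
    next
      case nt: False
      show ?thesis by (rule first[of 0]) (use fr[of 0] f nt False r in simp_all)
    qed
  qed
qed

lemma unit_frac: "unit (frac x) = unit x"
  by (simp add: unit_eq_iff frac_def)

lemma proj_fibre_shift:
  assumes "p \<noteq> 0" shows "proj (fibre_shift D t (proj p)) = proj (fibre_shift D t p)"
proof -
  have "fibre_shift D t (proj p) = inverse (norm p) *\<^sub>R fibre_shift D t p"
    unfolding proj_def using assms by (intro fibre_shift_scaleR) simp
  then show ?thesis using assms by (simp add: proj_scale)
qed

lemma emb_unit_nonzero: "emb z (unit x) \<noteq> 0"
  by (metis emb_0 emb_eq_iff unit_nonzero)

lemma braid_knot_in_S3: "braid_knot g x \<in> S3"
  unfolding braid_knot_def by (rule proj_in_S3) (rule emb_unit_nonzero)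

text \<open>
  A displacement of the moving strand by less than its distance to the two others extends to the
  fibre by a cone-shaped bump function around the strand: the other strands stay outside the bump,
  and its slope is less than 1.
\<close>

lemma braid_knot_small_step:
  assumes p: "path p" "pathstart p = base" "pathfinish p = base"
    and q: "path q" "pathstart q = base" "pathfinish q = base"
    and r: "r > 0" "\<And>t. t \<in> {0..1} \<Longrightarrow> r \<le> cmod (p t - 1) \<and> r \<le> cmod (p t + 1)"
    and c: "0 \<le> c" "c < 1" "\<And>t. t \<in> {0..1} \<Longrightarrow> cmod (q t - p t) \<le> c * r"
  shows "isotopic (braid_knot p) (braid_knot q)"
proof -
  define \<rho> where "\<rho> = sqrt 3 / 2 * r"
  have \<rho>: "\<rho> > 0" using r by (simp add: \<rho>_def)
  \<comment> \<open>In the fibre at angle \<open>t\<close>, in the last round, \<open>c0 t\<close> is the position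
      of the moving strand and \<open>d t\<close> is its displacement; \<open>\<rho>\<close> bounds
      its distance to the two other strands from below.\<close>
  define c0 where "c0 t = unit ((t + 2) / 3) * strand (p t)" for t
  define d where "d t = unit ((t + 2) / 3) * (strand (q t) - strand (p t))" for t
  define f where "f t z = of_real (max 0 (1 - cmod (z - c0 t) / \<rho>)) * d t" for t z
  define D where "D u z = f (turn u) z" for u z
  have d: "cmod (d t) \<le> c * \<rho>" if "t \<in> {0..1}" for t
  proof -
    have "cmod (d t) = sqrt 3 / 2 * cmod (q t - p t)" by (simp add: d_def norm_mult norm_strand_diff)
    also have "\<dots> \<le> sqrt 3 / 2 * (c * r)" using c(3)[OF that] by (intro mult_left_mono) auto
    finally show ?thesis by (simp add: \<rho>_def mult_ac)
  qed
  have ends: "p 0 = base" "p 1 = base" "q 0 = base" "q 1 = base"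
    using p q by (simp_all add: pathstart_def pathfinish_def)
  have turn01: "turn u \<in> {0..1}" for u using turn_range[of u] by simp
  have contf: "continuous_on ({0..1} \<times> UNIV) (\<lambda>(t, z). f t z)"
  proof -
    have "continuous_on ({0..1} \<times> (UNIV :: complex set)) (\<lambda>x. p (fst x))" "continuous_on ({0..1} \<times> (UNIV :: complex set)) (\<lambda>x. q (fst x))"
      using p(1) q(1) unfolding path_def
      by (auto intro!: continuous_on_compose2[of "{0..1}" _ _ fst] continuous_intros)
    then show ?thesis
      unfolding f_def c0_def d_def strand_def case_prod_beta using \<rho> by (intro continuous_intros) auto
  qed
  show ?thesis
  proof (rule fibre_shift_isotopic[of D "c * \<rho>" c])
    have "f 0 z = f 1 z" for z by (simp add: f_def d_def ends)
    from circle_function_continuous[OF contf this]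
    show "continuous_on (sphere 0 1 \<times> UNIV) (\<lambda>(u, z). D u z)"
      unfolding D_def by (rule continuous_on_subset) auto
    show "norm (D u z) \<le> c * \<rho>" for u z
    proof -
      have "norm (D u z) = max 0 (1 - cmod (z - c0 (turn u)) / \<rho>) * cmod (d (turn u))"
        by (simp add: D_def f_def norm_mult)
      also have "\<dots> \<le> 1 * (c * \<rho>)" using d[OF turn01] \<rho> c by (intro mult_mono) auto
      finally show ?thesis by simp
    qed
    show "norm (D u z - D u z') \<le> c * norm (z - z')" for u z z'
    proof -
      let ?b = "\<lambda>z. max 0 (1 - cmod (z - c0 (turn u)) / \<rho>)"
      have "\<bar>?b z - ?b z'\<bar> \<le> \<bar>(1 - cmod (z - c0 (turn u)) / \<rho>) - (1 - cmod (z' - c0 (turn u)) / \<rho>)\<bar>"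
        by (auto simp: max_def)
      also have "\<dots> = \<bar>cmod (z - c0 (turn u)) - cmod (z' - c0 (turn u))\<bar> / \<rho>"
        using \<rho> by (simp add: abs_minus_commute flip: diff_divide_distrib)
      also have "\<dots> \<le> cmod (z - z') / \<rho>"
        using \<rho> norm_triangle_ineq3[of "z - c0 (turn u)" "z' - c0 (turn u)"] by (intro divide_right_mono) auto
      finally have b: "\<bar>?b z - ?b z'\<bar> \<le> cmod (z - z') / \<rho>" .
      have "D u z - D u z' = of_real (?b z - ?b z') * d (turn u)"
        by (simp add: D_def f_def algebra_simps)
      then have "norm (D u z - D u z') = \<bar>?b z - ?b z'\<bar> * cmod (d (turn u))"
        by (simp only: norm_mult norm_of_real)
      also have "\<dots> \<le> cmod (z - z') / \<rho> * (c * \<rho>)"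
        using d[OF turn01] b \<rho> c by (intro mult_mono) auto
      also have "\<dots> = c * norm (z - z')" using \<rho> by simp
      finally show ?thesis .
    qed
    show "proj (fibre_shift D 1 (braid_knot p x)) = braid_knot q x" for x
    proof -
      let ?t = "max 0 (3 * frac x - 2)"
      have D: "D (unit (3 * x)) (unit x * strand (p ?t)) = unit x * (strand (q ?t) - strand (p ?t))"
      proof (cases x rule: frac_thirds)
        case last
        then have t: "turn (unit (3 * x)) = ?t" by (simp add: turn_unit)
        have "unit ((?t + 2) / 3) = unit x" using last unit_frac[of x] by simp
        then show ?thesis by (simp add: D_def f_def t c0_def d_def)
      next
        case (first m)
        let ?\<theta> = "frac (3 * x)"
        have t: "?t = 0" using first(2) by simp
        have "unit x = unit ((?\<theta> + 2) / 3) * unit (real m / 3 - 2 / 3)"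
          using first(3) by (simp add: unit_frac flip: unit_add add_divide_distrib diff_divide_distrib)
        moreover have "unit (real m / 3 - 2 / 3) = strand (if m = 0 then -1 else 1)"
          using first(1) by (auto simp: strand_values unit_eq_iff less_Suc_eq numeral_2_eq_2)
        ultimately have "unit x - c0 ?\<theta> = unit ((?\<theta> + 2) / 3) * (strand (if m = 0 then -1 else 1) - strand (p ?\<theta>))"
          by (simp add: c0_def right_diff_distrib)
        then have "cmod (unit x - c0 ?\<theta>) = sqrt 3 / 2 * cmod ((if m = 0 then -1 else 1) - p ?\<theta>)"
          by (simp only: norm_mult norm_unit norm_strand_diff mult_1)
        also have "\<dots> \<ge> \<rho>"
          unfolding \<rho>_def using r(2)[of ?\<theta>] frac_lt_1[of "3 * x"]
          by (intro mult_left_mono) (auto simp: norm_minus_commute[of "- 1"] norm_minus_commute[of 1])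
        finally have "f ?\<theta> (unit x) = 0" using \<rho> by (simp add: f_def)
        then show ?thesis by (simp add: D_def turn_unit t ends strand_values)
      qed
      have "proj (fibre_shift D 1 (braid_knot p x)) = proj (fibre_shift D 1 (emb (unit x * strand (p ?t)) (unit (3 * x))))"
        unfolding braid_knot_def by (rule proj_fibre_shift) (rule emb_unit_nonzero)
      also have "\<dots> = braid_knot q x"
      proof -
        have "fibre_shift D 1 (emb z (unit y)) = emb (z + D (unit y) z) (unit y)" for y z
          by (simp add: fibre_shift_def)
        then show ?thesis
          unfolding braid_knot_def D by (simp only: D flip: ring_distribs) simp
      qed
      finally show ?thesis .
    qed
  qed (use c in auto)
qed

text \<open>
  The homotopy is divided into steps that are small compared with its distance to \<open>1\<close>
  and \<open>-1\<close>.
\<close>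

lemma braid_knot_homotopic:
  assumes "homotopic_paths (- {1, -1}) p q" "pathstart p = base" "pathfinish p = base"
  shows "isotopic (braid_knot p) (braid_knot q)"
proof -
  obtain h where h: "continuous_on ({0..1} \<times> {0..1}) h" "h \<in> ({0..1} \<times> {0..1}) \<rightarrow> (- {1, -1 :: complex})"
    "\<forall>x\<in>{0..1}. h (0, x) = p x" "\<forall>x\<in>{0..1}. h (1, x) = q x"
    "\<forall>t\<in>{0..1::real}. pathstart (h \<circ> Pair t) = pathstart p \<and> pathfinish (h \<circ> Pair t) = pathfinish p"
    using assms(1) unfolding homotopic_paths by blast
  let ?Q = "{0..1::real} \<times> {0..1::real}"
  have comp: "compact ?Q" by (intro compact_Times) auto
  have dist: "\<exists>r>0. \<forall>x\<in>?Q. r \<le> cmod (h x - a)" if "a \<in> {1, -1}" for a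
  proof -
    have "continuous_on ?Q (\<lambda>x. cmod (h x - a))" using h(1) by (intro continuous_intros)
    then obtain x0 where x0: "x0 \<in> ?Q" "\<And>x. x \<in> ?Q \<Longrightarrow> cmod (h x0 - a) \<le> cmod (h x - a)"
      using continuous_attains_inf[OF comp, of "\<lambda>x. cmod (h x - a)"] by auto
    have "h x0 \<noteq> a" using h(2) x0(1) that by blast
    then show ?thesis using x0(2) by (intro exI[of _ "cmod (h x0 - a)"]) auto
  qed
  have "\<exists>r>0. \<forall>x\<in>?Q. r \<le> cmod (h x - 1)" "\<exists>r>0. \<forall>x\<in>?Q. r \<le> cmod (h x - (-1))"
    by (rule dist, simp)+
  then obtain r1 r2 where r12: "r1 > 0" "r2 > 0" "\<forall>x\<in>?Q. r1 \<le> cmod (h x - 1)"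
    "\<forall>x\<in>?Q. r2 \<le> cmod (h x - (-1))" by (elim exE conjE)
  define r where "r = min r1 r2"
  have r: "r > 0" "\<And>x. x \<in> ?Q \<Longrightarrow> r \<le> cmod (h x - 1) \<and> r \<le> cmod (h x + 1)"
  proof -
    show "r > 0" using r12(1,2) by (simp add: r_def)
    fix x assume "x \<in> ?Q"
    from bspec[OF r12(3) this] bspec[OF r12(4) this]
    show "r \<le> cmod (h x - 1) \<and> r \<le> cmod (h x + 1)" unfolding r_def by (simp add: min_le_iff_disj)
  qed
  have "uniformly_continuous_on ?Q h" by (rule compact_uniformly_continuous[OF h(1) comp])
  then obtain \<delta> where \<delta>: "\<delta> > 0" "\<And>x y. x \<in> ?Q \<Longrightarrow> y \<in> ?Q \<Longrightarrow> dist y x < \<delta> \<Longrightarrow> dist (h y) (h x) < r / 2"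
    using r(1) unfolding uniformly_continuous_on_def by (metis half_gt_zero)
  obtain N :: nat where N: "1 / \<delta> < real N" using reals_Archimedean2 by blast
  then have N0: "N > 0" using \<delta>(1) by (auto intro!: Nat.gr0I dest: order.strict_trans[of 0 "1/\<delta>"])
  have N1: "1 / real N < \<delta>" using N \<delta>(1) N0 by (simp add: field_simps)
  \<comment> \<open>The stages of the homotopy at the multiples of \<open>1 / N\<close>, which differ by less than
      half the distance to the two other strands.\<close>
  define P where "P i = (\<lambda>t. h (real i / real N, t))" for i :: nat
  have sq: "(real i / real N, t) \<in> ?Q" if "i \<le> N" "t \<in> {0..1}" for i t
    using that N0 by simp
  have P: "path (P i)" "pathstart (P i) = base" "pathfinish (P i) = base" if "i \<le> N" for i
  proof -
    show "path (P i)"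
      unfolding path_def P_def using sq[OF that]
      by (intro continuous_on_compose2[OF h(1)] continuous_intros) auto
    have "real i / real N \<in> {0..1}" using that N0 by simp
    then show "pathstart (P i) = base" "pathfinish (P i) = base"
      using h(5) assms(2,3) by (auto simp: P_def pathstart_def pathfinish_def)
  qed
  have step: "isotopic (braid_knot (P i)) (braid_knot (P (Suc i)))" if i: "Suc i \<le> N" for i
  proof (rule braid_knot_small_step[of _ _ r "1/2"])
    show "cmod (P (Suc i) t - P i t) \<le> 1 / 2 * r" if t: "t \<in> {0..1}" for t
    proof -
      have "dist (real (Suc i) / real N, t) (real i / real N, t) = 1 / real N"
        by (simp add: dist_Pair_Pair dist_real_def add_divide_distrib)
      then have "dist (h (real (Suc i) / real N, t)) (h (real i / real N, t)) < r / 2"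
        using sq[of i t] sq[of "Suc i" t] i t N1 by (intro \<delta>(2)) auto
      then show ?thesis by (simp add: P_def dist_norm)
    qed
    show "r \<le> cmod (P i t - 1) \<and> r \<le> cmod (P i t + 1)" if "t \<in> {0..1}" for t
      unfolding P_def using i that by (intro r(2) sq) auto
  qed (use i P r(1) in auto)
  have "isotopic (braid_knot (P 0)) (braid_knot (P i))" if "i \<le> N" for i
    using that
  proof (induction i)
    case 0
    show ?case using braid_knot_in_S3 by (intro isotopic_refl) blast
  next
    case (Suc i)
    then show ?case using step[of i] isotopic_trans by auto
  qed
  from this[of N] have "isotopic (braid_knot (P 0)) (braid_knot (P N))" by simp
  moreover have "braid_knot f = braid_knot g" if "\<And>t. t \<in> {0..1} \<Longrightarrow> f t = g t" for f g
  proof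
    fix x :: real
    have "max 0 (3 * frac x - 2) \<in> {0..1}" using frac_lt_1[of x] by simp
    from that[OF this] show "braid_knot f x = braid_knot g x" by (simp add: braid_knot_def)
  qed
  from this[of "P 0" p] this[of "P N" q] have "braid_knot (P 0) = braid_knot p" "braid_knot (P N) = braid_knot q"
    using h(3,4) N0 by (simp_all add: P_def)
  ultimately show ?thesis by simp
qed

lemma unit_power: "unit x ^ n = unit (real n * x)"
  by (simp add: unit_def Complex.DeMoivre mult_ac)

text \<open>
  For constant \<open>g\<close> the second coordinate is, up to a positive factor, the cube of the
  first one, so the curve lies on the graph of a homogeneous function. Shearing the graph flat gives
  the circle in the first coordinate plane.
\<close>

lemma braid_knot_const: "isotopic (braid_knot (\<lambda>t. base)) unknot"
proof (rule isotopic_homogeneous[of "\<lambda>s p. emb (fstc p) (sndc p - of_real s * (fstc p ^ 3 / of_real ((cmod (fstc p))\<^sup>2)))"])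
  \<comment> \<open>Division by the square of the absolute value makes the cube homogeneous of degree 1.\<close>
  let ?g = "\<lambda>z. z ^ 3 / of_real ((cmod z)\<^sup>2) :: complex"
  have cont: "isCont ?g z" for z
  proof (cases "z = 0")
    case False
    then show ?thesis by (intro continuous_intros) auto
  next
    case True
    have "norm (?g y) = norm y" for y by (simp add: norm_divide norm_mult power3_eq_cube power2_eq_square)
    moreover have "(norm \<longlongrightarrow> 0) (at (0::complex))" by (rule tendsto_norm_zero) (rule tendsto_ident_at)
    ultimately have "(?g \<longlongrightarrow> 0) (at 0)" by (intro Lim_null_comparison[of ?g norm]) auto
    then show ?thesis using True by (simp add: isCont_def)
  qed
  have "continuous_on UNIV ?g" using cont by (simp add: continuous_at_imp_continuous_on)
  then have G: "continuous_on ({0..1} \<times> (UNIV :: (real^4) set)) (\<lambda>x. ?g (fstc (snd x)))"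
    by (rule continuous_on_compose2) (auto intro!: continuous_intros)
  show "continuous_on ({0..1} \<times> UNIV) (\<lambda>(s, p). emb (fstc p) (sndc p - of_real s * ?g (fstc p)))"
    unfolding case_prod_beta
    by (intro continuous_on_emb continuous_on_diff continuous_on_mult continuous_on_of_real continuous_on_fstc
        continuous_on_sndc continuous_on_fst continuous_on_snd continuous_on_id G)
  show "bij (\<lambda>p. emb (fstc p) (sndc p - of_real s * ?g (fstc p)))" for s
    by (rule bij_betw_byWitness[where f' = "\<lambda>p. emb (fstc p) (sndc p + of_real s * ?g (fstc p))"]) auto
  show "emb (fstc (c *\<^sub>R p)) (sndc (c *\<^sub>R p) - of_real s * ?g (fstc (c *\<^sub>R p))) = c *\<^sub>R emb (fstc p) (sndc p - of_real s * ?g (fstc p))"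
    if "c > 0" for s c p
  proof -
    have "?g (c *\<^sub>R z) = c *\<^sub>R ?g z" for z
      using that by (cases "z = 0") (simp_all add: scaleR_conv_of_real norm_mult field_simps power2_eq_square power3_eq_cube)
    then show ?thesis unfolding fstc_scaleR sndc_scaleR by (simp add: emb_scaleR scaleR_diff_right)
  qed
  show "emb (fstc p) (sndc p - of_real 0 * ?g (fstc p)) = p" for p by simp
  show "proj (emb (fstc (braid_knot (\<lambda>t. base) x)) (sndc (braid_knot (\<lambda>t. base) x) - of_real 1 * ?g (fstc (braid_knot (\<lambda>t. base) x)))) = unknot x" for x
  proof -
    define c where "c = inverse (norm (emb (unit x) (unit (3 * x))))"
    have c: "c > 0" using emb_unit_nonzero by (simp add: c_def)
    have k: "braid_knot (\<lambda>t. base) x = c *\<^sub>R emb (unit x) (unit (3 * x))"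
      by (simp add: braid_knot_def strand_values proj_def c_def)
    have "?g (c *\<^sub>R unit x) = c *\<^sub>R unit (3 * x)"
      using c unit_power[of x 3] by (simp add: scaleR_conv_of_real norm_mult power_mult_distrib field_simps power2_eq_square power3_eq_cube)
    then have "proj (emb (fstc (braid_knot (\<lambda>t. base) x)) (sndc (braid_knot (\<lambda>t. base) x) - of_real 1 * ?g (fstc (braid_knot (\<lambda>t. base) x))))
        = proj (c *\<^sub>R emb (unit x) 0)"
      unfolding k by (simp add: emb_scaleR)
    also have "\<dots> = emb (unit x) 0" using c by (simp add: proj_scale) (simp add: proj_def norm_emb)
    also have "\<dots> = unknot x"
      by (simp add: unknot_def vec_eq_iff forall_4 unit_def vector_def)
    finally show ?thesis .
  qed
qed

section \<open>Derivatives of the closed braids\<close>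

lemma det_4:
  "det (A::'a::comm_ring_1^4^4) =
    A$1$1 * (A$2$2 * (A$3$3 * A$4$4 - A$3$4 * A$4$3) - A$2$3 * (A$3$2 * A$4$4 - A$3$4 * A$4$2) + A$2$4 * (A$3$2 * A$4$3 - A$3$3 * A$4$2))
  - A$1$2 * (A$2$1 * (A$3$3 * A$4$4 - A$3$4 * A$4$3) - A$2$3 * (A$3$1 * A$4$4 - A$3$4 * A$4$1) + A$2$4 * (A$3$1 * A$4$3 - A$3$3 * A$4$1))
  + A$1$3 * (A$2$1 * (A$3$2 * A$4$4 - A$3$4 * A$4$2) - A$2$2 * (A$3$1 * A$4$4 - A$3$4 * A$4$1) + A$2$4 * (A$3$1 * A$4$2 - A$3$2 * A$4$1))
  - A$1$4 * (A$2$1 * (A$3$2 * A$4$3 - A$3$3 * A$4$2) - A$2$2 * (A$3$1 * A$4$3 - A$3$3 * A$4$1) + A$2$3 * (A$3$1 * A$4$2 - A$3$2 * A$4$1))"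
proof -
  have f1234: "finite {2::4, 3, 4}" "1 \<notin> {2::4, 3, 4}"
    by auto
  have f234: "finite {3::4, 4}" "2 \<notin> {3::4, 4}"
    by auto
  have f34: "finite {4::4}" "3 \<notin> {4::4}"
    by auto
  show ?thesis
    unfolding det_def UNIV_4
    unfolding sum_over_permutations_insert[OF f1234]
    unfolding sum_over_permutations_insert[OF f234]
    unfolding sum_over_permutations_insert[OF f34]
    unfolding permutes_sing
    by (simp add: sign_swap_id permutation_swap_id permutation_compose sign_compose sign_id swap_id_eq algebra_simps)
qed

lemma vector_4:
  "(vector [x, y, z, w] :: ('a::zero)^4) $ 1 = x" "(vector [x, y, z, w] :: ('a::zero)^4) $ 2 = y"
  "(vector [x, y, z, w] :: ('a::zero)^4) $ 3 = z" "(vector [x, y, z, w] :: ('a::zero)^4) $ 4 = w"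
  by (simp_all add: vector_def)

definition proj_deriv :: "real^4 \<Rightarrow> real^4 \<Rightarrow> real^4" where
  "proj_deriv p q = q /\<^sub>R norm p - ((p \<bullet> q) / norm p ^ 3) *\<^sub>R p"

lemma proj_has_vector_derivative:
  assumes "(f has_vector_derivative f') (at x within S)" "f x \<noteq> 0"
  shows "((\<lambda>x. proj (f x)) has_vector_derivative proj_deriv (f x) f') (at x within S)"
proof -
  have "((\<lambda>x. norm (f x)) has_derivative (\<lambda>h. (h *\<^sub>R f') \<bullet> sgn (f x))) (at x within S)"
    using has_derivative_compose[OF assms(1)[unfolded has_vector_derivative_def] has_derivative_norm[OF assms(2)]] .
  then have n: "((\<lambda>x. norm (f x)) has_real_derivative f' \<bullet> sgn (f x)) (at x within S)"
    unfolding has_field_derivative_def by (rule has_derivative_eq_rhs) (auto simp: mult.commute)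
  have "((\<lambda>x. inverse (norm (f x)) *\<^sub>R f x) has_vector_derivative
      inverse (norm (f x)) *\<^sub>R f' + (- (inverse (norm (f x)) * (f' \<bullet> sgn (f x)) * inverse (norm (f x)))) *\<^sub>R f x) (at x within S)"
    by (rule has_vector_derivative_scaleR[OF DERIV_inverse'[OF n] assms(1)]) (use assms(2) in auto)
  moreover have "inverse (norm (f x)) *\<^sub>R f' + (- (inverse (norm (f x)) * (f' \<bullet> sgn (f x)) * inverse (norm (f x)))) *\<^sub>R f x
      = proj_deriv (f x) f'"
    by (simp add: proj_deriv_def sgn_div_norm inner_commute divide_inverse power3_eq_cube mult_ac)
  ultimately show ?thesis unfolding proj_def by simp
qed

lemma continuous_on_proj_deriv:
  assumes "continuous_on A f" "continuous_on A g" "\<And>x. x \<in> A \<Longrightarrow> f x \<noteq> 0"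
  shows "continuous_on A (\<lambda>x. proj_deriv (f x) (g x))"
  unfolding proj_deriv_def using assms by (intro continuous_intros) auto

lemma emb_has_vector_derivative:
  assumes "(f has_vector_derivative f') (at x within S)" "(g has_vector_derivative g') (at x within S)"
  shows "((\<lambda>x. emb (f x) (g x)) has_vector_derivative emb f' g') (at x within S)"
  using bounded_linear.has_vector_derivative[OF bounded_linear_emb has_vector_derivative_Pair[OF assms]] by simp

lemma unit_has_vector_derivative:
  assumes "(f has_real_derivative f') (at x within S)"
  shows "((\<lambda>x. unit (f x)) has_vector_derivative of_real (2 * pi * f') * \<i> * unit (f x)) (at x within S)"
proof -
  have "((\<lambda>x. 2 * pi * f x) has_derivative (\<lambda>h. 2 * pi * (f' * h))) (at x within S)"
    using assms unfolding has_field_derivative_def by (rule has_derivative_mult_right)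
  from has_derivative_cis[OF this] show ?thesis
    unfolding unit_def has_vector_derivative_def
    by (rule has_derivative_eq_rhs) (auto simp: scaleR_conv_of_real mult_ac)
qed

text \<open>
  The path of the moving strand as a function of the knot parameter, extended periodically. For
  \<open>g\<close> constant outside the unit interval it is as smooth as \<open>g\<close>.
\<close>

definition per :: "(real \<Rightarrow> complex) \<Rightarrow> real \<Rightarrow> complex" where
  "per f x = f (3 * frac x - 2)"

lemma per_local:
  assumes f: "\<And>t. t \<le> 0 \<Longrightarrow> f t = c" "\<And>t. t \<ge> 1 \<Longrightarrow> f t = c"
    and x: "x \<in> {real_of_int k - 1<..<real_of_int k + 2/3}"
  shows "per f x = f (3 * (x - real_of_int k) + 1)"
proof (cases "x < real_of_int k")
  case True
  then have "\<lfloor>x\<rfloor> = k - 1" using x by (simp add: floor_eq_iff)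
  then have "3 * frac x - 2 = 3 * (x - real_of_int k) + 1" by (simp add: frac_def algebra_simps)
  then show ?thesis by (simp only: per_def)
next
  case False
  then have "\<lfloor>x\<rfloor> = k" using x by (simp add: floor_eq_iff)
  then have "3 * frac x - 2 \<le> 0" using x by (simp add: frac_def)
  moreover have "3 * (x - real_of_int k) + 1 \<ge> 1" using False by simp
  ultimately show ?thesis by (simp add: per_def f)
qed

lemma per_nbhd: "x \<in> {real_of_int \<lceil>x\<rceil> - 1<..<real_of_int \<lceil>x\<rceil> + 2/3}"
proof -
  have "real_of_int \<lceil>x\<rceil> - 1 < x" "x < real_of_int \<lceil>x\<rceil> + 2/3" by linarith+
  then show ?thesis by (simp only: greaterThanLessThan_iff)
qed

lemma per_continuous:
  assumes "continuous_on UNIV f" "\<And>t. t \<le> 0 \<Longrightarrow> f t = c" "\<And>t. t \<ge> 1 \<Longrightarrow> f t = c"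
  shows "continuous_on UNIV (per f)"
proof -
  have "isCont (per f) x" for x
  proof -
    \<comment> \<open>Around the integer \<open>?k\<close> the periodic extension is given by a single formula;
        the left-hand part of the neighbourhood carries the path and the right-hand part its
        constant continuation.\<close>
    let ?k = "\<lceil>x\<rceil>" let ?U = "{real_of_int ?k - 1<..<real_of_int ?k + 2/3}"
    have "continuous_on ?U (\<lambda>x. f (3 * (x - real_of_int ?k) + 1))"
      by (rule continuous_on_compose2[OF assms(1)]) (auto intro!: continuous_intros)
    then have "continuous_on ?U (per f)"
      by (rule continuous_on_eq) (use per_local[OF assms(2,3)] in auto)
    then have "\<forall>y\<in>?U. isCont (per f) y"
      using continuous_on_eq_continuous_at[of ?U "per f"] by simp
    then show ?thesis using per_nbhd[of x] by blast
  qed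
  then show ?thesis by (simp add: continuous_at_imp_continuous_on)
qed

text \<open>
  Loops are extended to the whole line by their base value; then continuity of the derivative
  includes that the velocity vanishes at both ends.
\<close>

definition C1_loop :: "complex \<Rightarrow> (real \<Rightarrow> complex) \<Rightarrow> (real \<Rightarrow> complex) \<Rightarrow> bool" where
  "C1_loop c g g' \<longleftrightarrow> (\<forall>t. (g has_vector_derivative g' t) (at t)) \<and> continuous_on UNIV g' \<and>
     (\<forall>t. t \<le> 0 \<or> t \<ge> 1 \<longrightarrow> g t = c)"

lemma C1_loop_continuous: "C1_loop c g g' \<Longrightarrow> continuous_on A g"
  unfolding C1_loop_def
  by (meson continuous_at_imp_continuous_on has_vector_derivative_continuous)

lemma C1_loop_deriv_zero:
  assumes "C1_loop c g g'" "t \<le> 0 \<or> t \<ge> 1" shows "g' t = 0"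
proof -
  have z: "g' t = 0" if "t < 0 \<or> t > 1" for t
  proof -
    have op: "open ({..<0} \<union> {1<..} :: real set)" by auto
    have "(g has_vector_derivative 0) (at t)"
      by (rule has_vector_derivative_transform_within_open[OF has_vector_derivative_const op, of t c])
         (use that assms(1) in \<open>auto simp: C1_loop_def\<close>)
    then show ?thesis
      using assms(1) vector_derivative_unique_at unfolding C1_loop_def by blast
  qed
  have c: "continuous_on UNIV g'" using assms(1) by (simp add: C1_loop_def)
  have "g' 0 = 0"
    by (rule continuous_constant_on_closure[of "{..<0}" g']) (use c z in \<open>auto intro: continuous_on_subset\<close>)
  moreover have "g' 1 = 0"
    by (rule continuous_constant_on_closure[of "{1<..}" g']) (use c z in \<open>auto intro: continuous_on_subset\<close>)
  ultimately show ?thesis using z[of t] assms(2) by (cases "t = 0 \<or> t = 1") auto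
qed

lemma per_deriv:
  assumes g: "C1_loop c g g'"
  shows "(per g has_vector_derivative 3 * per g' x) (at x)" "continuous_on UNIV (per g')" "continuous_on UNIV (per g)"
proof -
  have g0: "\<And>t. t \<le> 0 \<Longrightarrow> g t = c" "\<And>t. t \<ge> 1 \<Longrightarrow> g t = c" using g by (auto simp: C1_loop_def)
  have g'0: "\<And>t. t \<le> 0 \<Longrightarrow> g' t = 0" "\<And>t. t \<ge> 1 \<Longrightarrow> g' t = 0" using C1_loop_deriv_zero[OF g] by auto
  show "continuous_on UNIV (per g')"
    using g g'0 by (intro per_continuous[of _ 0]) (auto simp: C1_loop_def)
  show "continuous_on UNIV (per g)"
    using C1_loop_continuous[OF g] g0 by (intro per_continuous[of _ c]) auto
  let ?k = "real_of_int \<lceil>x\<rceil>"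
  have "((\<lambda>x. 3 * (x - ?k) + 1) has_vector_derivative 3) (at x)"
    by (auto intro!: derivative_eq_intros)
  moreover have "(g has_vector_derivative g' (3 * (x - ?k) + 1)) (at (3 * (x - ?k) + 1))"
    using g by (simp add: C1_loop_def)
  ultimately have "((\<lambda>x. g (3 * (x - ?k) + 1)) has_vector_derivative 3 *\<^sub>R g' (3 * (x - ?k) + 1)) (at x)"
    using vector_diff_chain_at[of "\<lambda>x. 3 * (x - ?k) + 1" 3 x g] by (simp add: o_def)
  then have "(per g has_vector_derivative 3 *\<^sub>R g' (3 * (x - ?k) + 1)) (at x)"
    by (rule has_vector_derivative_transform_within_open[where S = "{?k - 1<..<?k + 2/3}"])
       (use per_nbhd per_local[OF g0] in auto)
  moreover have "g' (3 * (x - ?k) + 1) = per g' x"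
    using per_local[OF g'0 per_nbhd] by simp
  ultimately show "(per g has_vector_derivative 3 * per g' x) (at x)"
    by (simp add: scaleR_conv_of_real)
qed

lemma C1_loop_affine:
  assumes "C1_loop c g g'" "C1_loop 0 \<gamma> \<gamma>'"
  shows "C1_loop c (\<lambda>t. g t + of_real s * \<gamma> t) (\<lambda>t. g' t + of_real s * \<gamma>' t)"
  using assms unfolding C1_loop_def
  by (auto intro!: derivative_eq_intros has_vector_derivative_add has_vector_derivative_mult_right continuous_intros)

text \<open>
  The curve in \<open>real^4\<close> before the radial projection to the sphere.
\<close>

definition lift_curve :: "(real \<Rightarrow> complex) \<Rightarrow> curve" where
  "lift_curve g x = emb (unit x * strand (per g x)) (unit (3 * x))"

definition lift_deriv :: "(real \<Rightarrow> complex) \<Rightarrow> (real \<Rightarrow> complex) \<Rightarrow> curve" where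
  "lift_deriv g g' x = emb (of_real (2 * pi) * \<i> * unit x * strand (per g x) + unit x * (- \<i> * of_real (sqrt 3 / 2) * (3 * per g' x)))
     (of_real (6 * pi) * \<i> * unit (3 * x))"

lemma lift_curve_nonzero [simp]: "lift_curve g x \<noteq> 0"
  unfolding lift_curve_def by (rule emb_unit_nonzero)

lemma braid_knot_lift_curve:
  assumes "C1_loop c g g'" shows "braid_knot g x = proj (lift_curve g x)"
proof -
  have "g (max 0 (3 * frac x - 2)) = per g x"
    using assms by (auto simp: per_def C1_loop_def max_def)
  then show ?thesis by (simp add: braid_knot_def lift_curve_def)
qed

lemma lift_curve_deriv:
  assumes g: "C1_loop c g g'"
  shows "(lift_curve g has_vector_derivative lift_deriv g g' x) (at x)"
proof -
  have s: "((\<lambda>x. strand (per g x)) has_vector_derivative - \<i> * of_real (sqrt 3 / 2) * (3 * per g' x)) (at x)"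
  proof -
    have "((\<lambda>x. - 1/2 + (- \<i> * of_real (sqrt 3 / 2)) * per g x) has_vector_derivative
        0 + (- \<i> * of_real (sqrt 3 / 2)) * (3 * per g' x)) (at x)"
      by (intro has_vector_derivative_add has_vector_derivative_const has_vector_derivative_mult_right per_deriv(1)[OF g])
    moreover have "strand k = - 1/2 + (- \<i> * of_real (sqrt 3 / 2)) * k" for k by (simp add: strand_def)
    ultimately show ?thesis by simp
  qed
  have u: "(unit has_vector_derivative of_real (2 * pi) * \<i> * unit x) (at x)"
    using unit_has_vector_derivative[of "\<lambda>x. x" 1 x UNIV] by simp
  have u3: "((\<lambda>x. unit (3 * x)) has_vector_derivative of_real (6 * pi) * \<i> * unit (3 * x)) (at x)"
    using unit_has_vector_derivative[of "\<lambda>x. 3 * x" 3 x UNIV] by (auto intro: derivative_eq_intros)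
  have "((\<lambda>x. emb (unit x * strand (per g x)) (unit (3 * x))) has_vector_derivative
     emb (unit x * (- \<i> * of_real (sqrt 3 / 2) * (3 * per g' x)) + of_real (2 * pi) * \<i> * unit x * strand (per g x))
     (of_real (6 * pi) * \<i> * unit (3 * x))) (at x)"
    by (rule emb_has_vector_derivative[OF has_vector_derivative_mult[OF u s] u3])
  then show ?thesis unfolding lift_curve_def[abs_def] lift_deriv_def by (simp add: add.commute)
qed

lemma braid_knot_deriv:
  assumes g: "C1_loop c g g'"
  shows "(braid_knot g has_vector_derivative proj_deriv (lift_curve g x) (lift_deriv g g' x)) (at x)"
    "continuous_on UNIV (\<lambda>x. proj_deriv (lift_curve g x) (lift_deriv g g' x))"
proof -
  have "braid_knot g = (\<lambda>x. proj (lift_curve g x))" using braid_knot_lift_curve[OF g] by auto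
  then show "(braid_knot g has_vector_derivative proj_deriv (lift_curve g x) (lift_deriv g g' x)) (at x)"
    using proj_has_vector_derivative[OF lift_curve_deriv[OF g]] by simp
  note c = per_deriv(2,3)[OF g]
  have c': "continuous_on UNIV (\<lambda>x. per g x)" "continuous_on UNIV (\<lambda>x. per g' x)" using c by auto
  show "continuous_on UNIV (\<lambda>x. proj_deriv (lift_curve g x) (lift_deriv g g' x))"
    by (rule continuous_on_proj_deriv)
       (unfold lift_curve_def lift_deriv_def strand_def, (intro continuous_intros c')+, rule emb_unit_nonzero)
qed

lemma proj_deriv_relation:
  assumes "p \<noteq> 0" "a *\<^sub>R proj_deriv p q + b *\<^sub>R proj_deriv p r = 0"
  obtains c where "a *\<^sub>R q + b *\<^sub>R r = c *\<^sub>R p"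
proof
  let ?c = "norm p * (a * ((p \<bullet> q) / norm p ^ 3) + b * ((p \<bullet> r) / norm p ^ 3))"
  have "norm p *\<^sub>R (a *\<^sub>R proj_deriv p q + b *\<^sub>R proj_deriv p r) = a *\<^sub>R q + b *\<^sub>R r - ?c *\<^sub>R p"
    using assms(1) by (simp add: proj_deriv_def algebra_simps)
  then show "a *\<^sub>R q + b *\<^sub>R r = ?c *\<^sub>R p" using assms(2) by simp
qed

lemma braid_knot_deriv_nonzero: "proj_deriv (lift_curve g x) (lift_deriv g g' x) \<noteq> 0"
proof
  assume "proj_deriv (lift_curve g x) (lift_deriv g g' x) = 0"
  then obtain c where "1 *\<^sub>R lift_deriv g g' x + 0 *\<^sub>R lift_deriv g g' x = c *\<^sub>R lift_curve g x"
    using proj_deriv_relation[of "lift_curve g x" 1 "lift_deriv g g' x" 0 "lift_deriv g g' x"] by auto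
  then have "lift_deriv g g' x = c *\<^sub>R lift_curve g x" by simp
  from arg_cong[OF this, of sndc]
  have "of_real (6 * pi) * \<i> * unit (3 * x) = of_real c * unit (3 * x)"
    unfolding sndc_scaleR by (simp add: lift_deriv_def lift_curve_def scaleR_conv_of_real)
  then have "of_real (6 * pi) * \<i> = (of_real c :: complex)" by simp
  then show False by (auto simp: complex_eq_iff)
qed

lemma braid_knot_frac: "braid_knot g (frac x) = braid_knot g x"
proof -
  have "unit (3 * frac x) = unit (3 * x)"
    unfolding unit_eq_iff by (simp add: frac_def algebra_simps)
  moreover have "frac (frac x) = frac x" by (simp add: frac_def)
  ultimately show ?thesis by (simp add: braid_knot_def unit_frac)
qed

lemma braid_knot_immersed:
  assumes "C1_loop c g g'" shows "immersed_circle (braid_knot g)"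
  unfolding immersed_circle_def
proof (intro conjI allI)
  show "range (braid_knot g) \<subseteq> S3" using braid_knot_in_S3 by blast
  show "braid_knot g (x + 1) = braid_knot g x" for x
    using braid_knot_frac[of g "x + 1"] braid_knot_frac[of g x] by (simp add: frac_1_eq)
  show "braid_knot g C1_differentiable_on UNIV"
    unfolding C1_differentiable_on_def
    by (intro exI[of _ "\<lambda>x. proj_deriv (lift_curve g x) (lift_deriv g g' x)"] conjI ballI braid_knot_deriv[OF assms])
  show "vector_derivative (braid_knot g) (at x) \<noteq> 0" for x
    using vector_derivative_at[OF braid_knot_deriv(1)[OF assms]] braid_knot_deriv_nonzero by simp
qed

section \<open>Double points of the closed braids\<close>

definition hits :: "(real \<Rightarrow> complex) \<Rightarrow> real set" where
  "hits g = {t \<in> {0<..<1}. g t \<in> {1, -1}}"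

text \<open>
  The moving strand is at parameter \<open>(t + 2) / 3\<close> at time \<open>t\<close>; the strand
  that it meets is one third or two thirds of the parameter interval earlier.
\<close>

definition hit_pair :: "(real \<Rightarrow> complex) \<Rightarrow> real \<Rightarrow> real \<times> real" where
  "hit_pair g t = ((t + 2) / 3 - (if g t = 1 then 1/3 else 2/3), (t + 2) / 3)"

lemma per_first_two_thirds: "C1_loop base g g' \<Longrightarrow> 0 \<le> x \<Longrightarrow> x \<le> 2/3 \<Longrightarrow> per g x = base"
proof -
  assume g: "C1_loop base g g'" and x: "0 \<le> x" "x \<le> 2/3"
  have "frac x = x" using x by (simp add: frac_eq)
  then show ?thesis using g x by (simp add: per_def C1_loop_def)
qed

lemma per_last_third: "2/3 \<le> x \<Longrightarrow> x < 1 \<Longrightarrow> per f x = f (3 * x - 2)"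
  by (simp add: per_def frac_eq)

lemma lift_curve_eq:
  assumes "proj (lift_curve g x) = proj (lift_curve g y)"
  shows "lift_curve g x = lift_curve g y"
proof -
  obtain c where c: "c > 0" "lift_curve g x = c *\<^sub>R lift_curve g y"
    using proj_eqD[OF assms] by auto
  from arg_cong[OF c(2), of sndc] have "unit (3 * x) = c *\<^sub>R unit (3 * y)"
    unfolding sndc_scaleR by (simp add: lift_curve_def)
  then have "cmod (unit (3 * x)) = cmod (c *\<^sub>R unit (3 * y))" by simp
  then have "c = 1" using c(1) by (simp only: norm_scaleR norm_unit)
  then show ?thesis using c(2) by simp
qed

lemma strand_eq_unit: "strand k = unit (- (1/3)) \<longleftrightarrow> k = 1" "strand k = unit (- (2/3)) \<longleftrightarrow> k = -1"
proof -
  have "unit (- (1/3)) = unit (2/3)" "unit (- (2/3)) = unit (1/3)" by (simp_all add: unit_eq_iff)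
  then have "unit (- (1/3)) = strand 1" "unit (- (2/3)) = strand (-1)" by (simp_all add: strand_values)
  then show "strand k = unit (- (1/3)) \<longleftrightarrow> k = 1" "strand k = unit (- (2/3)) \<longleftrightarrow> k = -1"
    by (simp_all only: strand_eq_iff)
qed

lemma double_point_cases:
  assumes g: "C1_loop base g g'" and xy: "0 \<le> x" "x < y" "y < 1" "lift_curve g x = lift_curve g y"
  shows "3 * y - 2 \<in> hits g" "(x, y) = hit_pair g (3 * y - 2)"
proof -
  have e: "unit (3 * x) = unit (3 * y)" "unit x * strand (per g x) = unit y * strand (per g y)"
    using xy(4) by (simp_all add: lift_curve_def)
  obtain n :: int where "3 * y - 3 * x = of_int n" using e(1)[symmetric] unfolding unit_eq_iff by (rule Ints_cases)
  moreover from this have "0 < n" "n < 3" using xy by linarith+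
  then have "n = 1 \<or> n = 2" by auto
  ultimately have d: "y - x = 1/3 \<or> y - x = 2/3" by auto
  \<comment> \<open>The parameters differ by one or two thirds, so that the first branch is not in the last third.\<close>
  have x: "per g x = base" using d xy by (intro per_first_two_thirds[OF g]) auto
  then have eq: "unit x = unit y * strand (per g y)" using e(2) by (simp add: strand_values)
  have y: "2/3 < y"
  proof (rule ccontr)
    assume "\<not> ?thesis"
    then have "per g y = base" using xy by (intro per_first_two_thirds[OF g]) auto
    then have "unit x = unit y" using eq by (simp add: strand_values)
    then obtain m :: int where "x - y = of_int m" unfolding unit_eq_iff by (rule Ints_cases)
    moreover from this have "-1 < m" "m < 0" using xy by linarith+
    ultimately show False by simp
  qed
  have st: "strand (g (3 * y - 2)) = unit (x - y)"
    using eq y xy by (simp add: per_last_third unit_diff)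
  have t: "(3 * y - 2 + 2) / 3 = y" by simp
  have neg: "(1::complex) \<noteq> -1" by (simp add: complex_eq_iff)
  from d show "3 * y - 2 \<in> hits g" "(x, y) = hit_pair g (3 * y - 2)"
  proof -
    have "x - y = - (1/3) \<or> x - y = - (2/3)" using d by linarith
    then have "(g (3 * y - 2) = 1 \<and> x = y - (1/3)) \<or> (g (3 * y - 2) = -1 \<and> x = y - (2/3))"
    proof
      assume a: "x - y = - (1/3)"
      then have "strand (g (3 * y - 2)) = unit (- (1/3))" using st by (simp only:)
      with a show ?thesis by (simp add: strand_eq_unit)
    next
      assume a: "x - y = - (2/3)"
      then have "strand (g (3 * y - 2)) = unit (- (2/3))" using st by (simp only:)
      with a show ?thesis by (simp add: strand_eq_unit)
    qed
    then show "3 * y - 2 \<in> hits g" "(x, y) = hit_pair g (3 * y - 2)"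
      using y xy neg by (auto simp: hits_def hit_pair_def t)
  qed
qed

lemma hit_pair_double_point:
  assumes g: "C1_loop base g g'" and t: "t \<in> hits g"
  defines "x \<equiv> fst (hit_pair g t)" and "y \<equiv> snd (hit_pair g t)"
  shows "0 \<le> x" "x < y" "y < 1" "lift_curve g x = lift_curve g y" "x \<le> 2/3" "3 * y - 2 = t" "2/3 < y"
    "per g x = base" "per f y = f t"
proof -
  have t': "0 < t" "t < 1" "g t = 1 \<or> g t = -1" using t by (auto simp: hits_def)
  show "3 * y - 2 = t"
  proof -
    have "y = (t + 2) / 3" by (simp add: y_def hit_pair_def)
    then show ?thesis by simp
  qed
  moreover show "0 \<le> x" "x < y" "y < 1" "x \<le> 2/3" "2/3 < y"
    using t' by (auto simp: x_def y_def hit_pair_def)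
  ultimately have x: "0 \<le> x" "x < y" "y < 1" "x \<le> 2/3" "3 * y - 2 = t" "2/3 < y" by simp_all
  show px: "per g x = base" using x by (intro per_first_two_thirds[OF g])
  show py: "per f y = f t" for f using x per_last_third[of y f] by simp
  have neg: "(1::complex) \<noteq> -1" by (simp add: complex_eq_iff)
  have xy: "x = y + (if g t = 1 then - (1/3) else - (2/3))" by (simp add: x_def y_def hit_pair_def)
  have "strand (g t) = unit (if g t = 1 then - (1/3) else - (2/3))"
    using t'(3) neg strand_eq_unit[of "g t"] by auto
  then have "unit x = unit y * strand (g t)" unfolding xy by (simp only: unit_add)
  moreover have "unit (3 * x) = unit (3 * y)"
    unfolding xy unit_eq_iff by simp
  ultimately show "lift_curve g x = lift_curve g y"
    by (simp add: lift_curve_def px py strand_values)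
qed

lemma double_points_braid_knot:
  assumes g: "C1_loop base g g'"
  shows "double_points (braid_knot g) = hit_pair g ` hits g"
proof -
  have eq: "braid_knot g x = braid_knot g y \<longleftrightarrow> lift_curve g x = lift_curve g y" for x y
    unfolding braid_knot_lift_curve[OF g] using lift_curve_eq by metis
  show ?thesis
  proof (intro equalityI subsetI)
    fix p assume "p \<in> double_points (braid_knot g)"
    then obtain x y where p: "p = (x, y)" "0 \<le> x" "x < y" "y < 1" "lift_curve g x = lift_curve g y"
      by (auto simp: double_points_def eq)
    from double_point_cases[OF g p(2-5)] p(1) show "p \<in> hit_pair g ` hits g" by blast
  next
    fix p assume "p \<in> hit_pair g ` hits g"
    then obtain t where t: "t \<in> hits g" "p = hit_pair g t" by blast
    show "p \<in> double_points (braid_knot g)"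
      using hit_pair_double_point(1-4)[OF g t(1)] unfolding t(2) double_points_def
      by (cases "hit_pair g t") (simp add: eq)
  qed
qed

lemma hit_pair_inj: "inj_on (hit_pair g) A"
  by (auto simp: inj_on_def hit_pair_def)

lemma card_double_points:
  "C1_loop base g g' \<Longrightarrow> card (double_points (braid_knot g)) = card (hits g)"
  by (simp add: double_points_braid_knot card_image[OF hit_pair_inj])

lemma braid_knot_embedded:
  assumes g: "C1_loop base g g'" and "hits g = {}"
  shows "embedded_circle (braid_knot g)"
  unfolding embedded_circle_def
proof (intro conjI allI)
  show "range (braid_knot g) \<subseteq> S3" using braid_knot_in_S3 by blast
  show "continuous_on UNIV (braid_knot g)"
    using braid_knot_deriv(1)[OF g] has_vector_derivative_continuous continuous_at_imp_continuous_on by metis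
  fix x y
  have *: False if "frac a < frac b" "braid_knot g a = braid_knot g b" for a b
  proof -
    have "braid_knot g (frac a) = braid_knot g (frac b)" using that(2) by (simp add: braid_knot_frac)
    then have "(frac a, frac b) \<in> double_points (braid_knot g)"
      using that(1) frac_lt_1[of b] by (simp add: double_points_def)
    then show False using double_points_braid_knot[OF g] assms(2) by simp
  qed
  show "braid_knot g x = braid_knot g y \<longleftrightarrow> x - y \<in> \<int>"
  proof
    assume eq: "braid_knot g x = braid_knot g y"
    then have "frac x = frac y" using *[of x y] *[of y x] by (metis linorder_neqE)
    then have "x - y = of_int (\<lfloor>x\<rfloor> - \<lfloor>y\<rfloor>)" by (simp add: frac_def algebra_simps)
    then show "x - y \<in> \<int>" by (metis Ints_of_int)
  next
    assume "x - y \<in> \<int>"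
    then obtain n where "x - y = of_int n" by (rule Ints_cases)
    then have "frac x = frac y" by (simp add: frac_def algebra_simps)
    then show "braid_knot g x = braid_knot g y" by (metis braid_knot_frac)
  qed
qed

lemma braid_knot_tame:
  assumes "C1_loop base g g'" and "hits g = {}"
  shows "tame_knot (braid_knot g)"
  unfolding tame_knot_def using braid_knot_embedded[OF assms] braid_knot_immersed[OF assms(1)] isotopic_refl braid_knot_in_S3
  by (intro conjI exI[of _ "braid_knot g"]) blast+

lemma lift_deriv_diff_at_hit_pair:
  assumes g: "C1_loop base g g'" and t: "t \<in> hits g"
  defines "x \<equiv> fst (hit_pair g t)" and "y \<equiv> snd (hit_pair g t)"
  shows "lift_deriv g g' y - lift_deriv g g' x = emb (unit y * (- \<i> * of_real (sqrt 3 / 2) * (3 * g' t))) 0"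
proof -
  note h = hit_pair_double_point[OF g t, folded x_def y_def]
  have "frac x = x" using h by (simp add: frac_eq)
  then have z: "per g' x = 0" using C1_loop_deriv_zero[OF g] h by (simp add: per_def)
  have "unit x * strand (per g x) = unit y * strand (per g y)" "unit (3 * x) = unit (3 * y)"
    using h(4) by (simp_all add: lift_curve_def)
  then show ?thesis
    unfolding lift_deriv_def emb_diff z h(9) by (simp add: mult.assoc)
qed

text \<open>
  The two branches at a double point have the same velocity along the second coordinate, and their
  velocities in the first coordinate differ by a nonzero multiple of the velocity of
  \<open>g\<close>. Hence they are independent, also modulo the radial direction.
\<close>

lemma braid_knot_singular:
  assumes g: "C1_loop base g g'" and fin: "finite (hits g)" and tr: "\<And>t. t \<in> hits g \<Longrightarrow> g' t \<noteq> 0"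
  shows "singular_knot (braid_knot g)"
  unfolding singular_knot_def
proof (intro conjI)
  show "immersed_circle (braid_knot g)" by (rule braid_knot_immersed[OF g])
  show "finite (double_points (braid_knot g))" by (simp add: double_points_braid_knot[OF g] fin)
  show "inj_on (\<lambda>(x, y). braid_knot g x) (double_points (braid_knot g))"
    unfolding double_points_braid_knot[OF g]
  proof (rule inj_onI)
    fix p p' assume p: "p \<in> hit_pair g ` hits g" "p' \<in> hit_pair g ` hits g"
      and pp': "(case p of (x, y) \<Rightarrow> braid_knot g x) = (case p' of (x, y) \<Rightarrow> braid_knot g x)"
    obtain x y x' y' where p_eq: "p = (x, y)" "p' = (x', y')" by (metis surj_pair)
    obtain t t' where t: "t \<in> hits g" "t' \<in> hits g" "hit_pair g t = (x, y)" "hit_pair g t' = (x', y')"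
      using p unfolding p_eq by (metis imageE)
    have eq: "braid_knot g x = braid_knot g x'" using pp' by (simp add: p_eq)
    note h = hit_pair_double_point[OF g t(1)] and h' = hit_pair_double_point[OF g t(2)]
    have "lift_curve g y = lift_curve g y'"
      using eq h(4) h'(4) t(3,4) lift_curve_eq unfolding braid_knot_lift_curve[OF g] by (metis fst_conv snd_conv)
    then have "unit (3 * y) = unit (3 * y')" by (simp add: lift_curve_def)
    then obtain n :: int where n: "3 * y - 3 * y' = of_int n" unfolding unit_eq_iff by (rule Ints_cases)
    have "-1 < real_of_int n" "real_of_int n < 1"
      using n h(3,6,7) h'(3,6,7) t by auto
    then have "n = 0" by linarith
    then have "t = t'" using n h(6) h'(6) t(3,4) by simp
    then show "p = p'" using t(3,4) p_eq by simp
  qed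
  show "\<forall>(x, y)\<in>double_points (braid_knot g).
        dim {vector_derivative (braid_knot g) (at x), vector_derivative (braid_knot g) (at y)} = 2"
    unfolding double_points_braid_knot[OF g]
  proof clarify
    fix t x y assume t: "t \<in> hits g" "(x, y) = hit_pair g t"
    then have xy: "x = fst (hit_pair g t)" "y = snd (hit_pair g t)" by (metis fst_conv, metis snd_conv)
    note h = hit_pair_double_point[OF g t(1), folded xy]
    let ?p = "lift_curve g y" let ?q = "lift_deriv g g' x" let ?r = "lift_deriv g g' y"
    have vd: "vector_derivative (braid_knot g) (at z) = proj_deriv (lift_curve g z) (lift_deriv g g' z)" for z
      by (rule vector_derivative_at[OF braid_knot_deriv(1)[OF g]])
    have indep: "a = 0 \<and> b = 0" if ab: "a *\<^sub>R proj_deriv ?p ?q + b *\<^sub>R proj_deriv ?p ?r = 0" for a b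
    proof -
      obtain c where c: "a *\<^sub>R ?q + b *\<^sub>R ?r = c *\<^sub>R ?p"
        using proj_deriv_relation[OF _ ab] by auto
      have u: "unit (3 * x) = unit (3 * y)" using h(4) by (simp add: lift_curve_def)
      have "sndc (a *\<^sub>R ?q + b *\<^sub>R ?r) = of_real (a + b) * (of_real (6 * pi) * \<i> * unit (3 * y))"
      proof -
        have "sndc (p + q) = sndc p + sndc q" for p q by (simp add: sndc_def complex_eq_iff)
        then have s: "sndc (a *\<^sub>R ?q + b *\<^sub>R ?r) = a *\<^sub>R sndc ?q + b *\<^sub>R sndc ?r"
          by (simp only: sndc_scaleR)
        show ?thesis unfolding s unfolding lift_deriv_def sndc_emb u by (simp add: scaleR_conv_of_real algebra_simps)
      qed
      moreover have "sndc (c *\<^sub>R ?p) = of_real c * unit (3 * y)"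
        unfolding sndc_scaleR by (simp add: lift_curve_def scaleR_conv_of_real)
      ultimately have "(of_real (a + b) * (of_real (6 * pi) * \<i>)) * unit (3 * y) = of_real c * unit (3 * y)"
        using c by (metis mult.assoc)
      then have "of_real (a + b) * (of_real (6 * pi) * \<i>) = (of_real c :: complex)"
        by (simp only: mult_right_cancel[OF unit_nonzero])
      then have cz: "c = 0" "a + b = 0" by (auto simp: complex_eq_iff)
      then have "a = - b" by simp
      then have "b *\<^sub>R (?r - ?q) = a *\<^sub>R ?q + b *\<^sub>R ?r" by (simp add: scaleR_diff_right)
      then have "b *\<^sub>R (?r - ?q) = 0" using c cz by simp
      moreover have "?r - ?q \<noteq> 0"
        using lift_deriv_diff_at_hit_pair[OF g t(1), folded xy] tr[OF t(1)]
        by (metis emb_eq_iff emb_0 mult_eq_0_iff unit_nonzero neg_equal_0_iff_equal complex_i_not_zero of_real_eq_0_iff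
            divide_eq_0_iff real_sqrt_eq_0_iff zero_neq_numeral)
      ultimately show ?thesis using \<open>a = - b\<close> by simp
    qed
    have ne: "proj_deriv ?p ?r \<noteq> 0" using indep[of 0 1] by auto
    have "proj_deriv ?p ?q \<notin> span {proj_deriv ?p ?r}"
    proof
      assume "proj_deriv ?p ?q \<in> span {proj_deriv ?p ?r}"
      then obtain k where "proj_deriv ?p ?q = k *\<^sub>R proj_deriv ?p ?r" by (auto simp: span_singleton)
      then have "1 *\<^sub>R proj_deriv ?p ?q + (- k) *\<^sub>R proj_deriv ?p ?r = 0" by simp
      from indep[OF this] show False by simp
    qed
    then have "independent {proj_deriv ?p ?q, proj_deriv ?p ?r}" "proj_deriv ?p ?q \<noteq> proj_deriv ?p ?r"
      using ne by (auto simp: independent_insert span_base)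
    then have "dim {proj_deriv ?p ?q, proj_deriv ?p ?r} = 2"
      by (simp add: dim_eq_card_independent)
    then show "dim {vector_derivative (braid_knot g) (at x), vector_derivative (braid_knot g) (at y)} = 2"
      unfolding vd h(4) .
  qed
qed

section \<open>Resolutions of the closed braids\<close>

lemma emb_rows_det:
  "det (vector [emb z w, emb a v, emb b v, emb c 0] :: real^4^4) = Im (cnj w * v) * Im (cnj (b - a) * c)"
  by (simp add: det_4 vector_4 algebra_simps)

lemma det_row_combination:
  fixes p q r s :: "real^4"
  shows "det (vector [k *\<^sub>R p, k *\<^sub>R q - a *\<^sub>R p, k *\<^sub>R r - b *\<^sub>R p, k *\<^sub>R s - c *\<^sub>R p] :: real^4^4)
    = k ^ 4 * det (vector [p, q, r, s] :: real^4^4)"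
  by (simp add: det_4 vector_4 algebra_simps power4_eq_xxxx)

text \<open>
  Moving \<open>g\<close> straight to \<open>g + \<gamma>\<close> removes the passage at
  \<open>t0\<close> and nothing else. The resolution is positive if \<open>\<gamma>\<close> points
  to the right of \<open>g\<close> at the time \<open>t0\<close>.
\<close>

lemma braid_knot_resolution:
  assumes g: "C1_loop base g g'" and \<gamma>: "C1_loop 0 \<gamma> \<gamma>'"
    and t0: "t0 \<in> hits g" and e: "e * Im (cnj (g' t0) * \<gamma> t0) < 0"
    and fin: "finite (hits g)" and tr: "\<And>t. t \<in> hits g \<Longrightarrow> g' t \<noteq> 0"
    and hits: "\<And>s. s \<in> {0<..1} \<Longrightarrow> hits (\<lambda>t. g t + of_real s * \<gamma> t) = hits g - {t0}"
    and away: "\<And>t. t \<in> hits g - {t0} \<Longrightarrow> \<gamma> t = 0 \<and> \<gamma>' t = 0"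
  shows "resolution e (braid_knot g) (hit_pair g t0) (braid_knot (\<lambda>t. g t + \<gamma> t))"
proof -
  define h where "h s = (\<lambda>t. g t + of_real s * \<gamma> t)" for s :: real
  define h' where "h' s = (\<lambda>t. g' t + of_real s * \<gamma>' t)" for s :: real
  have h: "C1_loop base (h s) (h' s)" for s unfolding h_def h'_def by (rule C1_loop_affine[OF g \<gamma>])
  have hper: "per (h s) x = per g x + of_real s * per \<gamma> x" for s x by (simp add: per_def h_def)
  have h'per: "per (h' s) x = per g' x + of_real s * per \<gamma>' x" for s x by (simp add: per_def h'_def)
  \<comment> \<open>The unprojected curves depend on s in an affine way, with velocity V.\<close>
  define V where "V x = emb (unit x * (- \<i> * of_real (sqrt 3 / 2) * per \<gamma> x)) 0" for x
  let ?G = "\<lambda>s. braid_knot (h s)"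
  let ?Gt = "\<lambda>s x. proj_deriv (lift_curve (h s) x) (V x)"
  let ?Gx = "\<lambda>s x. proj_deriv (lift_curve (h s) x) (lift_deriv (h s) (h' s) x)"
  have h0: "h 0 = g" and h0': "h' 0 = g'" and h1: "h 1 = (\<lambda>t. g t + \<gamma> t)" by (auto simp: h_def h'_def)
  have lc: "lift_curve (h s) x = lift_curve g x + s *\<^sub>R V x" for s x
    unfolding lift_curve_def V_def hper emb_scaleR emb_add strand_def
    by (simp add: scaleR_conv_of_real algebra_simps)
  have Gt: "((\<lambda>s. ?G s x) has_vector_derivative ?Gt t x) (at t within {0..1})" for t x
  proof -
    have "((\<lambda>s. lift_curve (h s) x) has_vector_derivative V x) (at t within {0..1})"
      unfolding lc by (auto intro!: derivative_eq_intros)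
    from proj_has_vector_derivative[OF this lift_curve_nonzero] show ?thesis
      by (simp only: braid_knot_lift_curve[OF h])
  qed
  have c1: "continuous_on ({0..1} \<times> UNIV) (\<lambda>x::real \<times> real. per f (snd x))" if "continuous_on UNIV (per f)" for f
    by (rule continuous_on_compose2[OF that]) (auto intro: continuous_intros)
  note cg = per_deriv(2,3)[OF g, THEN c1] and c\<gamma> = per_deriv(2,3)[OF \<gamma>, THEN c1]
  have cl: "continuous_on ({0..1} \<times> UNIV) (\<lambda>x. lift_curve (h (fst x)) (snd x))"
    unfolding lift_curve_def strand_def hper by (intro continuous_intros cg c\<gamma>)
  have contGt: "continuous_on ({0..1} \<times> UNIV) (\<lambda>(t, x). ?Gt t x)"
    unfolding case_prod_beta
    by (intro continuous_on_proj_deriv cl) (auto simp: V_def intro!: continuous_intros c\<gamma>)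
  have contGx: "continuous_on ({0..1} \<times> UNIV) (\<lambda>(t, x). ?Gx t x)"
    unfolding case_prod_beta
  proof (intro continuous_on_proj_deriv cl)
    show "continuous_on ({0..1} \<times> UNIV) (\<lambda>x. lift_deriv (h (fst x)) (h' (fst x)) (snd x))"
      unfolding lift_deriv_def strand_def hper h'per by (intro continuous_intros cg c\<gamma>)
  qed simp
  have sing: "singular_knot (?G t) \<and> double_points (?G t) = double_points (?G 0) - {hit_pair g t0}" if t: "t \<in> {0<..1}" for t
  proof
    have ht: "hits (h t) = hits g - {t0}" using hits[OF t] by (simp add: h_def)
    show "singular_knot (?G t)"
    proof (rule braid_knot_singular[OF h])
      show "finite (hits (h t))" using fin ht by simp
      show "h' t u \<noteq> 0" if "u \<in> hits (h t)" for u
        using that away[of u] tr[of u] unfolding ht by (simp add: h'_def)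
    qed
    have "hit_pair (h t) u = hit_pair g u" if "u \<in> hits g - {t0}" for u
      using away[OF that] by (simp add: hit_pair_def h_def)
    then have "hit_pair (h t) ` (hits g - {t0}) = hit_pair g ` (hits g - {t0})" by (rule image_cong[OF refl])
    also have "\<dots> = hit_pair g ` hits g - {hit_pair g t0}"
      using inj_on_image_set_diff[OF hit_pair_inj[of g UNIV]] t0 by auto
    finally show "double_points (?G t) = double_points (?G 0) - {hit_pair g t0}"
      unfolding h0 double_points_braid_knot[OF h] double_points_braid_knot[OF g] ht .
  qed
  define x where "x = fst (hit_pair g t0)"
  define y where "y = snd (hit_pair g t0)"
  note hp = hit_pair_double_point[OF g t0, folded x_def y_def]
  have det: "e * det (vector [braid_knot g x, ?Gx 0 x, ?Gx 0 y, ?Gt 0 x - ?Gt 0 y] :: real^4^4) > 0"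
  proof -
    let ?p = "lift_curve g y" let ?k = "inverse (norm ?p)"
    have "frac x = x" using hp by (simp add: frac_eq)
    then have "per \<gamma> x = 0" using \<gamma> hp by (simp add: per_def C1_loop_def)
    then have Vx: "V x = 0" by (simp add: V_def)
    have Vy: "V y = emb (unit y * (- \<i> * of_real (sqrt 3 / 2) * \<gamma> t0)) 0" by (simp add: V_def hp(9))
    have k: "?k > 0" by simp
    have pd: "\<exists>a. proj_deriv ?p q = ?k *\<^sub>R q - a *\<^sub>R ?p" for q by (auto simp: proj_deriv_def)
    obtain a b c where abc: "proj_deriv ?p (lift_deriv g g' x) = ?k *\<^sub>R lift_deriv g g' x - a *\<^sub>R ?p"
      "proj_deriv ?p (lift_deriv g g' y) = ?k *\<^sub>R lift_deriv g g' y - b *\<^sub>R ?p"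
      "proj_deriv ?p (V y) = ?k *\<^sub>R V y - c *\<^sub>R ?p" using pd by metis
    have z: "proj_deriv ?p 0 = 0" by (simp add: proj_deriv_def)
    \<comment> \<open>Up to multiples of the first row, the rows are multiples of the vectors before projection.\<close>
    have row4: "proj_deriv ?p 0 - proj_deriv ?p (V y) = ?k *\<^sub>R (- V y) - (- c) *\<^sub>R ?p"
      unfolding abc z by simp
    have row1: "braid_knot g x = ?k *\<^sub>R ?p"
      unfolding braid_knot_lift_curve[OF g] hp(4) by (simp add: proj_def)
    have "det (vector [braid_knot g x, ?Gx 0 x, ?Gx 0 y, ?Gt 0 x - ?Gt 0 y] :: real^4^4)
      = ?k ^ 4 * det (vector [?p, lift_deriv g g' x, lift_deriv g g' y, - V y] :: real^4^4)"
      unfolding h0 h0' hp(4) Vx row4 row1 abc(1,2) by (rule det_row_combination)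
    also have "det (vector [?p, lift_deriv g g' x, lift_deriv g g' y, - V y] :: real^4^4)
      = - (27 / 2 * pi) * Im (cnj (g' t0) * \<gamma> t0)"
    proof -
      obtain z1 z2 where L: "lift_deriv g g' x = emb z1 (of_real (6 * pi) * \<i> * unit (3 * y))"
         "lift_deriv g g' y = emb z2 (of_real (6 * pi) * \<i> * unit (3 * y))"
        using hp(4) by (simp add: lift_deriv_def lift_curve_def)
      have d: "z2 - z1 = unit y * (- \<i> * of_real (sqrt 3 / 2) * (3 * g' t0))"
        using lift_deriv_diff_at_hit_pair[OF g t0, folded x_def y_def] unfolding L emb_diff by simp
      have uu: "cnj (unit r) * unit r = 1" for r by (simp add: unit_def cis_mult cis_cnj)
      have V': "- V y = emb (- (unit y * (- \<i> * of_real (sqrt 3 / 2) * \<gamma> t0))) 0"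
        unfolding Vy by (simp add: vec_eq_iff forall_4)
      have "Im (cnj (unit (3 * y)) * (of_real (6 * pi) * \<i> * unit (3 * y))) = 6 * pi"
      proof -
        have eq: "cnj (unit (3 * y)) * (of_real (6 * pi) * \<i> * unit (3 * y)) = of_real (6 * pi) * \<i> * (cnj (unit (3 * y)) * unit (3 * y))"
          by (simp only: mult_ac)
        show ?thesis unfolding eq unfolding uu by simp
      qed
      moreover have "Im (cnj (z2 - z1) * - (unit y * (- \<i> * of_real (sqrt 3 / 2) * \<gamma> t0))) = - (9 / 4) * Im (cnj (g' t0) * \<gamma> t0)"
      proof -
        have eq: "cnj (z2 - z1) * - (unit y * (- \<i> * of_real (sqrt 3 / 2) * \<gamma> t0))
          = - (cnj (unit y) * unit y) * of_real (3 * (sqrt 3 / 2 * (sqrt 3 / 2))) * (cnj (g' t0) * \<gamma> t0)"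
        proof -
          have "complex_of_real (sqrt 3) * complex_of_real (sqrt 3) = 3" by (simp flip: of_real_mult)
          then show ?thesis unfolding d by (simp add: mult_ac)
        qed
        show ?thesis unfolding eq unfolding uu by simp
      qed
      ultimately show ?thesis
        unfolding L V' by (simp only: lift_curve_def emb_rows_det)
    qed
    finally have "e * det (vector [braid_knot g x, ?Gx 0 x, ?Gx 0 y, ?Gt 0 x - ?Gt 0 y] :: real^4^4)
      = (?k ^ 4 * (27 / 2 * pi)) * (- (e * Im (cnj (g' t0) * \<gamma> t0)))" by simp
    also have "\<dots> > 0" using k e by (intro mult_pos_pos zero_less_power) auto
    finally show ?thesis .
  qed
  have xy: "hit_pair g t0 = (x, y)" by (simp add: x_def y_def)
  show ?thesis
    unfolding resolution_def
  proof (rule exI[of _ ?G], rule exI[of _ ?Gt], rule exI[of _ ?Gx], intro conjI ballI allI)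
    show "?G 0 = braid_knot g" "?G 1 = braid_knot (\<lambda>t. g t + \<gamma> t)" by (simp_all only: h0 h1)
    show "(?G t has_vector_derivative ?Gx t z) (at z)" for t z by (rule braid_knot_deriv(1)[OF h])
    show "singular_knot (?G t)" "double_points (?G t) = double_points (braid_knot g) - {hit_pair g t0}" if "t \<in> {0<..1}" for t
      using sing[OF that] by (simp_all add: h0)
    show "case hit_pair g t0 of (x, y) \<Rightarrow>
      e * det (vector [braid_knot g x, ?Gx 0 x, ?Gx 0 y, ?Gt 0 x - ?Gt 0 y] :: real^4^4) > 0"
      unfolding xy using det by simp
  qed (rule Gt contGt contGx)+
qed

lemma double_half_step [simp]: "(2 * a + 2) / (2::real) = a + 1"
  by (simp add: field_simps)

section \<open>Continuously differentiable paths and their passages through 1 and -1\<close>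

definition C1_path :: "complex \<Rightarrow> complex \<Rightarrow> (real \<Rightarrow> complex) \<Rightarrow> (real \<Rightarrow> complex) \<Rightarrow> bool" where
  "C1_path p q g g' \<longleftrightarrow> (\<forall>t. (g has_vector_derivative g' t) (at t)) \<and> continuous_on UNIV g' \<and>
     (\<forall>t\<le>0. g t = p \<and> g' t = 0) \<and> (\<forall>t\<ge>1. g t = q \<and> g' t = 0)"

lemma C1_path_loop: "C1_path c c g g' \<Longrightarrow> C1_loop c g g'"
  by (auto simp: C1_path_def C1_loop_def)

lemma C1_path_path:
  assumes "C1_path p q g g'"
  shows "path g" "pathstart g = p" "pathfinish g = q"
proof -
  show "path g"
    unfolding path_def using assms
    by (meson C1_path_def continuous_at_imp_continuous_on has_vector_derivative_continuous)
qed (use assms in \<open>auto simp: C1_path_def pathstart_def pathfinish_def\<close>)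

lemma has_vector_derivative_scale_shift:
  fixes g :: "real \<Rightarrow> 'a::real_normed_vector"
  assumes "(g has_vector_derivative g') (at (a * t + b))"
  shows "((\<lambda>t. g (a * t + b)) has_vector_derivative a *\<^sub>R g') (at t)"
proof -
  have "((\<lambda>t. a * t + b) has_vector_derivative a) (at t)" by (auto intro!: derivative_eq_intros)
  from vector_diff_chain_at[OF this assms] show ?thesis by (simp add: o_def)
qed

text \<open>
  Because each of the paths is at rest outside its own half of the interval, the derivative of the
  concatenation is the sum of the two rescaled derivatives, without case distinction.
\<close>

definition join_deriv :: "(real \<Rightarrow> complex) \<Rightarrow> (real \<Rightarrow> complex) \<Rightarrow> real \<Rightarrow> complex" where
  "join_deriv f' g' t = 2 * f' (2 * t) + 2 * g' (2 * t - 1)"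

lemma join_eq_sum:
  assumes "C1_path p q f f'" "C1_path q r g g'"
  shows "(f +++ g) t = f (2 * t) + g (2 * t - 1) - q"
  using assms by (auto simp: joinpaths_def C1_path_def)

lemma C1_path_join:
  assumes f: "C1_path p q f f'" and g: "C1_path q r g g'"
  shows "C1_path p r (f +++ g) (join_deriv f' g')"
  unfolding C1_path_def
proof (intro conjI allI)
  have eq: "f +++ g = (\<lambda>t. f (2 * t) + g (2 * t - 1) - q)"
    using join_eq_sum[OF f g] by auto
  show "((f +++ g) has_vector_derivative join_deriv f' g' t) (at t)" for t
  proof -
    have "((\<lambda>t. f (2 * t + 0)) has_vector_derivative 2 *\<^sub>R f' (2 * t + 0)) (at t)"
      using f by (intro has_vector_derivative_scale_shift) (simp add: C1_path_def)
    moreover have "((\<lambda>t. g (2 * t + (- 1))) has_vector_derivative 2 *\<^sub>R g' (2 * t + (- 1))) (at t)"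
      using g by (intro has_vector_derivative_scale_shift) (simp add: C1_path_def)
    ultimately show ?thesis
      unfolding eq join_deriv_def
      by (auto intro!: derivative_eq_intros has_vector_derivative_diff_const simp: scaleR_conv_of_real)
  qed
  have "continuous_on UNIV (\<lambda>t. f' (2 * t))" "continuous_on UNIV (\<lambda>t. g' (2 * t - 1))"
    using f g by (auto simp: C1_path_def intro!: continuous_on_compose2[of UNIV f'] continuous_on_compose2[of UNIV g'] continuous_intros)
  then show "continuous_on UNIV (join_deriv f' g')"
    unfolding join_deriv_def[abs_def] by (intro continuous_intros)
qed (use f g in \<open>auto simp: join_eq_sum[OF f g] join_deriv_def C1_path_def\<close>)

lemma C1_path_reverse:
  assumes f: "C1_path p q f f'"
  shows "C1_path q p (reversepath f) (\<lambda>t. - f' (1 - t))"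
  unfolding C1_path_def
proof (intro conjI allI)
  show "(reversepath f has_vector_derivative - f' (1 - t)) (at t)" for t
    using has_vector_derivative_scale_shift[of f "f' (1 - t)" "-1" t 1] f
    by (simp add: C1_path_def reversepath_def[abs_def] algebra_simps)
  show "continuous_on UNIV (\<lambda>t. - f' (1 - t))"
    using f by (auto simp: C1_path_def intro!: continuous_on_minus continuous_on_compose2[of UNIV f'] continuous_intros)
qed (use f in \<open>auto simp: C1_path_def reversepath_def\<close>)

lemma hits_join:
  assumes f: "C1_path p q f f'" and g: "C1_path q r g g'" and q: "q \<noteq> 1" "q \<noteq> -1"
  shows "hits (f +++ g) = (\<lambda>t. t / 2) ` hits f \<union> (\<lambda>t. (t + 1) / 2) ` hits g"
proof (intro equalityI subsetI)
  fix t assume t: "t \<in> hits (f +++ g)"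
  have "f 1 = q" using f by (simp add: C1_path_def)
  show "t \<in> (\<lambda>t. t / 2) ` hits f \<union> (\<lambda>t. (t + 1) / 2) ` hits g"
  proof (cases "t < 1/2")
    case True
    then have "2 * t \<in> hits f" using t by (auto simp: hits_def joinpaths_def)
    then show ?thesis by (intro UnI1 image_eqI[of _ _ "2 * t"]) auto
  next
    case False
    have "(f +++ g) (1/2) = q" using \<open>f 1 = q\<close> by (simp add: joinpaths_def)
    have "t \<noteq> 1/2"
    proof
      assume "t = 1/2"
      then have "(f +++ g) t = q" using \<open>(f +++ g) (1/2) = q\<close> by (simp only:)
      then show False using t q by (simp add: hits_def)
    qed
    then have "2 * t - 1 \<in> hits g" using t False by (auto simp: hits_def joinpaths_def)
    then show ?thesis by (intro UnI2 image_eqI[of _ _ "2 * t - 1"]) auto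
  qed
next
  fix t assume t: "t \<in> (\<lambda>t. t / 2) ` hits f \<union> (\<lambda>t. (t + 1) / 2) ` hits g"
  then show "t \<in> hits (f +++ g)"
    by (auto simp: hits_def joinpaths_def)
qed

lemma card_hits_join:
  assumes "C1_path p q f f'" "C1_path q r g g'" "q \<noteq> 1" "q \<noteq> -1" "finite (hits f)" "finite (hits g)"
  shows "card (hits (f +++ g)) = card (hits f) + card (hits g)"
proof -
  have "(\<lambda>t. t / 2) ` hits f \<inter> (\<lambda>t. (t + 1) / 2) ` hits g = {}"
    by (auto simp: hits_def)
  then show ?thesis
    unfolding hits_join[OF assms(1-4)] using assms(5,6)
    by (subst card_Un_disjoint) (auto simp: card_image inj_on_def)
qed

section \<open>Words of circles of varying size\<close>

definition direction :: "letter \<Rightarrow> real" where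
  "direction x = (if snd x then -1 else 1)"

definition letter_sign :: "letter \<Rightarrow> complex" where
  "letter_sign x = (if fst x then -1 else 1)"

definition letter_deriv :: "letter \<times> real \<Rightarrow> real \<Rightarrow> complex" where
  "letter_deriv l t = of_real (snd l / 2) * letter_sign (fst l) *
     (- of_real (direction (fst l) * (2 * pi * smoothstep' t)) * \<i> * cis (direction (fst l) * (2 * pi * smoothstep t)))"

lemma letter_loop_eq:
  "letter_loop l t = of_real (snd l / 2) * letter_sign (fst l) * (1 - cis (direction (fst l) * (2 * pi * smoothstep t)))"
  by (simp add: letter_loop_def letter_sign_def direction_def)

lemma smoothstep'_outside [simp]: "t \<le> 0 \<Longrightarrow> smoothstep' t = 0" "t \<ge> 1 \<Longrightarrow> smoothstep' t = 0"
  by (auto simp: smoothstep'_def abs_if)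

lemma C1_letter: "C1_path 0 0 (letter_loop l) (letter_deriv l)"
  unfolding C1_path_def
proof (intro conjI allI impI)
  let ?d = "direction (fst l)"
  have cis1: "cis (?d * (2 * pi)) = 1" by (auto simp: direction_def complex_eq_iff)
  show "letter_loop l t = 0" "letter_deriv l t = 0" if "t \<le> 0" for t
    using that by (simp_all add: letter_loop_eq letter_deriv_def)
  show "letter_loop l t = 0" "letter_deriv l t = 0" if "t \<ge> 1" for t
    using that cis1 by (simp_all add: letter_loop_eq letter_deriv_def)
  show "continuous_on UNIV (letter_deriv l)"
    unfolding letter_deriv_def cis_conv_exp by (intro continuous_intros)
  show "(letter_loop l has_vector_derivative letter_deriv l t) (at t)" for t
  proof -
    have "((\<lambda>t. ?d * (2 * pi * smoothstep t)) has_derivative (\<lambda>h. ?d * (2 * pi * (smoothstep' t * h)))) (at t)"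
      using smoothstep_deriv[of t] unfolding has_field_derivative_def by (intro has_derivative_mult_right)
    from has_derivative_cis[OF this]
    have "((\<lambda>t. cis (?d * (2 * pi * smoothstep t))) has_vector_derivative
        of_real (?d * (2 * pi * smoothstep' t)) * \<i> * cis (?d * (2 * pi * smoothstep t))) (at t)"
      unfolding has_vector_derivative_def
      by (rule has_derivative_eq_rhs) (auto simp: scaleR_conv_of_real mult_ac)
    from has_vector_derivative_mult_right[OF has_vector_derivative_diff[OF has_vector_derivative_const[of 1] this],
        of "of_real (snd l / 2) * letter_sign (fst l)"]
    show ?thesis unfolding letter_loop_eq[abs_def] letter_deriv_def by simp
  qed
qed

lemma letter_half:
  "letter_loop (x, 1) (1/2) = letter_sign x"
  "letter_deriv (x, 1) (1/2) = letter_sign x * \<i> * of_real (2 * pi * direction x)"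
proof -
  have c: "cis (direction x * (2 * pi * smoothstep (1/2))) = -1"
    by (auto simp: direction_def complex_eq_iff)
  show "letter_loop (x, 1) (1/2) = letter_sign x"
    unfolding letter_loop_eq fst_conv snd_conv c by simp
  have "smoothstep' (1/2) = 2" by (simp add: smoothstep'_def)
  then show "letter_deriv (x, 1) (1/2) = letter_sign x * \<i> * of_real (2 * pi * direction x)"
    unfolding letter_deriv_def fst_conv snd_conv c by simp
qed

text \<open>
  The circle of diameter \<open>k\<close> through \<open>0\<close> meets the real axis only at
  \<open>0\<close> and at its antipode, \<open>k\<close> or \<open>-k\<close>.
\<close>

lemma hits_letter:
  assumes "k \<ge> 0" shows "hits (letter_loop (x, k)) = (if k = 1 then {1/2} else {})"
proof -
  have key: "t = 1/2 \<and> k = 1" if t: "0 < t" "t < 1" and eq: "letter_loop (x, k) t = 1 \<or> letter_loop (x, k) t = -1" for t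
  proof -
    let ?\<theta> = "direction x * (2 * pi * smoothstep t)"
    have s: "letter_sign x = 1 \<or> letter_sign x = -1" by (simp add: letter_sign_def)
    \<comment> \<open>After removal of the sign the circle is in the closed right half-plane and does not meet
        \<open>-1\<close>.\<close>
    define X where "X = of_real (k / 2) * (1 - cis ?\<theta>)"
    have "letter_loop (x, k) t = letter_sign x * X" by (simp add: letter_loop_eq X_def)
    then have "X = 1 \<or> X = -1" using eq s by (auto simp: minus_equation_iff[of X])
    moreover have "Re X \<ge> 0" using assms by (simp add: X_def)
    then have "X \<noteq> -1" by auto
    ultimately have e: "of_real (k / 2) * (1 - cis ?\<theta>) = 1" by (simp only: X_def) simp
    then have k: "k \<noteq> 0" by auto
    have "Im (of_real (k / 2) * (1 - cis ?\<theta>)) = 0" "Re (of_real (k / 2) * (1 - cis ?\<theta>)) = 1"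
      using e by simp_all
    then have sin: "sin ?\<theta> = 0" and cos: "k / 2 * (1 - cos ?\<theta>) = 1" using k by simp_all
    have "sin (2 * pi * smoothstep t) = 0" using sin by (cases "snd x") (simp_all add: direction_def)
    then obtain n :: int where n: "2 * pi * smoothstep t = of_int n * pi" by (auto simp: sin_zero_iff_int2)
    then have n': "2 * smoothstep t = of_int n" by simp
    then have "0 < n" "n < 2" using smoothstep_strict[OF t] by linarith+
    then have "n = 1" by simp
    then have half: "smoothstep t = 1/2" using n' by simp
    then have "t = 1/2" by (rule smoothstep_eq_half[THEN iffD1])
    moreover have "cos ?\<theta> = -1" unfolding half by (cases "snd x") (simp_all add: direction_def)
    then have "k = 1" using cos by simp
    ultimately show ?thesis by simp
  qed
  have A: "t = 1/2 \<and> k = 1" if "t \<in> hits (letter_loop (x, k))" for t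
    by (rule key) (use that in \<open>simp_all add: hits_def\<close>)
  have B: "1/2 \<in> hits (letter_loop (x, 1))"
    unfolding hits_def using letter_half(1)[of x] by (simp add: letter_sign_def)
  show ?thesis
  proof (cases "k = 1")
    case True
    then show ?thesis using A B by auto
  next
    case False
    then have "hits (letter_loop (x, k)) = {}" using A by blast
    then show ?thesis using False by simp
  qed
qed

primrec word_deriv :: "(letter \<times> real) list \<Rightarrow> real \<Rightarrow> complex" where
  "word_deriv [] = (\<lambda>t. 0)"
| "word_deriv (l # w) = join_deriv (letter_deriv l) (word_deriv w)"

lemma C1_word: "C1_path 0 0 (word_path w) (word_deriv w)"
proof (induction w)
  case Nil
  show ?case by (simp add: C1_path_def)
next
  case (Cons l w)
  then show ?case by (simp add: C1_path_join[OF C1_letter])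
qed

abbreviation nonneg_word :: "(letter \<times> real) list \<Rightarrow> bool" where
  "nonneg_word w \<equiv> \<forall>l\<in>set w. snd l \<ge> 0"

lemma hits_word_Cons:
  "k \<ge> 0 \<Longrightarrow> hits (word_path ((x, k) # w)) = (if k = 1 then {1/4} else {}) \<union> (\<lambda>t. (t + 1) / 2) ` hits (word_path w)"
  by (simp add: hits_join[OF C1_letter C1_word] hits_letter)

lemma hits_word:
  assumes "nonneg_word w"
  shows "finite (hits (word_path w))" "card (hits (word_path w)) = length (filter (\<lambda>l. snd l = 1) w)"
    "t \<in> hits (word_path w) \<Longrightarrow> word_deriv w t \<noteq> 0"
proof -
  have "finite (hits (word_path w)) \<and> card (hits (word_path w)) = length (filter (\<lambda>l. snd l = 1) w) \<and>
    (\<forall>t\<in>hits (word_path w). word_deriv w t \<noteq> 0)"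
    using assms
  proof (induction w)
    case Nil
    then show ?case by (simp add: hits_def)
  next
    case (Cons l w)
    obtain x k where l: "l = (x, k)" by (cases l)
    have k: "k \<ge> 0" using Cons.prems l by simp
    have IH: "finite (hits (word_path w))" "card (hits (word_path w)) = length (filter (\<lambda>l. snd l = 1) w)"
      "\<And>t. t \<in> hits (word_path w) \<Longrightarrow> word_deriv w t \<noteq> 0"
      using Cons by auto
    have fin: "finite (hits (letter_loop (x, k)))" by (simp add: hits_letter k)
    have "card (hits (word_path (l # w))) = card (hits (letter_loop (x, k))) + card (hits (word_path w))"
      unfolding l word_path.simps by (rule card_hits_join[OF C1_letter C1_word _ _ fin IH(1)]) auto
    then have "card (hits (word_path (l # w))) = length (filter (\<lambda>l. snd l = 1) (l # w))"
      by (simp add: l hits_letter k IH(2))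
    moreover have "word_deriv (l # w) t \<noteq> 0" if t: "t \<in> hits (word_path (l # w))" for t
      using t unfolding l hits_word_Cons[OF k]
    proof (elim UnE imageE)
      assume "t \<in> (if k = 1 then {1/4} else {})"
      then have t: "t = 1/4" "k = 1" by (auto split: if_splits)
      have "word_deriv w (2 * (1/4) - 1) = 0" using C1_word[of w] by (simp add: C1_path_def)
      then show "word_deriv ((x, k) # w) t \<noteq> 0"
        using letter_half(2)[of x] by (simp add: t join_deriv_def) (simp add: letter_sign_def direction_def)
    next
      fix u assume u: "t = (u + 1) / 2" "u \<in> hits (word_path w)"
      have tu: "2 * t = u + 1" using u(1) by (simp add: field_simps)
      have "u + 1 \<ge> 1" using u(2) by (auto simp: hits_def)
      then have "letter_deriv (x, k) (u + 1) = 0" using C1_letter[of "(x, k)"] by (simp add: C1_path_def)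
      then show "word_deriv ((x, k) # w) t \<noteq> 0" using IH(3)[OF u(2)] by (simp add: join_deriv_def tu)
    qed
    moreover have "finite (hits (word_path (l # w)))" unfolding l hits_word_Cons[OF k] using IH(1) by simp
    ultimately show ?case by blast
  qed
  then show "finite (hits (word_path w))" "card (hits (word_path w)) = length (filter (\<lambda>l. snd l = 1) w)"
    "t \<in> hits (word_path w) \<Longrightarrow> word_deriv w t \<noteq> 0" by auto
qed

section \<open>Changing the size of one circle\<close>

text \<open>
  The derivative of the path of a word with respect to the diameter of its \<open>n\<close>-th
  circle; \<open>bump_time n\<close> is the time at which that circle is at the antipode of
  \<open>0\<close>.
\<close>

primrec bump :: "nat \<Rightarrow> letter \<Rightarrow> real \<Rightarrow> complex" where
  "bump 0 x t = letter_loop (x, 1) (2 * t)"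
| "bump (Suc n) x t = bump n x (2 * t - 1)"

primrec bump_deriv :: "nat \<Rightarrow> letter \<Rightarrow> real \<Rightarrow> complex" where
  "bump_deriv 0 x t = 2 * letter_deriv (x, 1) (2 * t)"
| "bump_deriv (Suc n) x t = 2 * bump_deriv n x (2 * t - 1)"

primrec bump_time :: "nat \<Rightarrow> real" where
  "bump_time 0 = 1/4"
| "bump_time (Suc n) = (bump_time n + 1) / 2"

lemma bump_time_range: "0 < bump_time n" "bump_time n < 1"
  by (induction n) auto

lemma C1_bump: "C1_path 0 0 (bump n x) (bump_deriv n x)"
proof (induction n)
  case 0
  have "C1_path 0 0 (letter_loop (x, 1) +++ (\<lambda>t. 0)) (join_deriv (letter_deriv (x, 1)) (\<lambda>t. 0))"
    by (rule C1_path_join[OF C1_letter]) (simp add: C1_path_def)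
  moreover have "letter_loop (x, 1) +++ (\<lambda>t. 0) = bump 0 x"
    using C1_letter[of "(x, 1)"] by (auto simp: joinpaths_def C1_path_def)
  moreover have "join_deriv (letter_deriv (x, 1)) (\<lambda>t. 0) = bump_deriv 0 x"
    by (auto simp: join_deriv_def)
  ultimately show ?case by (simp only:)
next
  case (Suc n)
  have "C1_path 0 0 ((\<lambda>t. 0) +++ bump n x) (join_deriv (\<lambda>t. 0) (bump_deriv n x))"
    by (rule C1_path_join[OF _ Suc]) (simp add: C1_path_def)
  moreover have "(\<lambda>t. 0) +++ bump n x = bump (Suc n) x"
    using Suc by (auto simp: joinpaths_def C1_path_def)
  moreover have "join_deriv (\<lambda>t. 0) (bump_deriv n x) = bump_deriv (Suc n) x"
    by (auto simp: join_deriv_def)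
  ultimately show ?case by (simp only:)
qed

text \<open>
  A circle is proportional to its diameter, so the path of a word is affine in each of the
  diameters.
\<close>

lemma word_path_change:
  "word_path (u @ (x, 1 + c) # v) t = word_path (u @ (x, 1) # v) t + of_real c * bump (length u) x t"
proof (induction u arbitrary: t)
  case Nil
  have "letter_loop (x, 1 + c) (2 * t) = letter_loop (x, 1) (2 * t) + of_real c * letter_loop (x, 1) (2 * t)"
    by (simp add: letter_loop_eq algebra_simps add_divide_distrib)
  then show ?case
    using join_eq_sum[OF C1_letter C1_word, of "(x, 1 + c)" v t] join_eq_sum[OF C1_letter C1_word, of "(x, 1)" v t]
    by simp
next
  case (Cons l u)
  show ?case
    using join_eq_sum[OF C1_letter C1_word, of l "u @ (x, 1 + c) # v" t] join_eq_sum[OF C1_letter C1_word, of l "u @ (x, 1) # v" t]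
      Cons.IH[of "2 * t - 1"] by simp
qed

lemma bump_at_time:
  "bump (length u) x (bump_time (length u)) = letter_sign x"
  "word_deriv (u @ (x, 1) # v) (bump_time (length u)) = 2 ^ Suc (length u) * (letter_sign x * \<i> * of_real (2 * pi * direction x))"
proof (induction u)
  case Nil
  show "bump (length []) x (bump_time (length [])) = letter_sign x" by (simp add: letter_half)
  have "word_deriv v (- (1/2)) = 0" using C1_word[of v] by (simp add: C1_path_def)
  then show "word_deriv ([] @ (x, 1) # v) (bump_time (length [])) = 2 ^ Suc (length []) * (letter_sign x * \<i> * of_real (2 * pi * direction x))"
    using letter_half(2)[of x] by (simp add: join_deriv_def)
next
  case (Cons l u)
  have r: "bump_time (length u) + 1 \<ge> 1" using bump_time_range[of "length u"] by simp
  have e: "2 * bump_time (length (l # u)) = bump_time (length u) + 1" by (simp add: field_simps)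
  show "bump (length (l # u)) x (bump_time (length (l # u))) = letter_sign x"
    using Cons(1) e by simp
  have "letter_deriv l (bump_time (length u) + 1) = 0" using C1_letter[of l] r by (simp add: C1_path_def)
  then show "word_deriv ((l # u) @ (x, 1) # v) (bump_time (length (l # u))) = 2 ^ Suc (length (l # u)) * (letter_sign x * \<i> * of_real (2 * pi * direction x))"
    using Cons(2) e by (simp add: join_deriv_def)
qed

lemma hits_change:
  assumes "nonneg_word u" "nonneg_word v" "k \<ge> 0" "k \<noteq> 1"
  shows "bump_time (length u) \<in> hits (word_path (u @ (x, 1) # v))"
    "hits (word_path (u @ (x, k) # v)) = hits (word_path (u @ (x, 1) # v)) - {bump_time (length u)}"
    "t \<in> hits (word_path (u @ (x, 1) # v)) \<Longrightarrow> t \<noteq> bump_time (length u) \<Longrightarrow> bump (length u) x t = 0 \<and> bump_deriv (length u) x t = 0"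
proof -
  have "bump_time (length u) \<in> hits (word_path (u @ (x, 1) # v)) \<and>
    hits (word_path (u @ (x, k) # v)) = hits (word_path (u @ (x, 1) # v)) - {bump_time (length u)} \<and>
    (\<forall>t\<in>hits (word_path (u @ (x, 1) # v)). t \<noteq> bump_time (length u) \<longrightarrow> bump (length u) x t = 0 \<and> bump_deriv (length u) x t = 0)"
    using assms(1)
  proof (induction u)
    case Nil
    have q: "1/4 \<notin> (\<lambda>t. (t + 1) / 2) ` hits (word_path v)" by (auto simp: hits_def)
    have z: "letter_loop (x, 1) (2 * t) = 0 \<and> letter_deriv (x, 1) (2 * t) = 0" if "t \<in> (\<lambda>t. (t + 1) / 2) ` hits (word_path v)" for t
      using that C1_letter[of "(x, 1)"] by (auto simp: hits_def C1_path_def)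
    show ?case
      using q z assms(3,4) by (auto simp: hits_word_Cons simp del: word_path.simps)
  next
    case (Cons l u)
    obtain y j where l: "l = (y, j)" by (cases l)
    have j: "j \<ge> 0" using Cons.prems l by simp
    have IH: "bump_time (length u) \<in> hits (word_path (u @ (x, 1) # v))"
      "hits (word_path (u @ (x, k) # v)) = hits (word_path (u @ (x, 1) # v)) - {bump_time (length u)}"
      "\<And>t. t\<in>hits (word_path (u @ (x, 1) # v)) \<Longrightarrow> t \<noteq> bump_time (length u) \<Longrightarrow> bump (length u) x t = 0 \<and> bump_deriv (length u) x t = 0"
      using Cons by auto
    have ne: "(bump_time (length u) + 1) / 2 \<noteq> 1/4" using bump_time_range[of "length u"] by auto
    have inj: "inj (\<lambda>t::real. (t + 1) / 2)" by (auto simp: inj_on_def)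
    have z: "bump (length u) x (- (1/2)) = 0 \<and> bump_deriv (length u) x (- (1/2)) = 0"
      using C1_bump[of "length u" x] by (simp add: C1_path_def)
    show ?case
    proof (intro conjI ballI impI)
      show "bump_time (length (l # u)) \<in> hits (word_path ((l # u) @ (x, 1) # v))"
        using IH(1) by (simp add: l hits_word_Cons[OF j] del: word_path.simps)
      show "hits (word_path ((l # u) @ (x, k) # v)) = hits (word_path ((l # u) @ (x, 1) # v)) - {bump_time (length (l # u))}"
        using ne unfolding l append_Cons hits_word_Cons[OF j] IH(2) image_set_diff[OF inj] by auto
      fix t assume t: "t \<in> hits (word_path ((l # u) @ (x, 1) # v))" "t \<noteq> bump_time (length (l # u))"
      from t(1) have "t = 1/4 \<or> (\<exists>s\<in>hits (word_path (u @ (x, 1) # v)). t = (s + 1) / 2)"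
        unfolding l append_Cons hits_word_Cons[OF j] by (auto split: if_splits)
      then have "bump (length (l # u)) x t = 0 \<and> bump_deriv (length (l # u)) x t = 0"
      proof (elim disjE bexE)
        assume "t = 1/4"
        then show ?thesis unfolding \<open>t = 1/4\<close> using z by simp
      next
        fix s assume s: "s \<in> hits (word_path (u @ (x, 1) # v))" "t = (s + 1) / 2"
        then have "s \<noteq> bump_time (length u)" using t(2) by auto
        then show ?thesis unfolding s(2) using IH(3)[OF s(1)] by simp
      qed
      then show "bump (length (l # u)) x t = 0" "bump_deriv (length (l # u)) x t = 0" by simp_all
    qed
  qed
  then show "bump_time (length u) \<in> hits (word_path (u @ (x, 1) # v))"
    "hits (word_path (u @ (x, k) # v)) = hits (word_path (u @ (x, 1) # v)) - {bump_time (length u)}"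
    "t \<in> hits (word_path (u @ (x, 1) # v)) \<Longrightarrow> t \<noteq> bump_time (length u) \<Longrightarrow> bump (length u) x t = 0 \<and> bump_deriv (length u) x t = 0"
    by blast+
qed

section \<open>The path from the base point to the origin\<close>

text \<open>
  For the root \<open>\<i> * y\<close> of the quartic with \<open>y\<close> real and positive,
  \<open>k\<close> is purely imaginary and a function of \<open>y\<close>. Letting \<open>y\<close>
  run from \<open>sqrt 3\<close> to \<open>tau\<close> moves \<open>k\<close> from
  \<open>base\<close> to \<open>0\<close>.
\<close>

definition approach_height :: "real \<Rightarrow> real" where
  "approach_height t = sqrt 3 + (tau - sqrt 3) * smoothstep t"

definition approach :: "real \<Rightarrow> complex" where
  "approach t = \<i> * of_real ((approach_height t ^ 4 + 6 * (approach_height t)\<^sup>2 - 3) / (8 * approach_height t))"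

lemma smoothstep_01: "0 \<le> smoothstep t" "smoothstep t \<le> 1"
proof -
  have "0 \<le> smoothstep t \<and> smoothstep t \<le> 1"
    using smoothstep_strict[of t] by (cases "t \<le> 0"; cases "t \<ge> 1") auto
  then show "0 \<le> smoothstep t" "smoothstep t \<le> 1" by auto
qed

lemma approach_height_pos: "approach_height t > 0"
proof -
  have "approach_height t = (1 - smoothstep t) * sqrt 3 + smoothstep t * tau"
    by (simp add: approach_height_def algebra_simps)
  also have "\<dots> > 0"
    using smoothstep_01[of t] tau_pos
    by (cases "smoothstep t = 0") (auto intro!: add_nonneg_pos mult_nonneg_nonneg mult_pos_pos)
  finally show ?thesis .
qed

lemma approach_avoids: "approach t \<noteq> 1" "approach t \<noteq> -1"
  by (auto simp: approach_def complex_eq_iff)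

definition approach_deriv :: "real \<Rightarrow> complex" where
  "approach_deriv t = (let y = approach_height t in
     \<i> * of_real ((3 * y\<^sup>2 / 8 + 6 / 8 + 3 / (8 * y\<^sup>2)) * ((tau - sqrt 3) * smoothstep' t)))"

lemma C1_approach: "C1_path base 0 approach approach_deriv"
  unfolding C1_path_def
proof (intro conjI allI impI)
  let ?y = approach_height
  have y: "?y t \<noteq> 0" for t using approach_height_pos[of t] by simp
  have dy: "(?y has_real_derivative (tau - sqrt 3) * smoothstep' t) (at t)" for t
    unfolding approach_height_def[abs_def] by (auto intro!: derivative_eq_intros smoothstep_deriv)
  have eq: "approach t = \<i> * of_real (?y t ^ 3 / 8 + 6 / 8 * ?y t - 3 / 8 * inverse (?y t))" for t
  proof -
    have "(?y t ^ 4 + 6 * (?y t)\<^sup>2 - 3) / (8 * ?y t) = ?y t ^ 3 / 8 + 6 / 8 * ?y t - 3 / 8 * inverse (?y t)"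
      using y[of t] by (simp add: field_simps power4_eq_xxxx power3_eq_cube power2_eq_square)
    then show ?thesis by (simp only: approach_def)
  qed
  have d: "((\<lambda>t. ?y t ^ 3 / 8 + 6 / 8 * ?y t - 3 / 8 * inverse (?y t)) has_real_derivative
      (3 * (?y t)\<^sup>2 / 8 + 6 / 8 + 3 / (8 * (?y t)\<^sup>2)) * ((tau - sqrt 3) * smoothstep' t)) (at t)" for t
    using y[of t] by (auto intro!: derivative_eq_intros dy simp: field_simps eval_nat_numeral)
  show "(approach has_vector_derivative approach_deriv t) (at t)" for t
  proof -
    have "((\<lambda>t. of_real (?y t ^ 3 / 8 + 6 / 8 * ?y t - 3 / 8 * inverse (?y t)) :: complex) has_vector_derivative
        of_real ((3 * (?y t)\<^sup>2 / 8 + 6 / 8 + 3 / (8 * (?y t)\<^sup>2)) * ((tau - sqrt 3) * smoothstep' t))) (at t)"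
      by (intro has_vector_derivative_of_real) (use d in \<open>simp add: has_real_derivative_iff_has_vector_derivative\<close>)
    from has_vector_derivative_mult_right[OF this, of \<i>] show ?thesis
      unfolding eq[abs_def] approach_deriv_def Let_def .
  qed
  show "continuous_on UNIV approach_deriv"
    unfolding approach_deriv_def Let_def approach_height_def
    using y unfolding approach_height_def by (intro continuous_intros) auto
  show "approach t = base" if "t \<le> 0" for t
  proof -
    have "approach t = \<i> * of_real (24 / (8 * sqrt 3))"
    proof -
      have h: "approach_height t = sqrt 3" using that by (simp add: approach_height_def)
      have "sqrt 3 ^ 4 = (9 :: real)" by (simp add: power4_eq_xxxx)
      then have "sqrt 3 ^ 4 + 6 * (sqrt 3)\<^sup>2 - 3 = (24 :: real)" by simp
      then show ?thesis unfolding approach_def h by (simp only:)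
    qed
    moreover have "24 / (8 * sqrt 3) = sqrt 3" by (simp add: real_div_sqrt)
    ultimately show ?thesis by (simp only: base_def)
  qed
  show "approach t = 0" if "t \<ge> 1" for t
  proof -
    have "tau ^ 4 = (tau\<^sup>2)\<^sup>2" by simp
    also have "\<dots> = 21 - 12 * sqrt 3" unfolding tau_sq by (simp add: power2_eq_square algebra_simps)
    finally have "tau ^ 4 + 6 * tau\<^sup>2 - 3 = 0" by (simp add: tau_sq)
    then show ?thesis using that by (simp add: approach_def approach_height_def)
  qed
qed (simp_all add: approach_deriv_def)

definition spin_base :: complex where "spin_base = of_real (sqrt (sqrt 3)) * cis (pi / 4)"

lemma spin_lift_approach: "spin_lift approach spin_base spin_tau"
proof -
  let ?s = "\<lambda>t. of_real (sqrt (approach_height t)) * cis (pi / 4)"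
  have sq: "(?s t)\<^sup>2 = \<i> * of_real (approach_height t)" for t
    using approach_height_pos[of t] by (simp add: power_mult_distrib Complex.DeMoivre flip: of_real_power)
  have "poly (quartic (approach t)) ((?s t)\<^sup>2) = 0" for t
  proof -
    let ?y = "approach_height t"
    define q where "q = (?y ^ 4 + 6 * ?y\<^sup>2 - 3) / (8 * ?y)"
    have q: "8 * ?y * q = ?y ^ 4 + 6 * ?y\<^sup>2 - 3"
      using approach_height_pos[of t] by (simp add: q_def)
    have "approach t = \<i> * of_real q" by (simp only: approach_def q_def)
    then have "poly (quartic (approach t)) ((?s t)\<^sup>2) = of_real (?y ^ 4 + 6 * ?y\<^sup>2 - 3 - 8 * ?y * q)"
      unfolding sq quartic_eval by (simp add: power_mult_distrib power4_eq_xxxx power2_eq_square algebra_simps)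
    also have "\<dots> = 0" unfolding q by simp
    finally show ?thesis .
  qed
  moreover have "path ?s"
    unfolding path_def approach_height_def by (intro continuous_intros)
  ultimately show ?thesis
    unfolding spin_lift_def spin_base_def spin_tau_def
    by (intro exI[of _ ?s]) (auto simp: pathstart_def pathfinish_def approach_height_def)
qed

section \<open>Knots of words\<close>

definition word_loop :: "(letter \<times> real) list \<Rightarrow> real \<Rightarrow> complex" where
  "word_loop w = approach +++ (word_path w +++ reversepath approach)"

definition word_loop_deriv :: "(letter \<times> real) list \<Rightarrow> real \<Rightarrow> complex" where
  "word_loop_deriv w = join_deriv approach_deriv (join_deriv (word_deriv w) (\<lambda>t. - approach_deriv (1 - t)))"

lemma C1_word_tail: "C1_path 0 base (word_path w +++ reversepath approach) (join_deriv (word_deriv w) (\<lambda>t. - approach_deriv (1 - t)))"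
  by (rule C1_path_join[OF C1_word C1_path_reverse[OF C1_approach]])

lemma C1_word_loop: "C1_path base base (word_loop w) (word_loop_deriv w)"
  unfolding word_loop_def word_loop_deriv_def by (rule C1_path_join[OF C1_approach C1_word_tail])

lemma hits_word_loop: "hits (word_loop w) = (\<lambda>t. (t + 2) / 4) ` hits (word_path w)"
proof -
  have "hits approach = {}" "hits (reversepath approach) = {}"
    using approach_avoids by (auto simp: hits_def reversepath_def)
  then show ?thesis
    unfolding word_loop_def
    by (simp add: hits_join[OF C1_approach C1_word_tail] hits_join[OF C1_word C1_path_reverse[OF C1_approach]] image_image field_simps)
qed

lemma word_loop_deriv_at:
  assumes "0 < t" "t < 1" shows "word_loop_deriv w ((t + 2) / 4) = 4 * word_deriv w t"
proof -
  define a where "a = (t + 2) / 4"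
  have a: "2 * a = 1 + t / 2" "t = 4 * a - 2" by (simp_all add: a_def field_simps)
  have "2 * (2 * a - 1) = t" using a(2) by simp
  moreover have "approach_deriv (1 + t / 2) = 0" "approach_deriv (1 - (t - 1)) = 0"
    using assms C1_approach by (simp_all add: C1_path_def)
  ultimately have "join_deriv (word_deriv w) (\<lambda>t. - approach_deriv (1 - t)) (2 * a - 1) = 2 * word_deriv w t"
    "approach_deriv (2 * a) = 0"
    using a(1) by (simp_all only: join_deriv_def) simp_all
  then show ?thesis by (simp only: word_loop_deriv_def join_deriv_def[of approach_deriv] flip: a_def) simp
qed

lemma word_loop_hits_finite:
  assumes "nonneg_word w"
  shows "finite (hits (word_loop w))" "card (hits (word_loop w)) = length (filter (\<lambda>l. snd l = 1) w)"
    "t \<in> hits (word_loop w) \<Longrightarrow> word_loop_deriv w t \<noteq> 0"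
proof -
  have "inj_on (\<lambda>t::real. (t + 2) / 4) A" for A by (auto simp: inj_on_def)
  then show "finite (hits (word_loop w))" "card (hits (word_loop w)) = length (filter (\<lambda>l. snd l = 1) w)"
    unfolding hits_word_loop using hits_word(1,2)[OF assms] by (simp_all add: card_image)
  show "word_loop_deriv w t \<noteq> 0" if "t \<in> hits (word_loop w)"
  proof -
    have "t \<in> (\<lambda>t. (t + 2) / 4) ` hits (word_path w)" using that by (simp only: hits_word_loop)
    then obtain u where u: "t = (u + 2) / 4" "u \<in> hits (word_path w)" by (rule imageE)
    have "0 < u" "u < 1" using u(2) by (auto simp: hits_def)
    then have "word_loop_deriv w t = 4 * word_deriv w u" unfolding u(1) by (rule word_loop_deriv_at)
    then show ?thesis using hits_word(3)[OF assms u(2)] by simp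
  qed
qed

abbreviation word_knot :: "(letter \<times> real) list \<Rightarrow> curve" where
  "word_knot w \<equiv> braid_knot (word_loop w)"

lemma word_knot_singular: "nonneg_word w \<Longrightarrow> singular_knot (word_knot w)"
  by (rule braid_knot_singular[OF C1_path_loop[OF C1_word_loop]]) (rule word_loop_hits_finite; assumption)+

lemma word_knot_card: "nonneg_word w \<Longrightarrow> card (double_points (word_knot w)) = length (filter (\<lambda>l. snd l = 1) w)"
  using word_loop_hits_finite(2) card_double_points[OF C1_path_loop[OF C1_word_loop]] by simp

lemma word_knot_tame:
  assumes "nonneg_word w" "filter (\<lambda>l. snd l = 1) w = []"
  shows "tame_knot (word_knot w)" "double_points (word_knot w) = {}"
proof -
  have "hits (word_loop w) = {}" using word_loop_hits_finite(1,2)[OF assms(1)] assms(2) by simp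
  then show "tame_knot (word_knot w)" "double_points (word_knot w) = {}"
    using braid_knot_tame[OF C1_path_loop[OF C1_word_loop]] double_points_braid_knot[OF C1_path_loop[OF C1_word_loop]]
    by simp_all
qed

text \<open>
  The sign of \<open>direction x\<close> enters because enlarging a circle moves it to its outer
  side, which is on the right of a counterclockwise circle and on the left of a clockwise one.
\<close>

lemma word_knot_resolution:
  assumes u: "nonneg_word u" and v: "nonneg_word v" and e: "\<bar>e\<bar> = 1"
  shows "resolution (e * direction x) (word_knot (u @ (x, 1) # v))
     (hit_pair (word_loop (u @ (x, 1) # v)) ((bump_time (length u) + 2) / 4)) (word_knot (u @ (x, 1 + e) # v))"
    "hit_pair (word_loop (u @ (x, 1) # v)) ((bump_time (length u) + 2) / 4) \<in> double_points (word_knot (u @ (x, 1) # v))"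
proof -
  let ?n = "length u" let ?w = "u @ (x, 1) # v" let ?t = "(bump_time ?n + 2) / 4"
  note loop = C1_path_loop[OF C1_word_loop]
  have e1: "e = 1 \<or> e = -1" using e by auto
  have nn: "nonneg_word ?w" using u v by auto
  \<comment> \<open>The path of the word occupies the third quarter of the loop.\<close>
  define \<gamma> where "\<gamma> t = of_real e * bump ?n x (4 * t - 2)" for t
  define \<gamma>' where "\<gamma>' t = of_real e * (4 * bump_deriv ?n x (4 * t - 2))" for t
  have \<gamma>: "C1_loop 0 \<gamma> \<gamma>'"
    unfolding C1_loop_def
  proof (intro conjI allI impI)
    show "(\<gamma> has_vector_derivative \<gamma>' t) (at t)" for t
    proof -
      have "((\<lambda>t. bump ?n x (4 * t + (- 2))) has_vector_derivative 4 *\<^sub>R bump_deriv ?n x (4 * t + (- 2))) (at t)"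
        using C1_bump[of ?n x] by (intro has_vector_derivative_scale_shift) (simp add: C1_path_def)
      from has_vector_derivative_mult_right[OF this, of "of_real e"] show ?thesis
        unfolding \<gamma>_def[abs_def] \<gamma>'_def by (simp add: scaleR_conv_of_real)
    qed
    have "continuous_on UNIV (\<lambda>t. bump_deriv ?n x (4 * t - 2))"
      by (rule continuous_on_compose2[of UNIV "bump_deriv ?n x"])
         (use C1_bump[of ?n x] in \<open>auto simp: C1_path_def intro!: continuous_intros\<close>)
    then show "continuous_on UNIV \<gamma>'" unfolding \<gamma>'_def[abs_def] by (intro continuous_intros)
    show "\<gamma> t = 0" if "t \<le> 0 \<or> 1 \<le> t" for t
      using C1_bump[of ?n x] that by (auto simp: \<gamma>_def C1_path_def)
  qed
  have change: "word_loop (u @ (x, 1 + c * e) # v) t = word_loop ?w t + of_real c * \<gamma> t" for c t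
    unfolding word_loop_def join_eq_sum[OF C1_approach C1_word_tail] join_eq_sum[OF C1_word C1_path_reverse[OF C1_approach]]
      word_path_change by (simp add: \<gamma>_def algebra_simps)
  have t_hit: "?t \<in> hits (word_loop ?w)"
    unfolding hits_word_loop using hits_change(1)[OF u v, of 0 x] by simp
  show "hit_pair (word_loop ?w) ?t \<in> double_points (word_knot ?w)"
    using t_hit by (simp add: double_points_braid_knot[OF loop])
  have "resolution (e * direction x) (braid_knot (word_loop ?w)) (hit_pair (word_loop ?w) ?t) (braid_knot (\<lambda>t. word_loop ?w t + \<gamma> t))"
  proof (rule braid_knot_resolution[OF loop \<gamma> t_hit])
    show "finite (hits (word_loop ?w))" "\<And>t. t \<in> hits (word_loop ?w) \<Longrightarrow> word_loop_deriv ?w t \<noteq> 0"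
      using word_loop_hits_finite[OF nn] by auto
    show "e * direction x * Im (cnj (word_loop_deriv ?w ?t) * \<gamma> ?t) < 0"
    proof -
      have "4 * ?t - 2 = bump_time ?n" by (simp add: field_simps)
      then have g: "\<gamma> ?t = of_real e * letter_sign x" unfolding \<gamma>_def by (simp only: bump_at_time)
      have d: "word_loop_deriv ?w ?t = of_real (2 ^ Suc ?n * (8 * pi * direction x)) * (letter_sign x * \<i>)"
        unfolding word_loop_deriv_at[OF bump_time_range] bump_at_time by (simp add: mult_ac)
      have s: "cnj (letter_sign x) * letter_sign x = 1" by (simp add: letter_sign_def)
      have "cnj (word_loop_deriv ?w ?t) * \<gamma> ?t = of_real (2 ^ Suc ?n * (8 * pi * direction x) * e) * (- \<i>) * (cnj (letter_sign x) * letter_sign x)"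
        unfolding d g by (simp add: mult_ac)
      then have "Im (cnj (word_loop_deriv ?w ?t) * \<gamma> ?t) = - (2 ^ Suc ?n * (8 * pi * direction x) * e)"
        unfolding s by simp
      moreover have "e * direction x * (- (2 ^ Suc ?n * (8 * pi * direction x) * e)) < 0"
        using e1 by (auto simp: direction_def)
      ultimately show ?thesis by simp
    qed
    show "hits (\<lambda>t. word_loop ?w t + of_real s * \<gamma> t) = hits (word_loop ?w) - {?t}" if s: "s \<in> {0<..1}" for s
    proof -
      have inj: "inj (\<lambda>t::real. (t + 2) / 4)" by (auto simp: inj_on_def)
      have "(\<lambda>t. word_loop ?w t + of_real s * \<gamma> t) = word_loop (u @ (x, 1 + s * e) # v)"
        using change[of s] by auto
      moreover have "1 + s * e \<ge> 0" "1 + s * e \<noteq> 1" using s e1 by auto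
      ultimately show ?thesis
        using hits_change(2)[OF u v] by (simp add: hits_word_loop image_set_diff[OF inj])
    qed
    show "\<gamma> t = 0 \<and> \<gamma>' t = 0" if t: "t \<in> hits (word_loop ?w) - {?t}" for t
    proof -
      have "t \<in> (\<lambda>t. (t + 2) / 4) ` hits (word_path ?w)" using t unfolding hits_word_loop by (rule DiffD1)
      then obtain r where r: "r \<in> hits (word_path ?w)" "t = (r + 2) / 4" by (rule imageE)
      have "r \<noteq> bump_time ?n" using t r(2) by auto
      then have "bump ?n x r = 0 \<and> bump_deriv ?n x r = 0" using hits_change(3)[OF u v _ _ r(1), of 0] by simp
      moreover have "4 * t - 2 = r" using r(2) by (simp add: field_simps)
      ultimately show ?thesis by (simp add: \<gamma>_def \<gamma>'_def)
    qed
  qed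
  moreover have "(\<lambda>t. word_loop ?w t + \<gamma> t) = word_loop (u @ (x, 1 + e) # v)"
    using change[of 1] by auto
  ultimately show "resolution (e * direction x) (word_knot ?w) (hit_pair (word_loop ?w) ?t) (word_knot (u @ (x, 1 + e) # v))"
    by simp
qed

lemma flipping_word_loop_lift: "spin_lift (word_loop (on (flipping_word n))) spin_base (- spin_base)"
proof -
  have "spin_lift (reversepath approach) (- spin_tau) (- spin_base)"
    by (intro spin_lift_reverse spin_lift_uminus spin_lift_approach)
  then show ?thesis
    unfolding word_loop_def
    by (intro spin_lift_join[OF spin_lift_approach] spin_lift_join[OF flipping_word_spin_lift])
qed

definition off_or_on :: "(letter \<times> real) list \<Rightarrow> bool" where
  "off_or_on w \<longleftrightarrow> (\<forall>l\<in>set w. snd l = 0 \<or> snd l = 2)"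

lemma off_or_on_simps [simp]:
  "off_or_on []" "off_or_on (l # w) \<longleftrightarrow> (snd l = 0 \<or> snd l = 2) \<and> off_or_on w"
  "off_or_on (u @ v) \<longleftrightarrow> off_or_on u \<and> off_or_on v" "off_or_on (on x)"
  by (auto simp: off_or_on_def)

lemma off_or_on_tame:
  assumes "off_or_on w" shows "tame_knot (word_knot w)" "double_points (word_knot w) = {}" "hits (word_path w) = {}"
proof -
  have nn: "nonneg_word w" using assms by (auto simp: off_or_on_def)
  have f: "filter (\<lambda>l. snd l = 1) w = []" using assms by (auto simp: off_or_on_def filter_empty_conv)
  show "tame_knot (word_knot w)" "double_points (word_knot w) = {}"
    using word_knot_tame[OF nn f] by auto
  show "hits (word_path w) = {}" using hits_word(1,2)[OF nn] f by simp
qed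

lemma path_image_avoids:
  assumes "C1_path p q g g'" "hits g = {}" "p \<notin> {1, -1}" "q \<notin> {1, -1}"
  shows "path_image g \<subseteq> - {1, -1}"
proof
  fix z assume "z \<in> path_image g"
  then obtain t where t: "t \<in> {0..1}" "z = g t" by (auto simp: path_image_def)
  have "t \<notin> hits g" using assms(2) by simp
  then show "z \<in> - {1, -1}"
    using t assms(1,3,4) by (cases "t = 0 \<or> t = 1") (auto simp: hits_def C1_path_def)
qed

lemma word_path_image: "off_or_on w \<Longrightarrow> path_image (word_path w) \<subseteq> - {1, -1}"
  by (rule path_image_avoids[OF C1_word off_or_on_tame(3)]) auto

lemma approach_image: "path_image approach \<subseteq> - {1, -1}"
  using approach_avoids by (auto simp: path_image_def)

lemma word_path_ends [simp]:
  "path (word_path w)" "pathstart (word_path w) = 0" "pathfinish (word_path w) = 0"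
  "path approach" "pathstart approach = base" "pathfinish approach = 0"
  using C1_path_path[OF C1_word[of w]] C1_path_path[OF C1_approach] by auto

lemma word_loop_isotopic:
  assumes "homotopic_paths (- {1, -1}) (word_path w) (word_path w')"
  shows "isotopic (word_knot w) (word_knot w')"
proof (rule braid_knot_homotopic)
  show "homotopic_paths (- {1, -1}) (word_loop w) (word_loop w')"
    unfolding word_loop_def using assms approach_image
    by (intro homotopic_paths_join) auto
  show "pathstart (word_loop w) = base" "pathfinish (word_loop w) = base"
    by (simp_all add: word_loop_def)
qed

lemma homotopic_word_append:
  assumes "homotopic_paths (- {1, -1}) (word_path w) (word_path w')" "off_or_on u"
  shows "homotopic_paths (- {1, -1}) (word_path (u @ w)) (word_path (u @ w'))"
  using assms(2)
proof (induction u)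
  case Nil
  then show ?case using assms(1) by simp
next
  case (Cons l u)
  have "path_image (word_path [l]) \<subseteq> - {1, -1}" using Cons.prems by (intro word_path_image) simp
  then have "path_image (letter_loop l) \<subseteq> - {1, -1}"
    using C1_path_path(2,3)[OF C1_letter[of l]] C1_path_path(2,3)[OF C1_word[of "[]"]]
    by (simp add: path_image_join)
  then have "homotopic_paths (- {1, -1}) (letter_loop l) (letter_loop l)"
    using C1_path_path(1)[OF C1_letter] by simp
  then show ?case
    using Cons C1_path_path(3)[OF C1_letter[of l]] by (auto intro!: homotopic_paths_join)
qed

lemma zero_path: "(\<lambda>t. 0) = linepath 0 (0 :: complex)"
  by (auto simp: linepath_def)

lemma letter_off_isotopic:
  assumes "off_or_on u" "off_or_on v"
  shows "isotopic (word_knot (u @ (x, 0) # v)) (word_knot (u @ v))"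
proof (intro word_loop_isotopic homotopic_word_append assms(1))
  have "letter_loop (x, 0) = linepath 0 0" unfolding zero_path[symmetric] by (auto simp: letter_loop_def)
  then show "homotopic_paths (- {1, -1}) (word_path ((x, 0) # v)) (word_path v)"
    using homotopic_paths_lid[of "word_path v" "- {1, -1}"] word_path_image[OF assms(2)] by simp
qed

lemma letter_inverse_isotopic:
  assumes "off_or_on u" "off_or_on v"
  shows "isotopic (word_knot (u @ (x, 2) # (inverse_letter x, 2) # v)) (word_knot (u @ v))"
proof (intro word_loop_isotopic homotopic_word_append assms(1))
  let ?S = "- {1, -1 :: complex}" and ?l = "letter_loop (x, 2)"
  have rev: "letter_loop (inverse_letter x, 2) = reversepath ?l"
    by (auto simp: letter_loop_def inverse_letter_def reversepath_def fun_eq_iff smoothstep_reverse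
        complex_eq_iff cos_diff sin_diff algebra_simps)
  have im: "path_image ?l \<subseteq> ?S"
    by (rule path_image_avoids[OF C1_letter]) (auto simp: hits_letter)
  note l = C1_path_path[OF C1_letter[of "(x, 2)"]] im
  have v: "path_image (word_path v) \<subseteq> ?S" by (rule word_path_image[OF assms(2)])
  have "homotopic_paths ?S (?l +++ (reversepath ?l +++ word_path v)) ((?l +++ reversepath ?l) +++ word_path v)"
    using l v by (intro homotopic_paths_assoc) auto
  also have "homotopic_paths ?S ((?l +++ reversepath ?l) +++ word_path v) (linepath 0 0 +++ word_path v)"
    using l v homotopic_paths_rinv[of ?l ?S] by (intro homotopic_paths_join) auto
  also have "homotopic_paths ?S (linepath 0 0 +++ word_path v) (word_path v)"
    using homotopic_paths_lid[of "word_path v" ?S] v by simp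
  finally show "homotopic_paths ?S (word_path ((x, 2) # (inverse_letter x, 2) # v)) (word_path v)"
    by (simp add: rev)
qed

lemma empty_word_isotopic: "isotopic (word_knot []) unknot"
proof -
  let ?S = "- {1, -1 :: complex}"
  have "homotopic_paths ?S (word_loop []) (approach +++ reversepath approach)"
    unfolding word_loop_def word_path.simps zero_path
    using approach_image homotopic_paths_lid[of "reversepath approach" ?S]
    by (intro homotopic_paths_join) auto
  also have "homotopic_paths ?S (approach +++ reversepath approach) (linepath base base)"
    using homotopic_paths_rinv[of approach ?S] approach_image by simp
  finally have "isotopic (word_knot []) (braid_knot (linepath base base))"
    by (rule braid_knot_homotopic) (simp_all add: word_loop_def)
  moreover have "linepath base base = (\<lambda>t. base)" by (auto simp: linepath_def algebra_simps)
  ultimately show ?thesis using isotopic_trans braid_knot_const by simp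
qed

lemma unknot_emb: "unknot x = emb (unit x) 0"
  by (simp add: unknot_def vec_eq_iff forall_4 unit_def vector_4)

lemma tame_unknot: "tame_knot unknot"
proof -
  have S3: "range unknot \<subseteq> S3" by (auto simp: unknot_emb norm_emb)
  have d: "(unknot has_vector_derivative emb (of_real (2 * pi * 1) * \<i> * unit x) 0) (at x)" for x
    unfolding unknot_emb[abs_def]
    by (intro emb_has_vector_derivative unit_has_vector_derivative has_vector_derivative_const derivative_intros)
  have "continuous_on UNIV unknot"
    using d has_vector_derivative_continuous continuous_at_imp_continuous_on by metis
  then have emb: "embedded_circle unknot"
    unfolding embedded_circle_def using S3 by (simp add: unknot_emb unit_eq_iff)
  have "unknot C1_differentiable_on UNIV"
    unfolding C1_differentiable_on_def
    by (intro exI[of _ "\<lambda>x. emb (of_real (2 * pi * 1) * \<i> * unit x) 0"] conjI ballI d continuous_intros)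
  moreover have "emb (of_real (2 * pi * 1) * \<i> * unit x) 0 \<noteq> emb 0 0" for x by (simp only: emb_eq_iff) simp
  then have "vector_derivative unknot (at x) \<noteq> 0" for x
    using vector_derivative_at[OF d[of x]] by simp
  moreover have "unknot (x + 1) = unknot x" for x by (simp add: unknot_emb unit_eq_iff)
  ultimately have "immersed_circle unknot" unfolding immersed_circle_def using S3 by blast
  then show ?thesis
    unfolding tame_knot_def using emb isotopic_refl[OF S3] by blast
qed

section \<open>Finite-type invariants of the knots of words\<close>

text \<open>
  On words whose circles all have diameter 0, 1 or 2, a circle of diameter 1 marks a double point
  whose resolutions have diameter 2 and 0 there, and a circle of diameter 0 may be deleted. So the
  difference between a word with and without a letter is, up to sign, the value on the word with
  that letter marked, and the words with more than \<open>n\<close> marks have value 0.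
\<close>

lemma finite_type_flipping_word:
  fixes v :: "curve \<Rightarrow> 'a::ab_group_add"
  assumes inv: "knot_invariant v" and ft: "finite_type v"
  obtains m where "v (word_knot (on (flipping_word m))) = v unknot"
proof -
  obtain w n where w: "singular_extension v w"
    and n: "\<And>K. singular_knot K \<Longrightarrow> card (double_points K) > n \<Longrightarrow> w K = 0"
    using ft unfolding finite_type_def by blast
  define W where "W u = w (word_knot u)" for u
  \<comment> \<open>\<open>marks\<close> counts the circles of diameter 1, that is, the double points.\<close>
  define marks where "marks = length \<circ> filter (\<lambda>l :: letter \<times> real. snd l = 1)"
  define good where "good u \<longleftrightarrow> (\<forall>l\<in>set u. snd l \<in> {0, 1, 2})" for u :: "(letter \<times> real) list"
  have good_nn: "nonneg_word u" if "good u" for u using that by (auto simp: good_def)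
  have good_append [simp]: "good (u @ v) \<longleftrightarrow> good u \<and> good v" for u v by (auto simp: good_def)
  have good_Cons [simp]: "good (l # v) \<longleftrightarrow> snd l \<in> {0, 1, 2} \<and> good v" for l v by (auto simp: good_def)
  have good_Nil [simp]: "good []" by (simp add: good_def)
  have good_on [simp]: "good (on u)" for u by (auto simp: good_def)
  have good_off: "off_or_on u" if "good u" "marks u = 0" for u
    using that by (auto simp: good_def off_or_on_def marks_def filter_empty_conv)
  have marks_simps [simp]: "marks (u @ v) = marks u + marks v" "marks (l # v) = (if snd l = 1 then 1 else 0) + marks v"
    "marks (on x) = 0" "marks [] = 0" for u v l x
    by (auto simp: marks_def filter_empty_conv)
  have Wv: "W u = v (word_knot u)" if "off_or_on u" for u
  proof -
    have "nonneg_word u" using that by (auto simp: off_or_on_def)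
    then have "singular_knot (word_knot u)" by (rule word_knot_singular)
    then show ?thesis
      using w off_or_on_tame(2)[OF that] unfolding W_def singular_extension_def by blast
  qed
  have resolve: "W (u @ (x, 1) # t) = (if direction x = 1 then W (u @ (x, 2) # t) - W (u @ (x, 0) # t)
      else W (u @ (x, 0) # t) - W (u @ (x, 2) # t))" if "good u" "good t" for u t x
  proof -
    let ?K = "word_knot (u @ (x, 1) # t)"
    let ?c = "hit_pair (word_loop (u @ (x, 1) # t)) ((bump_time (length u) + 2) / 4)"
    have K: "singular_knot ?K" by (rule word_knot_singular) (use good_nn[OF that(1)] good_nn[OF that(2)] in auto)
    have c: "?c \<in> double_points ?K"
      using word_knot_resolution(2)[OF good_nn[OF that(1)] good_nn[OF that(2)], of 1] by simp
    have r: "resolution (direction x) ?K ?c (word_knot (u @ (x, 2) # t))" "resolution (- direction x) ?K ?c (word_knot (u @ (x, 0) # t))"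
      using word_knot_resolution(1)[OF good_nn[OF that(1)] good_nn[OF that(2)], of 1 x]
        word_knot_resolution(1)[OF good_nn[OF that(1)] good_nn[OF that(2)], of "-1" x] by simp_all
    have ext: "w ?K = w P - w N" if "positive_resolution ?K ?c P" "negative_resolution ?K ?c N" for P N
      using w K c that unfolding singular_extension_def by blast
    have "direction x = 1 \<or> direction x = -1" by (simp add: direction_def)
    then show ?thesis
      unfolding W_def using r ext by auto
  qed
  have iso: "v K = v L" if "tame_knot K" "tame_knot L" "isotopic K L" for K L
    using inv that unfolding knot_invariant_def by blast
  \<comment> \<open>For words with marks the statement is reduced to words with fewer marks by resolving one of
      them.\<close>
  have delete: "W (u @ (x, 0) # t) = W (u @ t)" if "good u" "good t" for u t x
    using that
  proof (induction "marks u + marks t" arbitrary: u t)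
    case 0
    then have o: "off_or_on u" "off_or_on t" using good_off by auto
    have "v (word_knot (u @ (x, 0) # t)) = v (word_knot (u @ t))"
      by (rule iso[OF off_or_on_tame(1) off_or_on_tame(1) letter_off_isotopic[OF o]]) (use o in simp_all)
    then show ?case using Wv[of "u @ (x, 0) # t"] Wv[of "u @ t"] o by simp
  next
    case (Suc m)
    show ?case
    proof (cases "marks u = 0")
      case False
      then have "\<exists>l\<in>set u. snd l = 1" by (auto simp: marks_def filter_empty_conv)
      then obtain u1 u2 y where u: "u = u1 @ (y, 1) # u2" by (metis in_set_conv_decomp prod.collapse)
      have IH: "W ((u1 @ (y, k) # u2) @ (x, 0) # t) = W ((u1 @ (y, k) # u2) @ t)" if "k = 0 \<or> k = 2" for k
        using Suc.hyps(2) Suc.prems that unfolding u by (intro Suc.hyps(1)) auto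
      have g: "good u1" "good (u2 @ (x, 0) # t)" "good (u2 @ t)" using Suc.prems u by auto
      show ?thesis
        using IH[of 0] IH[of 2] resolve[OF g(1,2), of y] resolve[OF g(1,3), of y] unfolding u by simp
    next
      case True
      then have "marks t \<noteq> 0" using Suc.hyps(2) by simp
      then have "\<exists>l\<in>set t. snd l = 1" by (auto simp: marks_def filter_empty_conv)
      then obtain u1 u2 y where t: "t = u1 @ (y, 1) # u2" by (metis in_set_conv_decomp prod.collapse)
      have IH: "W (u @ (x, 0) # (u1 @ (y, k) # u2)) = W (u @ (u1 @ (y, k) # u2))" if "k = 0 \<or> k = 2" for k
        using Suc.hyps(2) Suc.prems that unfolding t by (intro Suc.hyps(1)) auto
      have g: "good (u @ (x, 0) # u1)" "good (u @ u1)" "good u2" using Suc.prems t by auto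
      show ?thesis
        using IH[of 0] IH[of 2] resolve[OF g(1,3), of y] resolve[OF g(2,3), of y] unfolding t by simp
    qed
  qed
  \<comment> \<open>Each difference adds a mark, and words with \<open>n + 3\<close> marks have value 0. The
      number 3 is the depth of \<open>flipping_word 0\<close>.\<close>
  have pol: "pol_fun k (\<lambda>t. W (s @ on t))" if "good s" "marks s + k = n + 3" for k s
    using that
  proof (induction k arbitrary: s)
    case 0
    have "W (s @ on t) = 0" for t
    proof -
      have g: "nonneg_word (s @ on t)" using 0 good_nn by auto
      have "card (double_points (word_knot (s @ on t))) = marks (s @ on t)"
        unfolding word_knot_card[OF g] by (simp add: marks_def)
      then show ?thesis unfolding W_def using 0 by (intro n word_knot_singular[OF g]) simp
    qed
    then show ?case by simp
  next
    case (Suc k)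
    show ?case
      unfolding pol_fun.simps
    proof (intro allI)
      fix u x
      have IH: "pol_fun k (\<lambda>t. W ((s @ on u @ [(x, 1)]) @ on t))"
        using Suc.prems by (intro Suc.IH) auto
      have eq: "W (s @ on (u @ x # t)) - W (s @ on (u @ t)) =
          (if direction x = 1 then W ((s @ on u @ [(x, 1)]) @ on t) else - W ((s @ on u @ [(x, 1)]) @ on t))" for t
        using resolve[of "s @ on u" "on t" x] delete[of "s @ on u" "on t" x] Suc.prems by simp
      show "pol_fun k (\<lambda>t. W (s @ on (u @ x # t)) - W (s @ on (u @ t)))"
        unfolding eq using IH pol_fun_uminus[OF IH] by (cases "direction x = 1") simp_all
    qed
  qed
  define f where "f t = W (on t)" for t
  have "pol_fun (n + 3) f"
    using pol[of "[]" "n + 3"] by (simp add: f_def[abs_def] good_def)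
  moreover have "letters.reduced_fun f"
    unfolding letters.reduced_fun_def f_def
  proof (intro allI)
    fix u x t
    have "v (word_knot (on u @ (x, 2) # (inverse_letter x, 2) # on t)) = v (word_knot (on u @ on t))"
      by (rule iso[OF off_or_on_tame(1) off_or_on_tame(1) letter_inverse_isotopic]) simp_all
    then show "W (on (u @ x # inverse_letter x # t)) = W (on (u @ t))"
      using Wv[of "on (u @ x # inverse_letter x # t)"] Wv[of "on (u @ t)"] by simp
  qed
  ultimately have "f (flipping_word n) = f []"
    using letters.deep_eq[OF flipping_word_deep] by blast
  moreover have "v (word_knot []) = v unknot"
    by (rule iso[OF off_or_on_tame(1) tame_unknot empty_word_isotopic]) simp
  ultimately show thesis
    using that[of n] Wv[of "on (flipping_word n)"] Wv[of "[]"] by (simp add: f_def)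
qed

section \<open>Cubics without continuous roots\<close>

definition cubic :: "complex \<Rightarrow> complex \<Rightarrow> complex \<Rightarrow> complex poly" where
  "cubic a b c = [:c, b, a, 1:]"

lemma cubic_eval: "poly (cubic a b c) x = x ^ 3 + a * x\<^sup>2 + b * x + c"
  by (simp add: cubic_def algebra_simps power2_eq_square power3_eq_cube)

lemma cubic_family:
  assumes "continuous_on U a" "continuous_on U b" "continuous_on U c"
    and "\<And>u x. u \<in> U \<Longrightarrow> x ^ 3 + a u * x\<^sup>2 + b u * x + c u = 0 \<Longrightarrow> 3 * x\<^sup>2 + 2 * a u * x + b u = 0 \<Longrightarrow> False"
  shows "root_family U 3 (\<lambda>u. cubic (a u) (b u) (c u))"
proof -
  have "rsquarefree (cubic (a u) (b u) (c u))" if "u \<in> U" for u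
    unfolding rsquarefree_roots
  proof safe
    fix x assume x: "poly (cubic (a u) (b u) (c u)) x = 0" "poly (pderiv (cubic (a u) (b u) (c u))) x = 0"
    have "poly (pderiv (cubic (a u) (b u) (c u))) x = 3 * x\<^sup>2 + 2 * a u * x + b u"
      by (simp add: cubic_def pderiv_pCons algebra_simps power2_eq_square)
    then show False using assms(4)[OF that, of x] x by (simp add: cubic_eval)
  qed
  moreover have "lead_coeff (cubic a b c) = 1" "degree (cubic a b c) = 3" for a b c
    by (simp_all add: cubic_def)
  moreover have "continuous_on U (\<lambda>u. poly (cubic (a u) (b u) (c u)) X)" for X
    unfolding cubic_eval by (intro continuous_intros assms(1-3))
  ultimately show ?thesis
    unfolding root_family_def by blast
qed

lemma cubic_vandermonde:
  assumes "{x. poly (cubic a b c) x = 0} = {x0, x1, x2}" "x0 \<noteq> x1" "x1 \<noteq> x2" "x0 \<noteq> x2"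
  shows "((x0 - x1) * (x1 - x2) * (x2 - x0))\<^sup>2 = a\<^sup>2 * b\<^sup>2 - 4 * b ^ 3 - 4 * a ^ 3 * c - 27 * c\<^sup>2 + 18 * (a * b * c)"
proof -
  have r: "x0 ^ 3 + a * x0\<^sup>2 + b * x0 + c = 0" "x1 ^ 3 + a * x1\<^sup>2 + b * x1 + c = 0" "x2 ^ 3 + a * x2\<^sup>2 + b * x2 + c = 0"
    using assms(1) unfolding cubic_eval by blast+
  have "(x0 - x1) * (x0\<^sup>2 + x0 * x1 + x1\<^sup>2 + a * (x0 + x1) + b) = 0" using r(1,2) by algebra
  then have 1: "x0\<^sup>2 + x0 * x1 + x1\<^sup>2 + a * (x0 + x1) + b = 0" using assms(2) by simp
  have "(x0 - x2) * (x0\<^sup>2 + x0 * x2 + x2\<^sup>2 + a * (x0 + x2) + b) = 0" using r(1,3) by algebra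
  then have 2: "x0\<^sup>2 + x0 * x2 + x2\<^sup>2 + a * (x0 + x2) + b = 0" using assms(4) by simp
  have "(x1 - x2) * (x0 + x1 + x2 + a) = 0" using 1 2 by algebra
  then have "x0 + x1 + x2 + a = 0" using assms(3) by simp
  then have a: "a = - (x0 + x1 + x2)" by algebra
  have b: "b = x0 * x1 + x0 * x2 + x1 * x2" using 1 unfolding a by algebra
  have c: "c = - (x0 * x1 * x2)" using r(1) unfolding a b by algebra
  show ?thesis unfolding a b c by algebra
qed

text \<open>
  The curve \<open>X ^ 3 - z * X + d = 0\<close> is parametrized by \<open>X\<close>, with \<open>z
  = f X = X\<^sup>2 + d / X\<close>, so it remains connected after removing finitely many points.
  The image of a continuous choice of roots would be both open and closed in it, hence everything,
  although \<open>f\<close> is not injective.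
\<close>

lemma no_root_section:
  fixes r :: "complex \<Rightarrow> complex"
  assumes d: "d \<noteq> 0" and F: "finite F" and cont: "continuous_on (- F) r"
    and root: "\<And>\<zeta>. \<zeta> \<in> - F \<Longrightarrow> r \<zeta> ^ 3 - \<zeta> * r \<zeta> + d = 0"
    and two: "\<zeta>0 \<in> - F" "X \<noteq> Y" "X ^ 3 - \<zeta>0 * X + d = 0" "Y ^ 3 - \<zeta>0 * Y + d = 0"
  shows False
proof -
  define f where "f X = X\<^sup>2 + d / X" for X
  have f_eq: "f X = \<zeta> \<longleftrightarrow> X ^ 3 - \<zeta> * X + d = 0" if "X \<noteq> 0" for X \<zeta>
    using that by (simp add: f_def field_simps power2_eq_square power3_eq_cube)
  have nz: "X \<noteq> 0" if "X ^ 3 - \<zeta> * X + d = 0" for X \<zeta> using that d by auto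
  \<comment> \<open>The parameters of the points of the curve outside of F.\<close>
  define E where "E = - (insert 0 (\<Union>\<zeta>\<in>F. {X. poly (cubic 0 (- \<zeta>) d) X = 0}))"
  have "finite {X. poly (cubic 0 (- \<zeta>) d) X = 0}" for \<zeta>
    by (rule poly_roots_finite) (simp add: cubic_def)
  then have finE: "finite (- E)" using F by (simp add: E_def)
  have E: "X \<in> E \<longleftrightarrow> X \<noteq> 0 \<and> f X \<in> - F" for X
  proof (cases "X = 0")
    case False
    have "f X \<in> F \<longleftrightarrow> (\<exists>\<zeta>\<in>F. X ^ 3 - \<zeta> * X + d = 0)"
      using f_eq[OF False] by metis
    then show ?thesis using False by (simp add: E_def cubic_eval)
  qed (simp add: E_def)
  have openE: "open E" using finE by (metis finite_imp_closed open_closed)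
  have "connected (UNIV - (- E))"
    by (rule connected_open_delete_finite) (use finE in auto)
  then have conE: "connected E" by (simp add: Diff_eq)
  have fr: "f (r \<zeta>) = \<zeta>" "r \<zeta> \<in> E" if "\<zeta> \<in> - F" for \<zeta>
  proof -
    show "f (r \<zeta>) = \<zeta>" using f_eq[OF nz[OF root[OF that]]] root[OF that] by blast
    then show "r \<zeta> \<in> E" using E nz[OF root[OF that]] that by simp
  qed
  have "open (r ` (- F))"
  proof (rule invariance_of_domain[OF cont])
    show "open (- F)" using F finite_imp_closed by blast
    show "inj_on r (- F)" using fr(1) by (metis inj_onI)
  qed
  then have op: "openin (top_of_set E) (r ` (- F))"
    using fr(2) by (intro openin_open_eq[THEN iffD2, OF openE]) auto
  have contf: "continuous_on E f" unfolding f_def using E by (intro continuous_intros) auto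
  have "continuous_on E (\<lambda>X. r (f X) - X)"
    using E by (intro continuous_intros continuous_on_compose2[OF cont contf]) auto
  then have "closedin (top_of_set E) (E \<inter> (\<lambda>X. r (f X) - X) -` {0})"
    by (rule continuous_closedin_preimage) simp
  moreover have "E \<inter> (\<lambda>X. r (f X) - X) -` {0} = r ` (- F)"
  proof (intro equalityI subsetI)
    fix X assume X: "X \<in> E \<inter> (\<lambda>X. r (f X) - X) -` {0}"
    then have "f X \<in> - F" "X = r (f X)" using E by auto
    then show "X \<in> r ` (- F)" by (rule rev_image_eqI)
  next
    fix X assume "X \<in> r ` (- F)"
    then obtain \<zeta> where "\<zeta> \<in> - F" "X = r \<zeta>" by blast
    then show "X \<in> E \<inter> (\<lambda>X. r (f X) - X) -` {0}" using fr by simp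
  qed
  ultimately have "closedin (top_of_set E) (r ` (- F))" by simp
  then have "r ` (- F) = E"
    using conE op two(1) unfolding connected_clopen by blast
  moreover have fXY: "f X = \<zeta>0" "f Y = \<zeta>0"
    using f_eq[OF nz[OF two(3)]] f_eq[OF nz[OF two(4)]] two(3,4) by blast+
  moreover have "X \<in> E" "Y \<in> E" using E fXY nz[OF two(3)] nz[OF two(4)] two(1) by simp_all
  ultimately obtain x y where xy: "x \<in> - F" "X = r x" "y \<in> - F" "Y = r y" by blast
  then have "x = \<zeta>0" "y = \<zeta>0" using fr(1)[OF xy(1)] fr(1)[OF xy(3)] fXY by simp_all
  then show False using xy two(2) by simp
qed

text \<open>
  On a large circle \<open>4 * z ^ 3 - c\<close> makes three turns around the origin, and three is
  odd.
\<close>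

lemma no_discriminant_root:
  fixes v :: "complex \<Rightarrow> complex"
  assumes F: "finite F" and cont: "continuous_on (- F) v"
    and sq: "\<And>\<zeta>. \<zeta> \<in> - F \<Longrightarrow> (v \<zeta>)\<^sup>2 = 4 * \<zeta> ^ 3 - c"
  shows False
proof -
  have "bounded F" using F by (rule finite_imp_bounded)
  then obtain b where b: "\<And>z. z \<in> F \<Longrightarrow> cmod z \<le> b" by (auto simp: bounded_iff)
  \<comment> \<open>A circle around all of F on which the constant c is dominated by the cubic term.\<close>
  define R where "R = max 1 (max (b + 1) (cmod c))"
  have R: "R \<ge> 1" "R > b" "R \<ge> cmod c" by (auto simp: R_def)
  have "R * 1 \<le> R * R\<^sup>2" using R(1) by (intro mult_left_mono) auto
  then have "R \<le> R ^ 3" by (simp add: power3_eq_cube power2_eq_square)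
  then have cR: "cmod c < 4 * R ^ 3" using R by linarith
  define \<zeta> where "\<zeta> t = of_real R * cis t" for t
  have \<zeta>F: "\<zeta> t \<in> - F" for t
  proof -
    have "cmod (\<zeta> t) = R" using R by (simp add: \<zeta>_def norm_mult)
    then show ?thesis using b[of "\<zeta> t"] R(2) by auto
  qed
  define e where "e t = 1 - c / (4 * of_real (R ^ 3)) * cis (- (3 * t))" for t
  have e: "Re (e t) > 0" for t
  proof -
    define y where "y = c / (4 * of_real (R ^ 3)) * cis (- (3 * t))"
    have "cmod y < 1"
      unfolding y_def using cR R(1) by (simp add: norm_mult norm_divide norm_power divide_less_eq)
    then have "Re y < 1"
      using abs_Re_le_cmod[of y] by linarith
    then show ?thesis by (simp only: e_def y_def minus_complex.sel one_complex.sel)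
  qed
  \<comment> \<open>On the circle \<open>4 * \<zeta> t ^ 3 - c\<close> is the square of the denominator, which
      changes its sign in one turn, so the quotient takes the values \<open>1\<close> and
      \<open>-1\<close> and is constant, a contradiction.\<close>
  define q where "q t = v (\<zeta> t) / (2 * of_real (sqrt (R ^ 3)) * exp (\<i> * of_real (3 * t / 2)) * csqrt (e t))" for t
  have e0: "e t \<noteq> 0" for t using e[of t] by auto
  have "(q t)\<^sup>2 = 1" for t
  proof -
    have ex: "(exp (\<i> * of_real (3 * t / 2)))\<^sup>2 = cis (3 * t)"
      by (simp add: cis_conv_exp power2_eq_square mult_ac flip: exp_add)
    have sR: "(of_real (sqrt (R ^ 3)) :: complex)\<^sup>2 = of_real (R ^ 3)"
      using R(1) by (simp flip: of_real_power)
    have "(v (\<zeta> t))\<^sup>2 = 4 * (\<zeta> t) ^ 3 - c" by (rule sq[OF \<zeta>F])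
    also have "(\<zeta> t) ^ 3 = of_real (R ^ 3) * cis (3 * t)"
      by (simp add: \<zeta>_def power_mult_distrib Complex.DeMoivre)
    also have "4 * (of_real (R ^ 3) * cis (3 * t)) - c = 4 * of_real (R ^ 3) * cis (3 * t) * e t"
    proof -
      have "cis (3 * t) * cis (- (3 * t)) = 1" by (simp add: cis_mult)
      moreover have "(of_real (R ^ 3) :: complex) \<noteq> 0" using R(1) by simp
      ultimately show ?thesis by (simp add: e_def field_simps)
    qed
    also have "\<dots> = (2 * of_real (sqrt (R ^ 3)) * exp (\<i> * of_real (3 * t / 2)) * csqrt (e t))\<^sup>2"
      unfolding power_mult_distrib ex sR by simp
    finally have "(v (\<zeta> t))\<^sup>2 = (2 * of_real (sqrt (R ^ 3)) * exp (\<i> * of_real (3 * t / 2)) * csqrt (e t))\<^sup>2" .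
    moreover have "2 * of_real (sqrt (R ^ 3)) * exp (\<i> * of_real (3 * t / 2)) * csqrt (e t) \<noteq> 0"
      using R(1) e0[of t] by simp
    ultimately show ?thesis unfolding q_def power_divide by simp
  qed
  then have q1: "q t = 1 \<or> q t = -1" for t by (simp add: power2_eq_1_iff)
  have "continuous_on {0..2*pi} q"
  proof -
    have "continuous_on {0..2*pi} (\<lambda>t. v (\<zeta> t))"
      by (rule continuous_on_compose2[OF cont]) (use \<zeta>F in \<open>auto simp: \<zeta>_def[abs_def] cis_conv_exp intro!: continuous_intros\<close>)
    moreover have "continuous_on {0..2*pi} (\<lambda>t. csqrt (e t))"
    proof (rule continuous_on_csqrt_comp)
      show "continuous_on {0..2*pi} e" unfolding e_def[abs_def] cis_conv_exp by (intro continuous_intros)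
      show "e t \<notin> \<real>\<^sub>\<le>\<^sub>0" for t using e[of t] by (auto simp: complex_nonpos_Reals_iff)
    qed
    ultimately show ?thesis
      unfolding q_def[abs_def] using R(1) e0 by (intro continuous_intros) auto
  qed
  moreover have "finite (q ` {0..2*pi})"
    by (rule finite_subset[of _ "{1, -1}"]) (use q1 in auto)
  ultimately have "q constant_on {0..2*pi}"
    by (intro continuous_finite_range_constant) auto
  then have "q (2*pi) = q 0" unfolding constant_on_def by force
  moreover have "q (2*pi) = - q 0"
  proof -
    have "\<zeta> (2*pi) = \<zeta> 0" by (simp add: \<zeta>_def)
    moreover have "cis (- (3 * (2 * pi))) = 1" using cis_power_int[of "2*pi" "-3"] by simp
    then have "e (2*pi) = e 0" by (simp add: e_def)
    moreover have "exp (\<i> * of_real (3 * (2 * pi) / 2)) = -1"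
    proof -
      have "\<i> * of_real (3 * (2 * pi) / 2) = \<i> * of_real pi + 2 * of_real pi * \<i>" by (simp add: algebra_simps)
      then show ?thesis by (simp only: exp_add exp_two_pi_i exp_pi_i' mult_1_right)
    qed
    ultimately show ?thesis by (simp add: q_def)
  qed
  ultimately show False using q1[of 0] by auto
qed

section \<open>The cubic of a square root of a root of the quartic\<close>

definition omega :: complex where "omega = unit (1/3)"
text \<open>
  For nonzero \<open>\<delta>\<close> the cubic \<open>X ^ 3 + \<alpha> * X\<^sup>2 - (z - \<beta>)
  * X + \<delta>\<close> has a double root at \<open>X\<close> iff \<open>X\<close> is a critical
  point of the rational function \<open>X\<^sup>2 + \<alpha> * X + \<beta> + \<delta> / X\<close>,
  with critical value \<open>z\<close>. Prescribing the positions \<open>1\<close>,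
  \<open>omega\<close>, \<open>omega\<^sup>2 * strand k\<close> of the three strands as critical
  values is a system of equations for the critical points, which is solved by \<open>crit0\<close>,
  \<open>crit1\<close>, \<open>crit2\<close> in terms of a square root \<open>s\<close> of a root of
  the quartic; \<open>coefA\<close>, \<open>coefB\<close>, \<open>coefC\<close> are the
  corresponding \<open>\<alpha>\<close>, \<open>\<beta>\<close>, \<open>\<delta>\<close>.
\<close>

definition crit_scale :: complex where "crit_scale = csqrt ((1 - omega) / 108)"

lemma omega_facts: "omega\<^sup>2 + omega + 1 = 0" "omega \<noteq> 1" "omega - omega\<^sup>2 = \<i> * of_real (sqrt 3)" "unit (2/3) = omega\<^sup>2"
proof -
  have "omega\<^sup>2 = unit (2/3)" by (simp add: omega_def power2_eq_square flip: unit_add)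
  then show "omega\<^sup>2 + omega + 1 = 0" "omega \<noteq> 1" "omega - omega\<^sup>2 = \<i> * of_real (sqrt 3)" "unit (2/3) = omega\<^sup>2"
    by (simp_all add: omega_def unit_thirds complex_eq_iff)
qed

lemma crit_scale_sq: "108 * crit_scale\<^sup>2 = 1 - omega" by (simp add: crit_scale_def)

definition crit0 :: "complex \<Rightarrow> complex" where "crit0 s = - crit_scale * s * (3 - s\<^sup>2)"
definition crit1 :: "complex \<Rightarrow> complex" where "crit1 s = crit_scale * s * (3 + s\<^sup>2)"
definition crit2 :: "complex \<Rightarrow> complex" where "crit2 s = crit_scale * (9 - s ^ 4) / (2 * s)"
definition coefA :: "complex \<Rightarrow> complex" where "coefA s = - 2 * (crit0 s + crit1 s + crit2 s)"
definition coefC :: "complex \<Rightarrow> complex" where "coefC s = 2 * crit0 s * crit1 s * crit2 s"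
definition coefB :: "complex \<Rightarrow> complex" where "coefB s = 1 - 3 * (crit0 s)\<^sup>2 - 2 * coefA s * crit0 s"

lemma strand_omega: "2 * strand k = - 1 - (omega - omega\<^sup>2) * k"
  unfolding omega_facts(3) by (simp add: strand_def algebra_simps)

text \<open>
  The third critical value depends on \<open>k\<close>, which is eliminated by means of the quartic;
  the other two are fixed by the choice of \<open>crit_scale\<close> and \<open>coefB\<close>.
\<close>

lemma critical_values:
  assumes s: "s \<noteq> 0" "poly (quartic k) (s\<^sup>2) = 0"
  shows "3 * (crit0 s)\<^sup>2 + 2 * coefA s * crit0 s + coefB s = 1"
    "3 * (crit1 s)\<^sup>2 + 2 * coefA s * crit1 s + coefB s = omega"
    "3 * (crit2 s)\<^sup>2 + 2 * coefA s * crit2 s + coefB s = omega\<^sup>2 * strand k"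
    "crit0 s * crit1 s + crit0 s * crit2 s + crit1 s * crit2 s = 0"
proof -
  define c2 where "c2 = crit2 s"
  have c2: "2 * s * c2 = crit_scale * (9 - s ^ 4)" using s(1) by (simp add: c2_def crit2_def)
  have q: "s ^ 8 - 6 * s ^ 4 + 8 * k * s\<^sup>2 - 3 = 0" using s(2) by (simp add: quartic_eval flip: power_mult)
  show 1: "3 * (crit0 s)\<^sup>2 + 2 * coefA s * crit0 s + coefB s = 1" by (simp add: coefB_def)
  have "s * (crit0 s * crit1 s + crit0 s * c2 + crit1 s * c2) = 0"
    unfolding crit0_def crit1_def using c2 by algebra
  then show 0: "crit0 s * crit1 s + crit0 s * crit2 s + crit1 s * crit2 s = 0"
    using s(1) by (simp add: c2_def)
  have "s * (3 * (crit1 s)\<^sup>2 + 2 * coefA s * crit1 s - (3 * (crit0 s)\<^sup>2 + 2 * coefA s * crit0 s)) = s * (- 108 * crit_scale\<^sup>2)"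
    unfolding coefA_def c2_def[symmetric] crit0_def crit1_def using c2 by algebra
  then have d1: "3 * (crit1 s)\<^sup>2 + 2 * coefA s * crit1 s - (3 * (crit0 s)\<^sup>2 + 2 * coefA s * crit0 s) = - 108 * crit_scale\<^sup>2"
    by (simp only: mult_left_cancel[OF s(1)])
  then show "3 * (crit1 s)\<^sup>2 + 2 * coefA s * crit1 s + coefB s = omega"
    using 1 crit_scale_sq by algebra
  have "(2 * s)\<^sup>2 * (3 * c2\<^sup>2 + 2 * coefA s * c2 - (3 * (crit0 s)\<^sup>2 + 2 * coefA s * crit0 s)) = (2 * s)\<^sup>2 * (- 54 * crit_scale\<^sup>2 * (1 + k))"
  proof -
    have "(2 * s)\<^sup>2 * (3 * c2\<^sup>2 + 2 * coefA s * c2 - (3 * (crit0 s)\<^sup>2 + 2 * coefA s * crit0 s))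
      = 3 * (2 * s * c2)\<^sup>2 + 2 * (2 * s * coefA s) * (2 * s * c2) - (3 * (2 * s * crit0 s)\<^sup>2 + 2 * (2 * s * coefA s) * (2 * s * crit0 s))"
      by algebra
    also have "2 * s * coefA s = - 2 * (2 * s * crit0 s + 2 * s * crit1 s + 2 * s * c2)"
      by (simp add: coefA_def c2_def algebra_simps)
    finally show ?thesis unfolding c2 crit0_def crit1_def using q by algebra
  qed
  moreover have "(2 * s)\<^sup>2 \<noteq> 0" using s(1) by simp
  ultimately have "3 * c2\<^sup>2 + 2 * coefA s * c2 - (3 * (crit0 s)\<^sup>2 + 2 * coefA s * crit0 s) = - 54 * crit_scale\<^sup>2 * (1 + k)"
    using mult_left_cancel by blast
  then show "3 * (crit2 s)\<^sup>2 + 2 * coefA s * crit2 s + coefB s = omega\<^sup>2 * strand k"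
    unfolding c2_def using 1 crit_scale_sq strand_omega[of k] omega_facts(1) by algebra
qed

lemma cubic_double_root:
  assumes s: "s \<noteq> 0" "poly (quartic k) (s\<^sup>2) = 0"
    and x: "x ^ 3 + coefA s * x\<^sup>2 - (z - coefB s) * x + coefC s = 0" "3 * x\<^sup>2 + 2 * coefA s * x - (z - coefB s) = 0"
  shows "z = 1 \<or> z = omega \<or> z = omega\<^sup>2 * strand k"
proof -
  note cv = critical_values[OF s]
  \<comment> \<open>The critical points are the roots of \<open>2 * X ^ 3 + \<alpha> * X\<^sup>2 -
      \<delta>\<close>.\<close>
  have "2 * ((x - crit0 s) * (x - crit1 s) * (x - crit2 s)) = 2 * x ^ 3 + coefA s * x\<^sup>2 - coefC s"
    unfolding coefA_def coefC_def using cv(4) by algebra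
  also have "\<dots> = 0" using x by algebra
  finally have "x = crit0 s \<or> x = crit1 s \<or> x = crit2 s" by auto
  moreover have "z = 3 * x\<^sup>2 + 2 * coefA s * x + coefB s" using x(2) by algebra
  ultimately show ?thesis using cv(1-3) by auto
qed

text \<open>
  Replacing \<open>s\<close> by \<open>-s\<close> amounts to replacing \<open>X\<close> by
  \<open>-X\<close>.
\<close>

lemma coef_uminus: "coefA (- s) = - coefA s" "coefB (- s) = coefB s" "coefC (- s) = - coefC s"
proof -
  have c: "crit0 (- s) = - crit0 s" "crit1 (- s) = - crit1 s" "crit2 (- s) = - crit2 s"
    by (simp_all add: crit0_def crit1_def crit2_def)
  show a: "coefA (- s) = - coefA s" "coefC (- s) = - coefC s"
    unfolding coefA_def coefC_def c by (simp_all add: algebra_simps)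
  show "coefB (- s) = coefB s" unfolding coefB_def c a by simp
qed

lemma coef_base: "coefA spin_base = 0" "coefB spin_base = 0" "coefC spin_base \<noteq> 0"
proof -
  let ?s = spin_base and ?c = "of_real (sqrt 3) :: complex"
  have s2: "?s\<^sup>2 = \<i> * ?c"
    by (simp add: spin_base_def power_mult_distrib Complex.DeMoivre flip: of_real_power)
  have c2: "?c\<^sup>2 = 3" by (simp flip: of_real_power)
  have s4: "?s ^ 4 = - 3"
  proof -
    have "?s ^ 4 = (?s\<^sup>2)\<^sup>2" by simp
    then show ?thesis unfolding s2 by (simp add: power_mult_distrib c2)
  qed
  have s0: "?s \<noteq> 0" using s4 by auto
  have sc: "crit_scale \<noteq> 0" using crit_scale_sq omega_facts(2) by auto
  have cr2: "crit2 ?s = - 2 * \<i> * ?c * crit_scale * ?s"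
  proof -
    have "2 * ?s * crit2 ?s = 12 * crit_scale" using s0 by (simp add: crit2_def s4)
    moreover have "2 * ?s * (- 2 * \<i> * ?c * crit_scale * ?s) = - 4 * \<i> * ?c * crit_scale * ?s\<^sup>2" by (simp add: power2_eq_square)
    then have "2 * ?s * (- 2 * \<i> * ?c * crit_scale * ?s) = 12 * crit_scale"
    proof -
      have "- 4 * \<i> * ?c * crit_scale * (\<i> * ?c) = - 4 * (\<i> * \<i>) * ?c\<^sup>2 * crit_scale"
        by (simp only: power2_eq_square mult_ac)
      also have "\<dots> = 12 * crit_scale" unfolding c2 by simp
      finally show "2 * ?s * (- 2 * \<i> * ?c * crit_scale * ?s) = 12 * crit_scale"
        using \<open>2 * ?s * (- 2 * \<i> * ?c * crit_scale * ?s) = - 4 * \<i> * ?c * crit_scale * ?s\<^sup>2\<close> unfolding s2 by (simp only:)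
    qed
    ultimately have "2 * ?s * crit2 ?s = 2 * ?s * (- 2 * \<i> * ?c * crit_scale * ?s)" by (simp only:)
    moreover have "2 * ?s \<noteq> 0" using s0 by simp
    ultimately show ?thesis by (simp only: mult_cancel_left simp_thms)
  qed
  show A: "coefA ?s = 0"
    unfolding coefA_def cr2 crit0_def crit1_def s2 by (simp add: algebra_simps)
  have "(crit0 ?s)\<^sup>2 = crit_scale\<^sup>2 * ?s\<^sup>2 * (3 - ?s\<^sup>2)\<^sup>2" by (simp add: crit0_def power_mult_distrib)
  also have "\<dots> = crit_scale\<^sup>2 * (\<i> * ?c * (3 - \<i> * ?c)\<^sup>2)" by (simp only: s2 mult.assoc)
  also have "\<i> * ?c * (3 - \<i> * ?c)\<^sup>2 = 6 * (3 + \<i> * ?c)"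
  proof -
    have j: "x * (3 - x)\<^sup>2 = 6 * (3 + x)" if "x\<^sup>2 = -3" for x :: complex
      using that by algebra
    show ?thesis by (rule j) (simp add: power_mult_distrib c2)
  qed
  finally have "108 * (crit0 ?s)\<^sup>2 = 6 * ((108 * crit_scale\<^sup>2) * (3 + \<i> * ?c))" by simp
  also have "\<dots> = 6 * ((1 - omega) * (3 + (omega - omega\<^sup>2)))" unfolding crit_scale_sq omega_facts(3) ..
  also have "\<dots> = 36" using omega_facts(1) by algebra
  finally have "3 * (crit0 ?s)\<^sup>2 = 1" by simp
  then show "coefB ?s = 0" by (simp add: coefB_def A)
  have "3 - \<i> * ?c \<noteq> 0" "3 + \<i> * ?c \<noteq> 0" by (auto simp: complex_eq_iff)
  then show "coefC ?s \<noteq> 0"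
    unfolding coefC_def cr2 crit0_def crit1_def s2 using s0 sc by simp
qed

section \<open>Cubics over the complement of a closed braid\<close>

text \<open>
  A function of the angle, multiplied by a function of the radius that vanishes at the origin, is
  continuous there.
\<close>

lemma cone_continuous:
  fixes f :: "real \<Rightarrow> complex"
  assumes f: "continuous_on {0..1} f" "f 0 = f 1" and \<phi>: "continuous_on UNIV \<phi>" "\<phi> 0 = 0"
  shows "continuous_on UNIV (\<lambda>w. of_real (\<phi> (cmod w)) * f (turn w))"
proof -
  let ?h = "\<lambda>w. of_real (\<phi> (cmod w)) * f (turn w)"
  have "continuous_on ({0..1} \<times> (UNIV :: real set)) (\<lambda>(t, y). f t)"
    unfolding case_prod_beta by (rule continuous_on_compose2[OF f(1)]) (auto intro!: continuous_intros)
  from circle_function_continuous[OF this] f(2)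
  have c: "continuous_on ((- {0}) \<times> (UNIV :: real set)) (\<lambda>(w, y). f (turn w))" by simp
  have "continuous_on (- {0}) ((\<lambda>(w, y). f (turn w)) \<circ> (\<lambda>w. (w, 0 :: real)))"
    by (intro continuous_on_compose continuous_intros continuous_on_subset[OF c]) auto
  then have c1: "continuous_on (- {0}) (\<lambda>w. f (turn w))" by (simp add: o_def)
  have c\<phi>: "continuous_on A (\<lambda>w::complex. \<phi> (cmod w))" for A
    by (rule continuous_on_compose2[OF \<phi>(1)]) (auto intro!: continuous_intros)
  have "bounded (f ` {0..1})"
    using compact_continuous_image[OF f(1)] compact_imp_bounded by blast
  then obtain B where B: "\<And>t. t \<in> {0..1} \<Longrightarrow> norm (f t) \<le> B" unfolding bounded_iff by blast
  have "isCont ?h w" for w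
  proof (cases "w = 0")
    case False
    have "continuous_on (- {0}) ?h" by (intro continuous_intros c\<phi> c1)
    then show ?thesis using False continuous_on_eq_continuous_at[of "- {0}" ?h] by (simp add: open_Compl)
  next
    case True
    have "norm (?h y) \<le> \<bar>\<phi> (cmod y)\<bar> * B" for y
      unfolding norm_mult norm_of_real using turn_range[of y] by (intro mult_left_mono B) auto
    moreover have "continuous_on UNIV (\<lambda>y::complex. \<bar>\<phi> (cmod y)\<bar> * B)" by (intro continuous_intros c\<phi>)
    then have "isCont (\<lambda>y::complex. \<bar>\<phi> (cmod y)\<bar> * B) 0" using continuous_on_eq_continuous_at[OF open_UNIV] by blast
    then have "((\<lambda>y::complex. \<bar>\<phi> (cmod y)\<bar> * B) \<longlongrightarrow> 0) (at 0)" using \<phi>(2) by (simp add: isCont_def)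
    ultimately have "(?h \<longlongrightarrow> 0) (at 0)" by (intro Lim_null_comparison[of ?h]) auto
    then show ?thesis using True \<phi>(2) by (simp add: isCont_def)
  qed
  then show ?thesis by (simp add: continuous_at_imp_continuous_on)
qed

lemma braid_knot_mem:
  assumes w: "sndc p \<noteq> 0" "p \<in> S3"
    and z: "fstc p = of_real (cmod (sndc p)) * unit (turn (sndc p) / 3) * y"
    and y: "y = 1 \<or> y = omega \<or> y = omega\<^sup>2 * strand (g (turn (sndc p)))" and g0: "g 0 = base"
  shows "p \<in> range (braid_knot g)"
proof -
  let ?\<theta> = "turn (sndc p)" and ?r = "cmod (sndc p)"
  have \<theta>: "0 \<le> ?\<theta>" "?\<theta> < 1" by (rule turn_range)+
  have snd: "sndc p = of_real ?r * unit ?\<theta>" using unit_turn[OF w(1)] w(1) by (simp add: field_simps)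
  have mem: "p \<in> range (braid_knot g)" if x: "braid_knot g x = proj (emb (unit (?\<theta> / 3) * y) (unit ?\<theta>))" for x
  proof -
    have "p = emb (of_real ?r * (unit (?\<theta> / 3) * y)) (of_real ?r * unit ?\<theta>)"
      using snd z emb_fstc_sndc[of p] by (metis mult.assoc)
    then have "p = ?r *\<^sub>R emb (unit (?\<theta> / 3) * y) (unit ?\<theta>)"
      by (simp only: emb_scaleR) (simp only: scaleR_conv_of_real)
    then have "proj p = braid_knot g x" using x proj_scale w(1) by (metis zero_less_norm_iff)
    then show ?thesis using proj_S3[OF w(2)] by (metis rangeI)
  qed
  have int: "unit (?\<theta> + 1) = unit ?\<theta>" "unit (?\<theta> + 2) = unit ?\<theta>" by (simp_all add: unit_eq_iff)
  from y show ?thesis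
  proof (elim disjE)
    assume "y = 1"
    have "frac (?\<theta> / 3) = ?\<theta> / 3" using \<theta> by (simp add: frac_eq)
    then have "braid_knot g (?\<theta> / 3) = proj (emb (unit (?\<theta> / 3) * y) (unit ?\<theta>))"
      using \<theta> \<open>y = 1\<close> g0 by (simp add: braid_knot_def strand_values)
    then show ?thesis by (rule mem)
  next
    assume y: "y = omega"
    have "frac (?\<theta> / 3 + 1/3) = ?\<theta> / 3 + 1/3" using \<theta> by (simp add: frac_eq)
    then have "braid_knot g (?\<theta> / 3 + 1/3) = proj (emb (unit (?\<theta> / 3 + 1/3)) (unit (?\<theta> + 1)))"
      using \<theta> g0 by (simp add: braid_knot_def strand_values algebra_simps)
    then have "braid_knot g (?\<theta> / 3 + 1/3) = proj (emb (unit (?\<theta> / 3) * y) (unit ?\<theta>))"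
      unfolding int unit_add[of "?\<theta> / 3"] y omega_def .
    then show ?thesis by (rule mem)
  next
    assume y: "y = omega\<^sup>2 * strand (g ?\<theta>)"
    have f: "frac (?\<theta> / 3 + 2/3) = ?\<theta> / 3 + 2/3" using \<theta> by (simp add: frac_eq)
    have "3 * (?\<theta> / 3 + 2/3) - 2 = ?\<theta>" "3 * (?\<theta> / 3 + 2/3) = ?\<theta> + 2" by (simp_all add: field_simps)
    then have "braid_knot g (?\<theta> / 3 + 2/3) = proj (emb (unit (?\<theta> / 3 + 2/3) * strand (g ?\<theta>)) (unit (?\<theta> + 2)))"
      unfolding braid_knot_def f using \<theta> by (simp add: max_def)
    then have "braid_knot g (?\<theta> / 3 + 2/3) = proj (emb (unit (?\<theta> / 3) * y) (unit ?\<theta>))"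
      unfolding int unit_add[of "?\<theta> / 3"] y omega_facts(4) by (simp add: mult.assoc)
    then show ?thesis by (rule mem)
  qed
qed

text \<open>
  Over the point with second coordinate \<open>w\<close> the cubic is the one of the square root
  \<open>s t\<close> at the angle \<open>t\<close> of \<open>w\<close>, with its roots multiplied by
  \<open>sqrt (cmod w) * unit (t / 6)\<close>; correspondingly \<open>z\<close> is multiplied by
  \<open>cmod w * unit (t / 3)\<close>, the scale and the rotation of the braid. After one turn the
  factor \<open>unit (t / 6)\<close> is a sixth root of unity whose cube is \<open>-1\<close>, which
  is compensated by the change of sign of \<open>s\<close>.
\<close>

lemma braid_knot_cubic_family:
  assumes g: "g 0 = base" and s: "continuous_on {0..1} s" "s 0 = spin_base" "s 1 = - spin_base"
    and lift: "\<And>t. t \<in> {0..1} \<Longrightarrow> poly (quartic (g t)) ((s t)\<^sup>2) = 0"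
  obtains A B C where "root_family (S3 - range (braid_knot g)) 3 (\<lambda>p. cubic (A p) (B p) (C p))"
    "\<And>p. sndc p = of_real (cmod (sndc p)) \<Longrightarrow> A p = 0 \<and> B p = - fstc p \<and> C p = of_real (sqrt (cmod (sndc p)) ^ 3) * coefC spin_base"
proof -
  have s0: "s t \<noteq> 0" if "t \<in> {0..1}" for t using quartic_nonzero[OF lift[OF that]] by auto
  define a where "a t = coefA (s t) * unit (t / 6)" for t
  define b where "b t = coefB (s t) * unit (t / 3)" for t
  define d where "d t = coefC (s t) * unit (t / 2)" for t
  have "unit (1/2) = -1" by (simp add: unit_def)
  then have ends: "a 0 = 0" "a 1 = 0" "b 0 = 0" "b 1 = 0" "d 0 = coefC spin_base" "d 1 = coefC spin_base"
    by (simp_all add: a_def b_def d_def s(2,3) coef_base coef_uminus)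
  have "continuous_on {0..1} (\<lambda>t. crit0 (s t))" "continuous_on {0..1} (\<lambda>t. crit1 (s t))" "continuous_on {0..1} (\<lambda>t. crit2 (s t))"
    unfolding crit0_def crit1_def crit2_def using s0 by (auto intro!: continuous_intros s(1))
  then have cont: "continuous_on {0..1} a" "continuous_on {0..1} b" "continuous_on {0..1} d"
    unfolding a_def b_def d_def coefA_def coefB_def coefC_def by (auto intro!: continuous_intros)
  let ?r = "\<lambda>p. cmod (sndc p)"
  define A where "A p = of_real (sqrt (?r p)) * a (turn (sndc p))" for p
  define B where "B p = of_real (?r p) * b (turn (sndc p)) - fstc p" for p
  define C where "C p = of_real (sqrt (?r p) ^ 3) * d (turn (sndc p))" for p
  have sndc: "continuous_on X sndc" for X by (intro continuous_intros)
  have comp: "continuous_on X (\<lambda>p. h (sndc p))" if "continuous_on UNIV h" for h :: "complex \<Rightarrow> complex" and X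
    by (rule continuous_on_compose2[OF that sndc]) auto
  have cA: "continuous_on X A" for X
    unfolding A_def[abs_def]
    by (rule comp, rule cone_continuous[of a sqrt]) (use cont ends in \<open>auto intro!: continuous_intros\<close>)
  have cB: "continuous_on X B" for X
    unfolding B_def[abs_def]
    by (rule continuous_on_diff, rule comp, rule cone_continuous[of b "\<lambda>x. x"]) (use cont ends in \<open>auto intro!: continuous_intros\<close>)
  have cC: "continuous_on X C" for X
    unfolding C_def[abs_def]
    by (rule comp, rule cone_continuous[of d "\<lambda>x. sqrt x ^ 3"]) (use cont ends in \<open>auto intro!: continuous_intros\<close>)
  show thesis
  proof (rule that)
    show "root_family (S3 - range (braid_knot g)) 3 (\<lambda>p. cubic (A p) (B p) (C p))"
    proof (rule cubic_family[OF cA cB cC])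
      fix p x assume p: "p \<in> S3 - range (braid_knot g)"
        and x: "x ^ 3 + A p * x\<^sup>2 + B p * x + C p = 0" "3 * x\<^sup>2 + 2 * A p * x + B p = 0"
      show False
      proof (cases "sndc p = 0")
        case True
        then have "x ^ 3 - fstc p * x = 0" "3 * x\<^sup>2 - fstc p = 0" using x by (simp_all add: A_def B_def C_def)
        then have "2 * x ^ 3 = 0" by algebra
        then have "fstc p = 0" using \<open>3 * x\<^sup>2 - fstc p = 0\<close> by simp
        then have "p = 0" using True emb_fstc_sndc[of p] by simp
        then show False using p by simp
      next
        case False
        let ?\<theta> = "turn (sndc p)"
        have \<theta>: "?\<theta> \<in> {0..1}" using turn_range[of "sndc p"] by simp
        define \<rho> where "\<rho> = (of_real (sqrt (?r p)) :: complex)"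
        define \<epsilon> where "\<epsilon> = unit (?\<theta> / 6)"
        have \<rho>0: "\<rho> \<noteq> 0" using False by (simp add: \<rho>_def)
        have \<epsilon>0: "\<epsilon> \<noteq> 0" by (simp add: \<epsilon>_def)
        have \<rho>2: "of_real (?r p) = \<rho>\<^sup>2" by (simp add: \<rho>_def flip: of_real_power)
        have \<epsilon>2: "unit (?\<theta> / 3) = \<epsilon>\<^sup>2" "unit (?\<theta> / 2) = \<epsilon> ^ 3"
          by (simp_all add: \<epsilon>_def unit_power)
        \<comment> \<open>The position and the root in the frame of the braid, without the scale and the rotation.\<close>
        define y where "y = fstc p / (\<epsilon>\<^sup>2 * \<rho>\<^sup>2)"
        define X where "X = x / (\<epsilon> * \<rho>)"
        have xX: "x = \<epsilon> * \<rho> * X" using \<rho>0 \<epsilon>0 by (simp add: X_def)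
        have zy: "fstc p = \<epsilon>\<^sup>2 * \<rho>\<^sup>2 * y" using \<rho>0 \<epsilon>0 by (simp add: y_def)
        have Ap: "A p = \<rho> * (coefA (s ?\<theta>) * \<epsilon>)" by (simp add: A_def a_def \<rho>_def \<epsilon>_def)
        have Bp: "B p = \<rho>\<^sup>2 * (coefB (s ?\<theta>) * \<epsilon>\<^sup>2) - \<epsilon>\<^sup>2 * \<rho>\<^sup>2 * y"
          unfolding B_def b_def \<rho>2 \<epsilon>2 zy ..
        have Cp: "C p = \<rho> ^ 3 * (coefC (s ?\<theta>) * \<epsilon> ^ 3)"
          unfolding C_def d_def \<epsilon>2 by (simp add: \<rho>_def)
        have "(\<epsilon> * \<rho>) ^ 3 * (X ^ 3 + coefA (s ?\<theta>) * X\<^sup>2 - (y - coefB (s ?\<theta>)) * X + coefC (s ?\<theta>)) = 0"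
          using x(1) unfolding Ap Bp Cp xX by algebra
        then have r1: "X ^ 3 + coefA (s ?\<theta>) * X\<^sup>2 - (y - coefB (s ?\<theta>)) * X + coefC (s ?\<theta>) = 0"
          using \<rho>0 \<epsilon>0 by simp
        have "(\<epsilon> * \<rho>)\<^sup>2 * (3 * X\<^sup>2 + 2 * coefA (s ?\<theta>) * X - (y - coefB (s ?\<theta>))) = 0"
          using x(2) unfolding Ap Bp Cp xX by algebra
        then have r2: "3 * X\<^sup>2 + 2 * coefA (s ?\<theta>) * X - (y - coefB (s ?\<theta>)) = 0"
          using \<rho>0 \<epsilon>0 by simp
        have "y = 1 \<or> y = omega \<or> y = omega\<^sup>2 * strand (g ?\<theta>)"
          by (rule cubic_double_root[OF s0[OF \<theta>] lift[OF \<theta>] r1 r2])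
        moreover have "fstc p = of_real (?r p) * unit (?\<theta> / 3) * y" unfolding zy \<rho>2 \<epsilon>2 by (simp only: mult_ac)
        ultimately have "p \<in> range (braid_knot g)"
          using braid_knot_mem[of p y g] False p g by blast
        then show False using p by blast
      qed
    qed
    fix p assume p: "sndc p = of_real (?r p)"
    have "turn (sndc p) = 0"
    proof (cases "?r p = 0")
      case True
      then show ?thesis by (simp add: turn_def Arg2pi_0)
    next
      case False
      then have "turn (of_real (?r p) * 1) = turn 1" by (intro turn_scale) simp
      also have "\<dots> = 0" using turn_unit[of 0] by simp
      finally show ?thesis using p by simp
    qed
    then show "A p = 0 \<and> B p = - fstc p \<and> C p = of_real (sqrt (?r p) ^ 3) * coefC spin_base"
      by (simp add: A_def B_def C_def ends)
  qed
qed

section \<open>Cubics over the complement of an unknotted curve\<close>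

text \<open>
  The roots are continuous functions on the simply connected base, and the translation permutes
  them. A permutation of three elements without fixed points is a 3-cycle and leaves the product of
  the differences invariant.
\<close>

lemma periodic_cubic_roots:
  fixes P :: "'b::real_normed_vector \<times> real \<Rightarrow> complex poly"
  assumes P: "root_family UNIV 3 P" and per: "\<And>z r. P (z, r + 1) = P (z, r)"
  obtains (root) x where "continuous_on UNIV x" "\<And>u. poly (P u) (x u) = 0" "\<And>z r. x (z, r + 1) = x (z, r)"
  | (cycle) V where "continuous_on UNIV V" "\<And>z r. V (z, r + 1) = V (z, r)"
      "\<And>u. \<exists>x0 x1 x2. {x. poly (P u) x = 0} = {x0, x1, x2} \<and> x0 \<noteq> x1 \<and> x1 \<noteq> x2 \<and> x0 \<noteq> x2 \<and>
         V u = (x0 - x1) * (x1 - x2) * (x2 - x0)"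
proof -
  define Z where "Z = {x. poly (P 0) x = 0}"
  have cZ: "card Z = 3" unfolding Z_def by (rule root_family_poly_eq(2)[OF P]) simp
  define sh where "sh u = (fst u, snd u + 1)" for u :: "'b \<times> real"
  have Psh: "P (sh u) = P u" for u using per[of "fst u" "snd u"] by (simp add: sh_def)
  have csh: "continuous_on UNIV sh" unfolding sh_def by (intro continuous_intros)
  have "\<exists>g. continuous_on UNIV g \<and> g 0 = z \<and> (\<forall>u. poly (P u) (g u) = 0)" if "z \<in> Z" for z
    using root_lift_exists[OF P convex_UNIV UNIV_I, of 0 z] that by (auto simp: Z_def)
  then obtain L where L: "\<And>z. z \<in> Z \<Longrightarrow> continuous_on UNIV (L z)" "\<And>z. z \<in> Z \<Longrightarrow> L z 0 = z"
      "\<And>z u. z \<in> Z \<Longrightarrow> poly (P u) (L z u) = 0"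
    by metis
  have uniq: "f y = h y" if "continuous_on UNIV f" "\<And>u. poly (P u) (f u) = 0"
      "continuous_on UNIV h" "\<And>u. poly (P u) (h u) = 0" "f u = h u" for f h u y
    by (rule root_lift_unique[OF P connected_UNIV UNIV_I UNIV_I]) (use that in auto)
  \<comment> \<open>The permutation of the roots at the base point that is induced by the translation.\<close>
  define \<tau> where "\<tau> z = L z (sh 0)" for z
  have \<tau>Z: "\<tau> z \<in> Z" if "z \<in> Z" for z
    using L(3)[OF that, of "sh 0"] by (simp add: Psh Z_def \<tau>_def)
  have Lsh: "L z (sh u) = L (\<tau> z) u" if "z \<in> Z" for z u
  proof (rule uniq[of "\<lambda>u. L z (sh u)" "L (\<tau> z)" 0])
    show "continuous_on UNIV (\<lambda>u. L z (sh u))"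
      by (rule continuous_on_compose2[OF L(1)[OF that] csh]) simp
    show "poly (P u) (L z (sh u)) = 0" for u using L(3)[OF that, of "sh u"] by (simp add: Psh)
    show "L z (sh 0) = L (\<tau> z) 0" using L(2)[OF \<tau>Z[OF that]] by (simp add: \<tau>_def)
  qed (use L \<tau>Z[OF that] in auto)
  have distinct: "L z u \<noteq> L z' u" if "z \<in> Z" "z' \<in> Z" "z \<noteq> z'" for z z' u
    using uniq[OF L(1)[OF that(1)] L(3)[OF that(1)] L(1)[OF that(2)] L(3)[OF that(2)], of u 0]
      L(2)[OF that(1)] L(2)[OF that(2)] that(3) by auto
  have \<tau>inj: "\<tau> z \<noteq> \<tau> z'" if "z \<in> Z" "z' \<in> Z" "z \<noteq> z'" for z z'
    using distinct[OF that] by (simp add: \<tau>_def)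
  show thesis
  proof (cases "\<exists>z\<in>Z. \<tau> z = z")
    case True
    then obtain z where z: "z \<in> Z" "\<tau> z = z" by blast
    show thesis
    proof (rule root[of "L z"])
      show "L z (y, r + 1) = L z (y, r)" for y r
        using Lsh[OF z(1), of "(y, r)"] z(2) by (simp add: sh_def)
    qed (use L z in auto)
  next
    case False
    then have nofix: "\<tau> z \<noteq> z" if "z \<in> Z" for z using that by blast
    have "Z \<noteq> {}" using cZ by auto
    then obtain a where a: "a \<in> Z" by blast
    define b c where "b = \<tau> a" and "c = \<tau> b"
    have b: "b \<in> Z" "b \<noteq> a" using \<tau>Z[OF a] nofix[OF a] by (auto simp: b_def)
    have c: "c \<in> Z" "c \<noteq> b" using \<tau>Z[OF b(1)] nofix[OF b(1)] by (auto simp: c_def)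
    have ca: "c \<noteq> a"
    proof
      assume "c = a"
      have "\<not> Z \<subseteq> {a, b}" using card_mono[of "{a, b}" Z] cZ b(2) by auto
      then obtain d where d: "d \<in> Z" "d \<noteq> a" "d \<noteq> b" by blast
      have Zd: "Z = {a, b, d}"
        by (rule sym, rule card_subset_eq) (use a b d cZ card_ge_0_finite[of Z] in auto)
      show False
        using \<tau>Z[OF d(1)] nofix[OF d(1)] \<tau>inj[OF d(1) a d(2)] \<tau>inj[OF d(1) b(1) d(3)] \<open>c = a\<close>
        unfolding Zd b_def[symmetric] c_def[symmetric] by auto
    qed
    have Zc: "Z = {a, b, c}"
      by (rule sym, rule card_subset_eq) (use a b c ca cZ card_ge_0_finite[of Z] in auto)
    have \<tau>c: "\<tau> c = a"
      using \<tau>Z[OF c(1)] nofix[OF c(1)] \<tau>inj[OF c(1) a ca] unfolding Zc b_def[symmetric] by auto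
    define V where "V u = (L a u - L b u) * (L b u - L c u) * (L c u - L a u)" for u
    show thesis
    proof (rule cycle[of V])
      show "continuous_on UNIV V" unfolding V_def by (intro continuous_intros L(1) a b c)
      have "V (sh u) = V u" for u
        unfolding V_def Lsh[OF a] Lsh[OF b(1)] Lsh[OF c(1)] \<tau>c b_def[symmetric] c_def[symmetric] by (simp only: mult_ac)
      from this[of "(_, _)"] show "V (z, r + 1) = V (z, r)" for z r by (simp add: sh_def)
      fix u
      have ne: "L a u \<noteq> L b u" "L b u \<noteq> L c u" "L a u \<noteq> L c u"
        using distinct a b c ca by metis+
      have "{L a u, L b u, L c u} = {x. poly (P u) x = 0}"
      proof (rule card_subset_eq)
        show "finite {x. poly (P u) x = 0}" by (rule root_family_poly_eq(3)[OF P]) simp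
        show "{L a u, L b u, L c u} \<subseteq> {x. poly (P u) x = 0}" using L(3) a b c by auto
        have "card {x. poly (P u) x = 0} = 3" by (rule root_family_poly_eq(2)[OF P]) simp
        then show "card {L a u, L b u, L c u} = card {x. poly (P u) x = 0}" using ne by simp
      qed
      then show "\<exists>x0 x1 x2. {x. poly (P u) x = 0} = {x0, x1, x2} \<and> x0 \<noteq> x1 \<and> x1 \<noteq> x2 \<and> x0 \<noteq> x2 \<and>
         V u = (x0 - x1) * (x1 - x2) * (x2 - x0)"
        using ne by (intro exI[of _ "L a u"] exI[of _ "L b u"] exI[of _ "L c u"]) (simp add: V_def)
    qed
  qed
qed

lemma circle_reparam_surj:
  assumes "circle_reparam \<phi>" obtains x where "\<phi> x = y"
proof -
  have c: "continuous_on UNIV \<phi>" and p: "\<And>x. \<phi> (x + 1) = \<phi> x + 1"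
    using assms by (auto simp: circle_reparam_def)
  have pn: "\<phi> (x + real n) = \<phi> x + real n" for x n
  proof (induction n)
    case (Suc n)
    then show ?case using p[of "x + real n"] by (simp add: add_ac)
  qed simp
  obtain n where n: "\<bar>y - \<phi> 0\<bar> \<le> real n" using real_arch_simple by blast
  have "\<phi> (- real n) \<le> y" "y \<le> \<phi> (real n)" using n pn[of "- real n" n] pn[of 0 n] by auto
  from IVT'[of \<phi>, OF this] show thesis
    using that continuous_on_subset[OF c] by auto
qed

text \<open>
  Functions invariant under the translation descend from the product of a plane and a line to the
  open solid torus outside of the first coordinate circle, on which the unknot lies.
\<close>

lemma solid_torus_function:
  fixes x :: "complex \<times> real \<Rightarrow> complex"
  assumes "continuous_on UNIV x" and per: "\<And>z r. x (z, r + 1) = x (z, r)"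
  shows "continuous_on {p. sndc p \<noteq> 0} (\<lambda>p. x (fstc p / of_real (cmod (sndc p)), turn (sndc p)))"
proof -
  have "continuous_on ({0..1} \<times> UNIV) (\<lambda>(t, y). x (y, t))"
    unfolding case_prod_beta by (rule continuous_on_compose2[OF assms(1)]) (auto intro!: continuous_intros)
  from circle_function_continuous[OF this] per[of _ 0]
  have c: "continuous_on ((- {0}) \<times> UNIV) (\<lambda>(w, y). x (y, turn w))" by simp
  have "continuous_on {p. sndc p \<noteq> 0} ((\<lambda>(w, y). x (y, turn w)) \<circ> (\<lambda>p. (sndc p, fstc p / of_real (cmod (sndc p)))))"
    by (intro continuous_on_compose continuous_intros continuous_on_subset[OF c]) auto
  then show ?thesis by (simp add: o_def)
qed

text \<open>
  The homeomorphism at the end of the isotopy carries the complement of \<open>K\<close> to the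
  complement of the unknot, which is parametrized by \<open>\<Psi>\<close>, an open solid torus
  unrolled to the product of a plane and a line.
\<close>

lemma unknotted_cubic_roots:
  assumes K: "range K \<subseteq> S3" and iso: "isotopic K unknot" and P: "root_family (S3 - range K) 3 P"
  obtains (root) x where "continuous_on (S3 - range K) x" "\<And>p. p \<in> S3 - range K \<Longrightarrow> poly (P p) (x p) = 0"
  | (cycle) V where "continuous_on (S3 - range K) V"
      "\<And>p. p \<in> S3 - range K \<Longrightarrow> \<exists>x0 x1 x2. {x. poly (P p) x = 0} = {x0, x1, x2} \<and> x0 \<noteq> x1 \<and> x1 \<noteq> x2 \<and> x0 \<noteq> x2 \<and>
         V p = (x0 - x1) * (x1 - x2) * (x2 - x0)"
proof -
  obtain H \<phi> where H: "ambient_isotopy H" "circle_reparam \<phi>" "\<And>x. H 1 (K x) = unknot (\<phi> x)"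
    using iso unfolding isotopic_def by blast
  define f where "f = H 1"
  obtain g where hom: "homeomorphism S3 S3 f g"
    using H(1) unfolding ambient_isotopy_def f_def by (meson atLeastAtMost_iff order_refl zero_le_one)
  have fg: "f (g q) = q" "g q \<in> S3" if "q \<in> S3" for q
    using hom that by (auto simp: homeomorphism_def)
  have gf: "g (f p) = p" "f p \<in> S3" if "p \<in> S3" for p
    using hom that by (auto simp: homeomorphism_def)
  define \<Psi> where "\<Psi> u = proj (emb (fst u) (unit (snd u)))" for u
  have \<Psi>S: "\<Psi> u \<in> S3" for u unfolding \<Psi>_def by (intro proj_in_S3 emb_unit_nonzero)
  have c\<Psi>: "continuous_on UNIV \<Psi>"
    unfolding \<Psi>_def by (intro continuous_on_proj continuous_intros emb_unit_nonzero)
  have g\<Psi>: "g (\<Psi> u) \<in> S3 - range K" for u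
  proof -
    have "g (\<Psi> u) \<noteq> K x" for x
    proof
      assume "g (\<Psi> u) = K x"
      then have "\<Psi> u = unknot (\<phi> x)" using fg(1)[OF \<Psi>S[of u]] H(3)[of x] by (simp add: f_def)
      then have "sndc (\<Psi> u) = 0" by (simp add: unknot_emb)
      then show False using emb_unit_nonzero[of "fst u" "snd u"] by (simp add: \<Psi>_def proj_def)
    qed
    then show ?thesis using fg(2)[OF \<Psi>S[of u]] by blast
  qed
  have cg: "continuous_on UNIV (\<lambda>u. g (\<Psi> u))"
    by (rule continuous_on_compose2[OF homeomorphism_cont2[OF hom] c\<Psi>]) (use \<Psi>S in auto)
  have R: "root_family UNIV 3 (\<lambda>u. P (g (\<Psi> u)))"
    unfolding root_family_def
  proof (intro conjI allI)
    show "\<forall>b\<in>UNIV. lead_coeff (P (g (\<Psi> b))) = 1 \<and> degree (P (g (\<Psi> b))) = 3 \<and> rsquarefree (P (g (\<Psi> b)))"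
      using P g\<Psi> unfolding root_family_def by blast
    fix X
    have "continuous_on (S3 - range K) (\<lambda>p. poly (P p) X)" using P unfolding root_family_def by blast
    then show "continuous_on UNIV (\<lambda>b. poly (P (g (\<Psi> b))) X)"
      by (rule continuous_on_compose2[OF _ cg]) (rule image_subsetI, rule g\<Psi>)
  qed
  have per: "P (g (\<Psi> (z, r + 1))) = P (g (\<Psi> (z, r)))" for z r
  proof -
    have "unit (r + 1) = unit r" by (simp add: unit_eq_iff)
    then show ?thesis by (simp add: \<Psi>_def)
  qed
  \<comment> \<open>A discontinuous section of the unrolling; continuous periodic functions composed with it are
      continuous.\<close>
  define \<Phi> where "\<Phi> p = (fstc (f p) / of_real (cmod (sndc (f p))), turn (sndc (f p)))" for p
  have snd0: "sndc (f p) \<noteq> 0" if p: "p \<in> S3 - range K" for p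
  proof
    assume 0: "sndc (f p) = 0"
    then have fp: "f p = emb (fstc (f p)) 0" using emb_fstc_sndc[of "f p"] by simp
    then have "cmod (fstc (f p)) = 1" using gf(2)[of p] p norm_emb[of "fstc (f p)" 0] by simp
    then have "unit (turn (fstc (f p))) = fstc (f p)" using unit_turn[of "fstc (f p)"] by fastforce
    then have "f p = unknot (turn (fstc (f p)))" using fp by (simp add: unknot_emb)
    moreover obtain x where "\<phi> x = turn (fstc (f p))" by (rule circle_reparam_surj[OF H(2)])
    ultimately have "f p = f (K x)" using H(3)[of x] by (simp add: f_def)
    then have "p = K x" using gf(1)[of p] gf(1)[of "K x"] p K by (metis DiffD1 range_subsetD)
    then show False using p by blast
  qed
  have \<Phi>: "g (\<Psi> (\<Phi> p)) = p" if p: "p \<in> S3 - range K" for p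
  proof -
    let ?r = "cmod (sndc (f p))"
    have r: "?r > 0" using snd0[OF p] by simp
    have "f p = ?r *\<^sub>R emb (fstc (f p) / of_real ?r) (unit (turn (sndc (f p))))"
      unfolding emb_scaleR using unit_turn[OF snd0[OF p]] r emb_fstc_sndc[of "f p"]
      by (simp add: scaleR_conv_of_real)
    then have "\<Psi> (\<Phi> p) = proj (f p)" unfolding \<Psi>_def \<Phi>_def fst_conv snd_conv using proj_scale[OF r] by metis
    then show ?thesis using proj_S3[OF gf(2)] gf(1) p by simp
  qed
  have pull: "continuous_on (S3 - range K) (\<lambda>p. x (\<Phi> p))"
    if "continuous_on UNIV x" "\<And>z r. x (z, r + 1) = x (z, r)" for x :: "complex \<times> real \<Rightarrow> complex"
    unfolding \<Phi>_def
    by (rule continuous_on_compose2[OF solid_torus_function[OF that] continuous_on_subset[OF homeomorphism_cont1[OF hom]]])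
       (use snd0 in auto)
  from R per show thesis
  proof (cases rule: periodic_cubic_roots)
    case (root x)
    have "poly (P p) (x (\<Phi> p)) = 0" if "p \<in> S3 - range K" for p
      using root(2)[of "\<Phi> p"] \<Phi>[OF that] by simp
    then show thesis using that(1)[OF pull[OF root(1,3)]] by blast
  next
    case (cycle V)
    show thesis
    proof (rule that(2)[OF pull[OF cycle(1,2)]])
      fix p assume "p \<in> S3 - range K"
      from cycle(3)[of "\<Phi> p", unfolded \<Phi>[OF this]]
      show "\<exists>x0 x1 x2. {x. poly (P p) x = 0} = {x0, x1, x2} \<and> x0 \<noteq> x1 \<and> x1 \<noteq> x2 \<and> x0 \<noteq> x2 \<and>
         V (\<Phi> p) = (x0 - x1) * (x1 - x2) * (x2 - x0)" .
    qed
  qed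
qed

text \<open>
  At angle 0 the moving strand is at its base position, so that the strands are the three cube roots
  of unity.
\<close>

lemma braid_knot_slice:
  assumes g: "g 0 = base" and z: "z ^ 3 \<noteq> 1"
  shows "proj (emb z 1) \<notin> range (braid_knot g)"
proof
  assume "proj (emb z 1) \<in> range (braid_knot g)"
  then obtain x where x: "proj (emb z 1) = proj (emb (unit x * strand (g (max 0 (3 * frac x - 2)))) (unit (3 * x)))"
    by (auto simp: braid_knot_def)
  have "emb z 1 \<noteq> 0" by (metis emb_0 emb_eq_iff zero_neq_one)
  then obtain c where c: "c > 0" "emb z 1 = c *\<^sub>R emb (unit x * strand (g (max 0 (3 * frac x - 2)))) (unit (3 * x))"
    using proj_eqD[OF x _ emb_unit_nonzero] by blast
  then have zc: "z = c *\<^sub>R (unit x * strand (g (max 0 (3 * frac x - 2))))" and 1: "1 = c *\<^sub>R unit (3 * x)"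
    unfolding emb_scaleR emb_eq_iff by blast+
  have "cmod 1 = c" using arg_cong[OF 1, of cmod] c(1) by simp
  then have "c = 1" by simp
  then have u: "unit (3 * x) = unit 0" using 1 by simp
  then have "3 * x \<in> \<int>" unfolding unit_eq_iff by simp
  then obtain k :: int where k: "3 * x = of_int k" by (auto elim: Ints_cases)
  have "3 * frac x < 3" using frac_lt_1[of x] by simp
  moreover have fx: "3 * frac x = of_int (k - 3 * \<lfloor>x\<rfloor>)" using k by (simp add: frac_def)
  ultimately have "k - 3 * \<lfloor>x\<rfloor> < 3" by linarith
  then have "3 * frac x \<le> 2" unfolding fx by linarith
  then have "z = unit x" using zc g \<open>c = 1\<close> by (simp add: max_def strand_values)
  then have "z ^ 3 = 1" using u by (simp add: unit_power)
  then show False using z by blast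
qed

text \<open>
  On the slice \<open>q\<close>, where the second coordinate is a positive number, the family of
  cubics is \<open>X ^ 3 - z * X + d\<close> up to the scaling of the roots by
  \<open>\<rho>\<close>. Neither a continuous root nor a continuous square root of the discriminant
  exists there.
\<close>

theorem braid_knot_not_unknot:
  assumes g: "g 0 = base" and s: "spin_lift g spin_base (- spin_base)"
  shows "\<not> isotopic (braid_knot g) unknot"
proof
  assume iso: "isotopic (braid_knot g) unknot"
  let ?K = "range (braid_knot g)"
  obtain s where s: "path s" "s 0 = spin_base" "s 1 = - spin_base"
    and lift: "\<And>t. t \<in> {0..1} \<Longrightarrow> poly (quartic (g t)) ((s t)\<^sup>2) = 0"
    using s unfolding spin_lift_def pathstart_def pathfinish_def by blast
  obtain A B C where P: "root_family (S3 - ?K) 3 (\<lambda>p. cubic (A p) (B p) (C p))"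
    and ABC: "\<And>p. sndc p = of_real (cmod (sndc p)) \<Longrightarrow> A p = 0 \<and> B p = - fstc p \<and>
      C p = of_real (sqrt (cmod (sndc p)) ^ 3) * coefC spin_base"
    using braid_knot_cubic_family[OF g s(1)[unfolded path_def] s(2,3) lift] by blast
  define d where "d = coefC spin_base"
  define q where "q z = proj (emb z 1)" for z
  define F where "F = {z :: complex. z ^ 3 = 1}"
  have F: "finite F" unfolding F_def by (rule finite_roots_unity) simp
  have ne: "emb z 1 \<noteq> 0" for z by (metis emb_0 emb_eq_iff zero_neq_one)
  have q: "q z \<in> S3 - ?K" if "z \<in> - F" for z
    using braid_knot_slice[where g = g, OF g, of z] that proj_in_S3[OF ne[of z]] by (simp add: q_def F_def)
  have cq: "continuous_on (- F) q" unfolding q_def by (intro continuous_on_proj continuous_intros ne)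
  \<comment> \<open>\<open>\<rho> z\<close> is the square root of the second coordinate of \<open>q z\<close>.\<close>
  define \<rho> where "\<rho> z = (of_real (sqrt (inverse (norm (emb z 1)))) :: complex)" for z
  have \<rho>0: "\<rho> z \<noteq> 0" for z using ne[of z] by (simp add: \<rho>_def)
  have c\<rho>: "continuous_on (- F) \<rho>" unfolding \<rho>_def using ne by (intro continuous_intros) auto
  have coef: "A (q z) = 0" "B (q z) = - ((\<rho> z)\<^sup>2 * z)" "C (q z) = (\<rho> z) ^ 3 * d" for z
  proof -
    have n: "norm (emb z 1) > 0" using ne[of z] by simp
    have s: "sndc (q z) = of_real (inverse (norm (emb z 1)))" "fstc (q z) = of_real (inverse (norm (emb z 1))) * z"
      unfolding q_def proj_def fstc_scaleR sndc_scaleR fstc_emb sndc_emb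
      by (simp_all only: scaleR_conv_of_real mult_1_right)
    have m: "cmod (sndc (q z)) = inverse (norm (emb z 1))" unfolding s(1) norm_of_real using n by simp
    have r2: "(\<rho> z)\<^sup>2 = of_real (inverse (norm (emb z 1)))"
      unfolding \<rho>_def using n by (simp flip: of_real_power)
    show "A (q z) = 0" "B (q z) = - ((\<rho> z)\<^sup>2 * z)" "C (q z) = (\<rho> z) ^ 3 * d"
      using ABC[of "q z"] unfolding m r2 s(2) by (simp_all add: s(1) \<rho>_def d_def)
  qed
  have eval: "poly (cubic (A (q z)) (B (q z)) (C (q z))) x = (\<rho> z) ^ 3 * ((x / \<rho> z) ^ 3 - z * (x / \<rho> z) + d)" for z x
    unfolding cubic_eval coef using \<rho>0[of z] by (simp add: field_simps power2_eq_square power3_eq_cube)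
  have d0: "d \<noteq> 0" using coef_base(3) by (simp add: d_def)
  have K: "?K \<subseteq> S3" using braid_knot_in_S3 by blast
  from K iso P show False
  proof (cases rule: unknotted_cubic_roots)
    case (root x)
    have "(0::complex) \<in> - F" by (simp add: F_def)
    then have "card {x. poly (cubic (A (q 0)) (B (q 0)) (C (q 0))) x = 0} = 3"
      by (rule root_family_poly_eq(2)[OF P q])
    then obtain X Y Z where XYZ: "{x. poly (cubic (A (q 0)) (B (q 0)) (C (q 0))) x = 0} = {X, Y, Z}" "X \<noteq> Y"
      unfolding card_3_iff by blast
    then have "poly (cubic (A (q 0)) (B (q 0)) (C (q 0))) X = 0" "poly (cubic (A (q 0)) (B (q 0)) (C (q 0))) Y = 0"
      by blast+
    then have XY: "(X / \<rho> 0) ^ 3 - 0 * (X / \<rho> 0) + d = 0" "(Y / \<rho> 0) ^ 3 - 0 * (Y / \<rho> 0) + d = 0"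
      unfolding eval using \<rho>0[of 0] by (metis mult_eq_0_iff power_not_zero)+
    show False
    proof (rule no_root_section[OF d0 F _ _ \<open>0 \<in> - F\<close> _ XY])
      show "continuous_on (- F) (\<lambda>z. x (q z) / \<rho> z)"
        by (intro continuous_on_divide c\<rho> continuous_on_compose2[OF root(1) cq]) (use q \<rho>0 in auto)
      show "X / \<rho> 0 \<noteq> Y / \<rho> 0" using XYZ(2) \<rho>0[of 0] by simp
      fix z assume "z \<in> - F"
      from root(2)[OF q[OF this]] show "(x (q z) / \<rho> z) ^ 3 - z * (x (q z) / \<rho> z) + d = 0"
        unfolding eval using \<rho>0[of z] by simp
    qed
  next
    case (cycle V)
    show False
    proof (rule no_discriminant_root[OF F])
      show "continuous_on (- F) (\<lambda>z. V (q z) / (\<rho> z) ^ 3)"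
        by (intro continuous_on_divide continuous_on_power c\<rho> continuous_on_compose2[OF cycle(1) cq]) (use q \<rho>0 in auto)
      fix z assume z: "z \<in> - F"
      obtain x0 x1 x2 where x: "{x. poly (cubic (A (q z)) (B (q z)) (C (q z))) x = 0} = {x0, x1, x2}"
        "x0 \<noteq> x1" "x1 \<noteq> x2" "x0 \<noteq> x2" "V (q z) = (x0 - x1) * (x1 - x2) * (x2 - x0)"
        using cycle(2)[OF q[OF z]] by blast
      have "(V (q z))\<^sup>2 = ((\<rho> z) ^ 3)\<^sup>2 * (4 * z ^ 3 - 27 * d\<^sup>2)"
        unfolding x(5) cubic_vandermonde[OF x(1-4)] coef
        by (simp add: power_mult_distrib algebra_simps flip: power_mult)
      then show "(V (q z) / (\<rho> z) ^ 3)\<^sup>2 = 4 * z ^ 3 - 27 * d\<^sup>2"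
        using \<rho>0[of z] by (simp add: power_divide)
    qed
  qed
qed

section \<open>The theorem on finite-type invariants\<close>

theorem theoremB:
  fixes v :: "curve \<Rightarrow> 'a::ab_group_add"
  assumes "knot_invariant v"
    and "\<And>K. tame_knot K \<Longrightarrow> v K = v unknot \<Longrightarrow> isotopic K unknot"
  shows "\<not> finite_type v"
proof
  assume "finite_type v"
  then obtain m where "v (word_knot (on (flipping_word m))) = v unknot"
    by (rule finite_type_flipping_word[OF assms(1)])
  moreover have "tame_knot (word_knot (on (flipping_word m)))" by (rule off_or_on_tame) auto
  ultimately have "isotopic (word_knot (on (flipping_word m))) unknot" by (intro assms(2))
  moreover have "word_loop (on (flipping_word m)) 0 = base"
    by (simp add: word_loop_def flip: pathstart_def)
  ultimately show False
    using braid_knot_not_unknot[OF _ flipping_word_loop_lift] by blast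
qed

end
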